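(* Let $\phi\colon\mathbb{R}\to\mathbb{R}$ be an increasing homeomorphism with $\phi(0)=0$, $f\colon\mathbb{R}\to\mathbb{R}$ continuous, and $g\colon[0,T]\times\mathbb{R}\to\mathbb{R}$ a Carathéodory function. For $s\in\mathbb{R}$ consider $$(\phi(u'))'+f(u)u'+g(t,u)=s.\qquad(\mathscr{E}_s)$$ Assume: $(H_0)$ for all $t_0\in[0,T]$, $u_0\in\mathbb{R}$, $\varepsilon>0$ there is $\delta>0$ such that $|t-t_0|<\delta$, $|u-u_0|<\delta$ imply $|g(t,u)-g(t,u_0)|<\varepsilon$ for a.e. $t$; $(H_1^{\rm I})$ there is $\gamma_0\in L^1([0,T],\mathbb{R}^+)$ with $g(t,u)\ge-\gamma_0(t)$ for all $u$ and a.e. $t$; $(H_2^{\rm I})$ there are $u_0,g_0\in\mathbb{R}$ with $g(t,u_0)\le g_0$ for a.e. $t$; $(H_3^{\rm I})$ there exist $\sigma>\max\{0,g_0\}$ and $d>0$ such that $\frac1T\int_0^Tg(t,u(t))\,dt>\sigma$ for every $u\in\mathcal{C}^1_T$ with $u(t)\le-d$ for all $t$. Let $\sigma^*$ be the supremum of those $\sigma\in\,]g_0,+\infty[$ for which $(H_3^{\rm I})$ holds with this $\sigma$ (for some $d>0$). Then there exists $s_0\in\,]-\infty,\sigma^*[$ such that: for $s_0<s<\sigma^*$, $(\mathscr{E}_s)$ has at least one $T$-periodic solution; for $s<s_0$, $(\mathscr{E}_s)$ has no $T$-periodic solutions. Moreover, if also $(H_4^{\rm I})$ there exist $\sigma>\max\{0,g_0\}$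 and $d>0$ such that $\frac1T\int_0^Tg(t,u(t))\,dt>\sigma$ for every $u\in\mathcal{C}^1_T$ with $u(t)\ge d$ for all $t$, holds, and $\sigma^{**}$ denotes the supremum of those $\sigma\in\,]g_0,\sigma^*]$ for which $(H_4^{\rm I})$ holds with this $\sigma$, then: for $s=s_0$, $(\mathscr{E}_s)$ has at least one $T$-periodic solution; for $s_0<s<\sigma^{**}$, $(\mathscr{E}_s)$ has at least two $T$-periodic solutions.
   Context: $\mathcal{C}^1_T=\{u\in\mathcal{C}^1([0,T]):u(0)=u(T),\,u'(0)=u'(T)\}$. A $T$-periodic solution of $(\mathscr{E}_s)$ is $u\in\mathcal{C}^1_T$ with $\phi(u')$ absolutely continuous satisfying the equation a.e. A Carathéodory function is measurable in $t$, continuous in $u$, and for each $r>0$ bounded in absolute value on $[0,T]\times[-r,r]$ by an $L^1$ function of $t$. $\mathbb{R}^+$ denotes the nonnegative reals. *)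

theory Defs
  imports "HOL-Analysis.Analysis"
begin

definition abs_continuous_on :: "real \<Rightarrow> real \<Rightarrow> (real \<Rightarrow> real) \<Rightarrow> bool" where
  "abs_continuous_on a b v \<longleftrightarrow>
     (\<forall>e>0. \<exists>d>0. \<forall>(n::nat) (x::nat \<Rightarrow> real) (y::nat \<Rightarrow> real).
        (\<forall>i<n. a \<le> x i \<and> x i \<le> y i \<and> y i \<le> b) \<and>
        (\<forall>i<n. \<forall>j<n. i \<noteq> j \<longrightarrow> {x i<..<y i} \<inter> {x j<..<y j} = {}) \<and>
        (\<Sum>i<n. y i - x i) < d
        \<longrightarrow> (\<Sum>i<n. \<bar>v (y i) - v (x i)\<bar>) < e)"

definition C1_T :: "real \<Rightarrow> (real \<Rightarrow> real) \<Rightarrow> bool" where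
  "C1_T T u \<longleftrightarrow>
     (\<exists>u'. (\<forall>t\<in>{0..T}. (u has_real_derivative u' t) (at t within {0..T})) \<and>
           continuous_on {0..T} u' \<and> u 0 = u T \<and> u' 0 = u' T)"

definition caratheodory :: "real \<Rightarrow> (real \<Rightarrow> real \<Rightarrow> real) \<Rightarrow> bool" where
  "caratheodory T g \<longleftrightarrow>
     (\<forall>u. (\<lambda>t. g t u) \<in> borel_measurable (lebesgue_on {0..T})) \<and>
     (\<forall>t\<in>{0..T}. continuous_on UNIV (g t)) \<and>
     (\<forall>r>0. \<exists>h. integrable (lebesgue_on {0..T}) h \<and>
                 (\<forall>t\<in>{0..T}. \<forall>u. \<bar>u\<bar> \<le> r \<longrightarrow> \<bar>g t u\<bar> \<le> h t))"

definition periodic_solution ::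
  "(real \<Rightarrow> real) \<Rightarrow> (real \<Rightarrow> real) \<Rightarrow> (real \<Rightarrow> real \<Rightarrow> real) \<Rightarrow> real \<Rightarrow> real \<Rightarrow> (real \<Rightarrow> real) \<Rightarrow> bool" where
  "periodic_solution \<phi> f g T s u \<longleftrightarrow>
     (\<exists>u'. (\<forall>t\<in>{0..T}. (u has_real_derivative u' t) (at t within {0..T})) \<and>
           continuous_on {0..T} u' \<and> u 0 = u T \<and> u' 0 = u' T \<and>
           abs_continuous_on 0 T (\<lambda>t. \<phi> (u' t)) \<and>
           (\<exists>w. AE t in lebesgue_on {0..T}.
                  ((\<lambda>\<tau>. \<phi> (u' \<tau>)) has_real_derivative w t) (at t within {0..T}) \<and>
                  w t + f (u t) * u' t + g t (u t) = s))"

definition H3_I :: "real \<Rightarrow> (real \<Rightarrow> real \<Rightarrow> real) \<Rightarrow> real \<Rightarrow> real \<Rightarrow> real \<Rightarrow> bool" where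
  "H3_I T g g0 \<sigma> d \<longleftrightarrow> \<sigma> > max 0 g0 \<and> d > 0 \<and>
     (\<forall>u. C1_T T u \<and> (\<forall>t\<in>{0..T}. u t \<le> - d) \<longrightarrow>
          (1 / T) * integral\<^sup>L (lebesgue_on {0..T}) (\<lambda>t. g t (u t)) > \<sigma>)"

definition H4_I :: "real \<Rightarrow> (real \<Rightarrow> real \<Rightarrow> real) \<Rightarrow> real \<Rightarrow> real \<Rightarrow> real \<Rightarrow> bool" where
  "H4_I T g g0 \<sigma> d \<longleftrightarrow> \<sigma> > max 0 g0 \<and> d > 0 \<and>
     (\<forall>u. C1_T T u \<and> (\<forall>t\<in>{0..T}. u t \<ge> d) \<longrightarrow>
          (1 / T) * integral\<^sup>L (lebesgue_on {0..T}) (\<lambda>t. g t (u t)) > \<sigma>)"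

end

theory Submission
  imports Defs "HOL-Complex_Analysis.Great_Picard"
begin

text \<open>The proof uses the Schauder fixed point theorem instead of degree theory. Let \<open>F\<close> be a primitive of
  \<open>f\<close>. Integrating the equation once, a periodic solution with parameter \<open>\<mu>\<close> is a fixed point of
  \<open>u \<mapsto> b\<^sub>0 + \<integral> \<phi>\<^sup>-\<^sup>1 (a - F (u) - \<integral> (g (u) - \<mu>))\<close>, where \<open>\<mu>\<close> is the mean of \<open>g (t, u)\<close> and \<open>a\<close> is determined by
  periodicity. The remaining constant \<open>b\<^sub>0\<close> is fixed by prescribing \<open>c = max (u - b)\<close>, where \<open>b\<close> solves the
  problem for some smaller parameter \<open>s\<^sub>1 < s\<close> (or is the constant \<open>u\<^sub>0\<close>).

  The level \<open>c\<close> is treated as a further unknown, updated by \<open>c := c \<plusminus> (\<mu> - s)\<close> and clipped to an interval. At a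
  fixed point either \<open>\<mu> = s\<close>, or \<open>c\<close> is an end of the interval and \<open>\<mu> - s\<close> has a definite sign there. At the
  end \<open>c = 0\<close> this is excluded by (H0), since \<open>u\<close> would touch the strict upper solution \<open>b\<close> from below; at the other
  end it is excluded by (H3) or (H4), since the oscillation of \<open>u\<close> is bounded a priori. The interval \<open>[-C, 0]\<close>
  yields a solution below \<open>b\<close>, and \<open>[0, C]\<close> yields a second one that exceeds \<open>b\<close> somewhere. Finally, \<open>s\<^sub>0\<close> is
  the infimum of the solvable parameters, and it is attained by compactness.\<close>

section \<open>Lebesgue differentiation and absolutely continuous functions\<close>

hide_const (open) Polynomial.content

text \<open>Lebesgue's differentiation theorem for the gauge integral. Where the difference quotient
  misses \<open>q t\<close> by more than \<open>e\<close> at arbitrarily near points, Vitali's lemma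
  selects disjoint offending segments, and Henstock's lemma bounds the sum of the misses, hence the
  total length.\<close>

lemma negligible_not_has_derivative_indefinite_integral:
  fixes q :: "real \<Rightarrow> real"
  assumes q: "q integrable_on {a..b}"
  shows "negligible {t \<in> {a..b}. \<not> ((\<lambda>x. integral {a..x} q) has_real_derivative q t) (at t within {a..b})}"
proof -
  define F where "F x = integral {a..x} q" for x
  define E where "E e = {t \<in> {a..b}. \<forall>d>0. \<exists>y\<in>{a..b}. y \<noteq> t \<and> \<bar>y - t\<bar> < d \<and>
      \<bar>F y - F t - q t * (y - t)\<bar> > e * \<bar>y - t\<bar>}" for e
  have F_diff: "integral {x..y} q = F y - F x" if "a \<le> x" "x \<le> y" "y \<le> b" for x y
  proof -
    have "integral {a..x} q + integral {x..y} q = integral {a..y} q"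
      by (rule Henstock_Kurzweil_Integration.integral_combine)
         (use that q in \<open>auto intro: integrable_subinterval_real\<close>)
    then show ?thesis by (simp add: F_def)
  qed
  have neg: "negligible (E e)" if "e > 0" for e
    unfolding negligible_outer_le
  proof (intro allI impI)
    fix \<epsilon> :: real assume "\<epsilon> > 0"
    \<comment> \<open>A miss of \<open>e\<close> per unit length turns the error
      \<open>e * \<epsilon> / 5\<close> into total length \<open>\<epsilon> / 5\<close>, and the
      enlargement in Vitali's covering lemma multiplies lengths by 5.\<close>
    then have pos: "e * \<epsilon> / 5 > 0" using \<open>e > 0\<close> by simp
    have "q integrable_on cbox a b" using q by simp
    from Henstock_lemma[OF this pos] obtain \<gamma> where \<gamma>: "gauge \<gamma>"
      and hen: "\<And>p. \<lbrakk>p tagged_partial_division_of (cbox a b); \<gamma> fine p\<rbrakk> \<Longrightarrow>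
             sum (\<lambda>(x,k). norm (content k *\<^sub>R q x - integral k q)) p < e * \<epsilon> / 5"
      by blast
    \<comment> \<open>The ball is the segment between \<open>t\<close> and \<open>y\<close>, so its
      tag is an endpoint and the integral over it is an increment of \<open>F\<close>. The bound 1
      is the uniform bound on radii that the covering lemma asks for.\<close>
    have "\<exists>y. y \<in> {a..b} \<and> y \<noteq> t \<and> \<bar>y - t\<bar> \<le> 1 \<and> cball ((t + y) / 2) (\<bar>y - t\<bar> / 2) \<subseteq> \<gamma> t \<and>
        \<bar>F y - F t - q t * (y - t)\<bar> > e * \<bar>y - t\<bar>" if t: "t \<in> E e" for t
    proof -
      from \<gamma> have "open (\<gamma> t)" "t \<in> \<gamma> t" by (auto simp: gauge_def)
      then obtain d where d: "d > 0" "ball t d \<subseteq> \<gamma> t" using open_contains_ball by blast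
      then have "min d 1 > 0" by simp
      with t obtain y where y: "y \<in> {a..b}" "y \<noteq> t" "\<bar>y - t\<bar> < min d 1"
        "\<bar>F y - F t - q t * (y - t)\<bar> > e * \<bar>y - t\<bar>"
        unfolding E_def by blast
      have "cball ((t + y) / 2) (\<bar>y - t\<bar> / 2) \<subseteq> ball t d"
      proof
        fix z assume "z \<in> cball ((t + y) / 2) (\<bar>y - t\<bar> / 2)"
        then have "\<bar>(t + y) / 2 - z\<bar> \<le> \<bar>y - t\<bar> / 2" by (simp add: dist_real_def)
        then have "\<bar>t - z\<bar> \<le> \<bar>y - t\<bar>" by argo
        then show "z \<in> ball t d" using y(3) by (simp add: dist_real_def)
      qed
      with y d show ?thesis by (intro exI[of _ y]) auto
    qed
    then obtain y where y: "\<And>t. t \<in> E e \<Longrightarrow> y t \<in> {a..b} \<and> y t \<noteq> t \<and> \<bar>y t - t\<bar> \<le> 1 \<and>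
        cball ((t + y t) / 2) (\<bar>y t - t\<bar> / 2) \<subseteq> \<gamma> t \<and>
        \<bar>F (y t) - F t - q t * (y t - t)\<bar> > e * \<bar>y t - t\<bar>"
      by metis
    define c r where "c t = (t + y t) / 2" and "r t = \<bar>y t - t\<bar> / 2" for t
    have Esub: "E e \<subseteq> {a..b}" by (auto simp: E_def)
    have r: "0 < r t \<and> r t \<le> 1" if "t \<in> E e" for t using y[OF that] by (auto simp: r_def)
    have "E e \<subseteq> (\<Union>t\<in>E e. cball (c t) (r t))"
    proof
      fix t assume "t \<in> E e"
      have "t \<in> cball (c t) (r t)" unfolding c_def r_def mem_cball dist_real_def by argo
      with \<open>t \<in> E e\<close> show "t \<in> (\<Union>t\<in>E e. cball (c t) (r t))" by blast
    qed
    then obtain C where C: "countable C" "C \<subseteq> E e"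
      "pairwise (\<lambda>i j. disjnt (cball (c i) (r i)) (cball (c j) (r j))) C"
      "E e \<subseteq> (\<Union>i\<in>C. cball (c i) (5 * r i))"
      using Vitali_covering_lemma_cballs[of "E e" c r "E e" 1, OF _ r] by blast
    have fin: "(\<Sum>t\<in>D. 2 * r t) \<le> \<epsilon> / 5" if D: "finite D" "D \<subseteq> C" for D
    proof -
      define p where "p = (\<lambda>t. (t, cball (c t) (r t))) ` D"
      have inj: "inj_on (\<lambda>t. (t, cball (c t) (r t))) D" by (auto simp: inj_on_def)
      have DE: "D \<subseteq> E e" using D C by auto
      have cb: "cball (c t) (r t) = cbox (min t (y t)) (max t (y t))" for t
        by (cases "t \<le> y t") (simp_all add: c_def r_def cball_eq_atLeastAtMost field_simps)
      have part: "p tagged_partial_division_of (cbox a b)"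
        unfolding tagged_partial_division_of_def
      proof (intro conjI allI impI)
        show "finite p" using D by (simp add: p_def)
        fix x K assume xK: "(x, K) \<in> p"
        then have x: "x \<in> D" "K = cball (c x) (r x)" by (auto simp: p_def)
        show "x \<in> K" unfolding x(2) cb by auto
        show "K \<subseteq> cbox a b" unfolding x(2) cb using y[of x] x(1) DE Esub by auto
        show "\<exists>a b. K = cbox a b" unfolding x(2) cb by blast
      next
        fix x K x' K' assume "(x, K) \<in> p \<and> (x', K') \<in> p \<and> (x, K) \<noteq> (x', K')"
        then have x: "x \<in> D" "K = cball (c x) (r x)" and x': "x' \<in> D" "K' = cball (c x') (r x')" "x \<noteq> x'"
          by (auto simp: p_def)
        then have "disjnt K K'" using C(3) x D by (auto simp: pairwise_def)
        then show "interior K \<inter> interior K' = {}"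
          using interior_subset by (fastforce simp: disjnt_def)
      qed
      have fine: "\<gamma> fine p"
        using y DE by (auto simp: fine_def p_def c_def r_def)
      have "(\<Sum>t\<in>D. e * (2 * r t)) \<le> (\<Sum>t\<in>D. norm (content (cball (c t) (r t)) *\<^sub>R q t - integral (cball (c t) (r t)) q))"
      proof (rule sum_mono)
        fix t assume t: "t \<in> D"
        have tE: "t \<in> E e" "t \<in> {a..b}" using t DE Esub by auto
        note yt = y[OF tE(1)]
        have le: "e * \<bar>y t - t\<bar> \<le> \<bar>F (y t) - F t - q t * (y t - t)\<bar>" using yt by simp
        show "e * (2 * r t) \<le> norm (content (cball (c t) (r t)) *\<^sub>R q t - integral (cball (c t) (r t)) q)"
        proof (cases "y t > t")
          case True
          then have i: "integral (cball (c t) (r t)) q = F (y t) - F t"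
            unfolding cb using F_diff[of t "y t"] tE yt by simp
          have co: "content (cball (c t) (r t)) = y t - t" unfolding cb using True by simp
          show ?thesis unfolding i co using le True by (simp add: r_def algebra_simps abs_minus_commute)
        next
          case False
          with yt have lt: "y t < t" by auto
          then have i: "integral (cball (c t) (r t)) q = F t - F (y t)"
            unfolding cb using F_diff[of "y t" t] tE yt by simp
          have co: "content (cball (c t) (r t)) = t - y t" unfolding cb using lt by simp
          show ?thesis unfolding i co using le lt by (simp add: r_def algebra_simps)
        qed
      qed
      also have "\<dots> = sum (\<lambda>(x,k). norm (content k *\<^sub>R q x - integral k q)) p"
        unfolding p_def by (subst sum.reindex[OF inj]) (simp add: o_def)
      also have "\<dots> < e * \<epsilon> / 5" by (rule hen[OF part fine])
      finally show ?thesis using \<open>e > 0\<close> by (simp add: sum_distrib_left[symmetric] field_simps)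
    qed
    have bound: "measure lebesgue (\<Union>i\<in>D. cball (c i) (5 * r i)) \<le> \<epsilon>" if D: "D \<subseteq> C" "finite D" for D
    proof -
      have "measure lebesgue (\<Union>i\<in>D. cball (c i) (5 * r i)) \<le> (\<Sum>i\<in>D. measure lebesgue (cball (c i) (5 * r i)))"
        by (rule measure_UNION_le) (use D in auto)
      also have "\<dots> = (\<Sum>i\<in>D. 5 * (2 * r i))"
        using r D C by (intro sum.cong) (auto simp: cball_eq_atLeastAtMost subset_eq less_imp_le)
      also have "\<dots> \<le> \<epsilon>" using fin[OF D(2,1)] by (simp add: sum_distrib_left[symmetric])
      finally show ?thesis .
    qed
    show "\<exists>T. E e \<subseteq> T \<and> T \<in> lmeasurable \<and> measure lebesgue T \<le> \<epsilon>"
      using C(4) fmeasurable_UN_bound[OF C(1) _ bound] measure_UN_bound[OF C(1) _ bound]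
      by (intro exI[of _ "\<Union>i\<in>C. cball (c i) (5 * r i)"]) auto
  qed
  have "{t \<in> {a..b}. \<not> (F has_real_derivative q t) (at t within {a..b})} \<subseteq> (\<Union>k::nat. E (1 / Suc k))"
  proof
    fix t assume t: "t \<in> {t \<in> {a..b}. \<not> (F has_real_derivative q t) (at t within {a..b})}"
    show "t \<in> (\<Union>k::nat. E (1 / Suc k))"
    proof (rule ccontr)
      assume "\<not> ?thesis"
      then have nE: "t \<notin> E (1 / Suc k)" for k by auto
      have "(F has_real_derivative q t) (at t within {a..b})"
        unfolding has_field_derivative_def has_derivative_within_alt
      proof (intro conjI allI impI)
        show "bounded_linear ((*) (q t))" by (rule bounded_linear_mult_right)
        fix e :: real assume "e > 0"
        then obtain k :: nat where k: "1 / Suc k < e" using nat_approx_posE by metis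
        have "t \<in> {a..b}" using t by simp
        with nE[of k] obtain d where d: "d > 0" "\<And>y. y \<in> {a..b} \<Longrightarrow> y \<noteq> t \<Longrightarrow> \<bar>y - t\<bar> < d \<Longrightarrow>
          \<bar>F y - F t - q t * (y - t)\<bar> \<le> 1 / Suc k * \<bar>y - t\<bar>"
          unfolding E_def mem_Collect_eq by (metis (no_types, lifting) not_less)
        show "\<exists>d>0. \<forall>y\<in>{a..b}. norm (y - t) < d \<longrightarrow> norm (F y - F t - q t * (y - t)) \<le> e * norm (y - t)"
        proof (intro exI[of _ d] conjI ballI impI)
          fix y assume "y \<in> {a..b}" "norm (y - t) < d"
          then show "norm (F y - F t - q t * (y - t)) \<le> e * norm (y - t)"
            using d(2)[of y] mult_right_mono[OF less_imp_le[OF k], of "\<bar>y - t\<bar>"] by (cases "y = t") force+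
        qed (fact d)
      qed
      with t show False by simp
    qed
  qed
  moreover have "negligible (\<Union>k::nat. E (1 / Suc k))"
    by (intro negligible_countable_Union) (auto intro!: neg)
  ultimately show ?thesis unfolding F_def by (rule negligible_subset[rotated])
qed

text \<open>Fundamental theorem of calculus for absolutely continuous functions. Tags off
  \<open>N\<close> are handled by differentiability; tags in \<open>N\<close> are confined by the
  gauge to an open set of measure below the \<open>d\<close> of absolute continuity, so the
  increments of \<open>v\<close> over their intervals sum to less than \<open>e / 2\<close>.\<close>

lemma abs_continuous_on_has_integral:
  fixes v w :: "real \<Rightarrow> real"
  assumes ac: "abs_continuous_on a b v" and ab: "a \<le> b" and N: "negligible N"
    and deriv: "\<And>t. t \<in> {a..b} - N \<Longrightarrow> (v has_real_derivative w t) (at t within {a..b})"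
  shows "(w has_integral (v b - v a)) {a..b}"
proof -
  \<comment> \<open>With \<open>w\<close> set to 0 on \<open>N\<close>, a tag in \<open>N\<close>
    contributes only an increment of \<open>v\<close> to the error of the Riemann sum.\<close>
  define w0 where "w0 t = (if t \<in> N then 0 else w t)" for t
  have "(w0 has_integral (v b - v a)) (cbox a b)"
    unfolding has_integral
  proof (intro allI impI)
    fix e :: real assume e: "e > 0"
    \<comment> \<open>The summand 1 keeps the denominator positive when \<open>a = b\<close> and
      makes the bound by \<open>e / 2\<close> strict.\<close>
    define \<epsilon> where "\<epsilon> = e / (2 * (b - a + 1))"
    have \<epsilon>: "\<epsilon> > 0" "\<epsilon> * (b - a) < e / 2" using e ab by (auto simp: \<epsilon>_def field_simps)
    have "e / 2 > 0" using e by simp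
    from mp[OF spec[OF ac[unfolded abs_continuous_on_def], of "e / 2"] this]
    obtain d where "d > 0 \<and> (\<forall>(n::nat) x y. (\<forall>i<n. a \<le> x i \<and> x i \<le> y i \<and> y i \<le> b) \<and>
          (\<forall>i<n. \<forall>j<n. i \<noteq> j \<longrightarrow> {x i<..<y i} \<inter> {x j<..<y j} = {}) \<and>
          (\<Sum>i<n. y i - x i) < d \<longrightarrow> (\<Sum>i<n. \<bar>v (y i) - v (x i)\<bar>) < e / 2)" ..
    note d = conjunct1[OF this] and dd = conjunct2[OF this]
    from N d obtain S where S: "N \<subseteq> S" "S \<in> lmeasurable" "measure lebesgue S < d / 2"
      unfolding negligible_outer by (meson half_gt_zero)
    obtain G where G: "open G" "S \<subseteq> G" "G - S \<in> lmeasurable" "emeasure lebesgue (G - S) < ennreal (d / 2)"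
      using sets_lebesgue_outer_open[OF fmeasurableD[OF S(2)], of "d / 2"] d by (metis half_gt_zero)
    have GS: "G = S \<union> (G - S)" using G by auto
    have Gm: "G \<in> lmeasurable" using S G fmeasurable.Un[OF S(2) G(3)] GS by simp
    have mGS: "measure lebesgue (G - S) < d / 2" using G(3,4) d
      by (simp add: emeasure_eq_measure2 ennreal_less_iff)
    have Gd: "measure lebesgue G < d"
      using measure_Un_le[of S lebesgue "G - S"] S G mGS GS by (auto simp: fmeasurableD)
    have "\<exists>r>0. \<forall>y\<in>{a..b}. \<bar>y - t\<bar> < r \<longrightarrow> \<bar>v y - v t - w t * (y - t)\<bar> \<le> \<epsilon> * \<bar>y - t\<bar>"
      if "t \<in> {a..b} - N" for t
      using deriv[OF that] \<epsilon>(1) unfolding has_field_derivative_def has_derivative_within_alt by (metis real_norm_def)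
    then obtain r where r: "\<And>t. t \<in> {a..b} - N \<Longrightarrow> r t > 0"
      "\<And>t y. t \<in> {a..b} - N \<Longrightarrow> y \<in> {a..b} \<Longrightarrow> \<bar>y - t\<bar> < r t \<Longrightarrow> \<bar>v y - v t - w t * (y - t)\<bar> \<le> \<epsilon> * \<bar>y - t\<bar>"
      by metis
    define \<gamma> where "\<gamma> t = (if t \<in> N then G else if t \<in> {a..b} then ball t (r t) else ball t 1)" for t
    have gauge: "gauge \<gamma>"
      using G S r(1) by (auto simp: gauge_def \<gamma>_def)
    show "\<exists>\<gamma>. gauge \<gamma> \<and> (\<forall>\<D>. \<D> tagged_division_of cbox a b \<and> \<gamma> fine \<D> \<longrightarrow>
        norm ((\<Sum>(x, k)\<in>\<D>. content k *\<^sub>R w0 x) - (v b - v a)) < e)"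
    proof (intro exI[of _ \<gamma>] conjI allI impI gauge)
      fix p assume p: "p tagged_division_of cbox a b \<and> \<gamma> fine p"
      then have p': "p tagged_division_of {a..b}" by simp
      have finp: "finite p" using p by auto
      have tel: "(\<Sum>(x,k)\<in>p. v (Sup k) - v (Inf k)) = v b - v a"
        by (rule additive_tagged_division_1[OF ab p'])
      have K: "\<exists>c d. k = {c..d} \<and> c \<le> d \<and> x \<in> k \<and> Inf k = c \<and> Sup k = d \<and> content k = d - c \<and> k \<subseteq> {a..b} \<and> k \<subseteq> \<gamma> x"
        if xk: "(x,k) \<in> p" for x k
      proof -
        obtain c d where "k = cbox c d" "x \<in> k" "k \<subseteq> cbox a b"
          using tagged_division_ofD(2-4)[OF conjunct1[OF p] xk] by blast
        moreover have "k \<subseteq> \<gamma> x" using p xk by (auto simp: fine_def)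
        ultimately show ?thesis by (intro exI[of _ c] exI[of _ d]) auto
      qed
      define q where "q = {(x,k) \<in> p. x \<in> N}"
      have qp: "q \<subseteq> p" by (auto simp: q_def)
      have finq: "finite q" using finp qp finite_subset by blast
      have qpart: "q tagged_partial_division_of cbox a b"
        by (rule tagged_partial_division_subset[OF _ qp])
           (use p in \<open>simp add: tagged_division_of_def\<close>)
      have qdiv: "q tagged_division_of \<Union>(snd ` q)"
        by (rule tagged_partial_division_of_Union_self[OF qpart])
      have Un: "\<Union>(snd ` q) \<subseteq> G"
      proof
        fix z assume "z \<in> \<Union>(snd ` q)"
        then obtain x k where "(x,k) \<in> q" "z \<in> k" by force
        then show "z \<in> G" using K[of x k] by (auto simp: q_def \<gamma>_def)
      qed
      have "(\<Sum>(x,k)\<in>q. content k) = (\<Sum>k\<in>snd ` q. content k)"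
        by (rule sum.over_tagged_division_lemma[OF qdiv]) (simp add: content_eq_0_interior)
      also have "\<dots> = (\<Sum>k\<in>snd ` q. measure lebesgue k)"
      proof (rule sum.cong[OF refl])
        fix k assume "k \<in> snd ` q"
        then obtain c d where "k = cbox c d" using K qp by force
        then show "content k = measure lebesgue k" by simp
      qed
      also have "\<dots> = measure lebesgue (\<Union>(snd ` q))"
        using content_division[OF division_of_tagged_division[OF qdiv]] .
      also have "\<dots> \<le> measure lebesgue G"
        by (rule measure_mono_fmeasurable[OF Un _ Gm])
           (use division_of_tagged_division[OF qdiv] lmeasurable_division in blast)
      finally have cont: "(\<Sum>(x,k)\<in>q. content k) < d" using Gd by simp
      \<comment> \<open>Absolute continuity is stated for finite sequences of intervals, so the
        pieces with tags in \<open>N\<close> are enumerated.\<close>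
      obtain h where h: "bij_betw h {..<card q} q"
        using ex_bij_betw_nat_finite[OF finq] by (auto simp: atLeast0LessThan)
      define X Y where "X i = Inf (snd (h i))" and "Y i = Sup (snd (h i))" for i
      have hq: "h i \<in> q" if "i < card q" for i using h that by (auto simp: bij_betw_def)
      have "(\<Sum>i<card q. \<bar>v (Y i) - v (X i)\<bar>) < e / 2"
      proof (rule mp[OF dd[THEN spec, THEN spec, THEN spec]], intro conjI)
        have hp: "\<exists>c d. snd (h i) = {c..d} \<and> c \<le> d \<and> X i = c \<and> Y i = d \<and> content (snd (h i)) = d - c \<and> snd (h i) \<subseteq> {a..b}"
          if "i < card q" for i
          using K[of "fst (h i)" "snd (h i)"] hq[OF that] qp unfolding X_def Y_def by auto
        show "\<forall>i<card q. a \<le> X i \<and> X i \<le> Y i \<and> Y i \<le> b"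
          using hp by fastforce
        show "\<forall>i<card q. \<forall>j<card q. i \<noteq> j \<longrightarrow> {X i<..<Y i} \<inter> {X j<..<Y j} = {}"
        proof (intro allI impI)
          fix i j assume ij: "i < card q" "j < card q" "i \<noteq> j"
          then have ne: "h i \<noteq> h j" using h by (auto simp: bij_betw_def inj_on_def)
          have "interior (snd (h i)) \<inter> interior (snd (h j)) = {}"
            using tagged_partial_division_ofD(5)[OF qpart, of "fst (h i)" "snd (h i)" "fst (h j)" "snd (h j)"] hq ij ne
            by (auto simp: prod_eq_iff)
          then show "{X i<..<Y i} \<inter> {X j<..<Y j} = {}"
            using hp[OF ij(1)] hp[OF ij(2)] by auto
        qed
        have "(\<Sum>i<card q. Y i - X i) = (\<Sum>i<card q. content (snd (h i)))"
          using hp by (intro sum.cong) force+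
        also have "\<dots> = (\<Sum>z\<in>q. content (snd z))" by (rule sum.reindex_bij_betw[OF h])
        finally show "(\<Sum>i<card q. Y i - X i) < d" using cont by (simp add: case_prod_unfold)
      qed
      also have "(\<Sum>i<card q. \<bar>v (Y i) - v (X i)\<bar>) = (\<Sum>z\<in>q. \<bar>v (Sup (snd z)) - v (Inf (snd z))\<bar>)"
        unfolding X_def Y_def by (rule sum.reindex_bij_betw[OF h])
      finally have q1: "(\<Sum>z\<in>q. \<bar>v (Sup (snd z)) - v (Inf (snd z))\<bar>) < e / 2" .
      have q2: "(\<Sum>z\<in>p-q. \<bar>content (snd z) * w0 (fst z) - (v (Sup (snd z)) - v (Inf (snd z)))\<bar>) \<le> (\<Sum>z\<in>p-q. \<epsilon> * content (snd z))"
      proof (rule sum_mono)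
        fix z assume z: "z \<in> p - q"
        obtain x k where zz: "z = (x,k)" by force
        obtain c d where cd: "k = {c..d}" "c \<le> d" "x \<in> k" "Inf k = c" "Sup k = d" "content k = d - c" "k \<subseteq> {a..b}" "k \<subseteq> \<gamma> x"
          using K[of x k] z zz by blast
        have xN: "x \<notin> N" "x \<in> {a..b}" using z zz q_def cd by auto
        have "c \<in> {a..b}" "d \<in> {a..b}" "c \<in> \<gamma> x" "d \<in> \<gamma> x" using cd by auto
        then have "\<bar>v c - v x - w x * (c - x)\<bar> \<le> \<epsilon> * \<bar>c - x\<bar>" "\<bar>v d - v x - w x * (d - x)\<bar> \<le> \<epsilon> * \<bar>d - x\<bar>"
          using xN by (auto intro!: r(2) simp: \<gamma>_def dist_real_def abs_minus_commute)
        moreover have "\<bar>c - x\<bar> = x - c" "\<bar>d - x\<bar> = d - x" using cd by auto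
        ultimately have "\<bar>v c - v x - w x * (c - x)\<bar> \<le> \<epsilon> * (x - c)" "\<bar>v d - v x - w x * (d - x)\<bar> \<le> \<epsilon> * (d - x)"
          by auto
        moreover have "(d - c) * w x - (v d - v c) = (v c - v x - w x * (c - x)) - (v d - v x - w x * (d - x))"
          by (simp add: algebra_simps)
        moreover have "\<epsilon> * (x - c) + \<epsilon> * (d - x) = \<epsilon> * (d - c)" by (simp add: algebra_simps)
        ultimately have "\<bar>(d - c) * w x - (v d - v c)\<bar> \<le> \<epsilon> * (d - c)" by linarith
        then show "\<bar>content (snd z) * w0 (fst z) - (v (Sup (snd z)) - v (Inf (snd z)))\<bar> \<le> \<epsilon> * content (snd z)"
          using zz cd xN by (simp add: w0_def)
      qed
      also have "\<dots> \<le> (\<Sum>z\<in>p. \<epsilon> * content (snd z))"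
        using \<epsilon>(1) finp by (intro sum_mono2) auto
      also have "\<dots> = \<epsilon> * (b - a)"
        using additive_content_tagged_division[of p a b] p ab by (simp add: sum_distrib_left[symmetric] case_prod_unfold)
      also have "\<dots> < e / 2" by (fact \<epsilon>)
      finally have q2: "(\<Sum>z\<in>p-q. \<bar>content (snd z) * w0 (fst z) - (v (Sup (snd z)) - v (Inf (snd z)))\<bar>) < e / 2" .
      have "(\<Sum>(x, k)\<in>p. content k *\<^sub>R w0 x) - (v b - v a)
          = (\<Sum>z\<in>p. content (snd z) * w0 (fst z) - (v (Sup (snd z)) - v (Inf (snd z))))"
        unfolding tel[symmetric] by (simp add: sum_subtractf case_prod_unfold)
      also have "\<dots> = (\<Sum>z\<in>p-q. content (snd z) * w0 (fst z) - (v (Sup (snd z)) - v (Inf (snd z))))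
          + (\<Sum>z\<in>q. content (snd z) * w0 (fst z) - (v (Sup (snd z)) - v (Inf (snd z))))"
        by (rule sum.subset_diff[OF qp finp])
      finally have "\<bar>(\<Sum>(x, k)\<in>p. content k *\<^sub>R w0 x) - (v b - v a)\<bar>
          \<le> (\<Sum>z\<in>p-q. \<bar>content (snd z) * w0 (fst z) - (v (Sup (snd z)) - v (Inf (snd z)))\<bar>)
          + (\<Sum>z\<in>q. \<bar>content (snd z) * w0 (fst z) - (v (Sup (snd z)) - v (Inf (snd z)))\<bar>)"
        by (simp only:) (intro order_trans[OF abs_triangle_ineq] add_mono sum_abs)
      also have "(\<Sum>z\<in>q. \<bar>content (snd z) * w0 (fst z) - (v (Sup (snd z)) - v (Inf (snd z)))\<bar>)
          = (\<Sum>z\<in>q. \<bar>v (Sup (snd z)) - v (Inf (snd z))\<bar>)"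
        by (intro sum.cong) (auto simp: q_def w0_def)
      finally show "norm ((\<Sum>(x, k)\<in>p. content k *\<^sub>R w0 x) - (v b - v a)) < e"
        using q1 q2 by simp
    qed
  qed
  then show ?thesis
    using has_integral_spike[OF N, of "{a..b}" w w0] by (auto simp: w0_def)
qed

section \<open>A fixed point theorem for Lipschitz operators\<close>

lemma coordinatewise_convergent_subsequence:
  fixes X :: "nat \<Rightarrow> nat \<Rightarrow> real"
  assumes "\<And>k j. j < N \<Longrightarrow> \<bar>X k j\<bar> \<le> B j"
  shows "\<exists>\<sigma> x. strict_mono (\<sigma>::nat \<Rightarrow> nat) \<and> (\<forall>j<N. (\<lambda>k. X (\<sigma> k) j) \<longlonglongrightarrow> x j)"
  using assms
proof (induction N)
  case 0
  show ?case by (intro exI[of _ id]) (auto simp: strict_mono_def)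
next
  case (Suc N)
  then obtain \<sigma> x where \<sigma>: "strict_mono (\<sigma>::nat \<Rightarrow> nat)" "\<And>j. j < N \<Longrightarrow> (\<lambda>k. X (\<sigma> k) j) \<longlonglongrightarrow> x j"
    by (metis less_SucI)
  have "bounded (range (\<lambda>k. X (\<sigma> k) N))"
    unfolding bounded_iff using Suc.prems[of N] by (auto intro!: exI[of _ "B N"])
  from bounded_imp_convergent_subsequence[OF this] obtain l r where r: "strict_mono (r::nat \<Rightarrow> nat)"
    "((\<lambda>k. X (\<sigma> k) N) \<circ> r) \<longlonglongrightarrow> l" by blast
  show ?case
  proof (intro exI[of _ "\<sigma> \<circ> r"] exI[of _ "x(N := l)"] conjI allI impI)
    show "strict_mono (\<sigma> \<circ> r)" using \<sigma> r by (auto intro: strict_mono_compose simp: strict_mono_o)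
    fix j assume "j < Suc N"
    show "(\<lambda>k. X ((\<sigma> \<circ> r) k) j) \<longlonglongrightarrow> (x(N := l)) j"
    proof (cases "j = N")
      case False
      with \<open>j < Suc N\<close> \<sigma> have "(\<lambda>k. X (\<sigma> k) j) \<longlonglongrightarrow> x j" by simp
      from LIMSEQ_subseq_LIMSEQ[OF this r(1)] False show ?thesis by (simp add: o_def)
    qed (use r in \<open>simp add: o_def\<close>)
  qed
qed

text \<open>The dimension is a variable here, which the library version over the class
  \<open>euclidean_space\<close> does not allow.\<close>

lemma brouwer_box:
  fixes f :: "(nat \<Rightarrow> real) \<Rightarrow> nat \<Rightarrow> real" and l r :: "nat \<Rightarrow> real"
  assumes lr: "\<And>i. i < N \<Longrightarrow> l i \<le> r i"
    and self: "\<And>x i. (\<And>j. j < N \<Longrightarrow> x j \<in> {l j..r j}) \<Longrightarrow> i < N \<Longrightarrow> f x i \<in> {l i..r i}"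
    and cont: "\<And>X x i. (\<And>k j. j < N \<Longrightarrow> X k j \<in> {l j..r j}) \<Longrightarrow>
        (\<And>j. j < N \<Longrightarrow> (\<lambda>k. X k j) \<longlonglongrightarrow> x j) \<Longrightarrow> i < N \<Longrightarrow> (\<lambda>k. f (X k) i) \<longlonglongrightarrow> f x i"
  shows "\<exists>x. (\<forall>j<N. x j \<in> {l j..r j}) \<and> (\<forall>i<N. f x i = x i)"
proof -
  \<comment> \<open>Kuhn's combinatorial conclusion at mesh \<open>1 / p\<close>: near one point
    \<open>Y\<close>, each coordinate \<open>i\<close> has its own witnesses \<open>A i\<close> and
    \<open>B i\<close> for the two signs of \<open>f x i - x i\<close>.\<close>
  define Q where "Q p Y A B \<longleftrightarrow> (\<forall>i<N. Y i \<in> {l i..r i} \<and> f (A i) i \<ge> A i i \<and> f (B i) i \<le> B i i \<and>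
      (\<forall>j<N. A i j \<in> {l j..r j} \<and> B i j \<in> {l j..r j} \<and>
        \<bar>A i j - Y j\<bar> \<le> (r j - l j) / p \<and> \<bar>B i j - Y j\<bar> \<le> (r j - l j) / p))"
    for p :: nat and Y A B
  have "\<exists>Y A B. Q p Y A B"
    if p: "p > 0" for p :: nat
  proof -
    define pt where "pt q = (\<lambda>i. l i + (r i - l i) * (real (q i) / p))" for q :: "nat \<Rightarrow> nat"
    \<comment> \<open>Label 0 records that coordinate \<open>i\<close> does not decrease under
      \<open>f\<close>, label 1 that it does not increase. The values that \<open>kuhn_lemma\<close>
      prescribes on the two faces are consistent with this because \<open>f\<close> maps the box
      into itself.\<close>
    define label where "label q i = (if q i = 0 then 0 else if q i = p then 1
        else if f (pt q) i \<ge> pt q i then 0 else (1::nat))" for q i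
    have pt: "pt q j \<in> {l j..r j}" if "q j \<le> p" "j < N" for q j
    proof -
      have "real (q j) / p \<le> 1" "real (q j) / p \<ge> 0" using that p by auto
      then have "(r j - l j) * (real (q j) / p) \<le> r j - l j" "(r j - l j) * (real (q j) / p) \<ge> 0"
        using lr[OF that(2)] by (auto simp del: times_divide_eq_right intro!: mult_left_le mult_nonneg_nonneg)
      then show ?thesis by (auto simp: pt_def)
    qed
    have lab: "(label q i = 0 \<longrightarrow> f (pt q) i \<ge> pt q i) \<and> (label q i = 1 \<longrightarrow> f (pt q) i \<le> pt q i)"
      if "\<And>j. j < N \<Longrightarrow> q j \<le> p" "i < N" for q i
    proof -
      have "f (pt q) i \<in> {l i..r i}" using self[of "pt q" i] pt that by blast
      moreover have "q i = 0 \<Longrightarrow> pt q i = l i" "q i = p \<Longrightarrow> pt q i = r i" using p by (auto simp: pt_def)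
      ultimately show ?thesis using p by (auto simp: label_def)
    qed
    obtain q where q: "\<forall>i<N. q i < p"
      "\<forall>i<N. \<exists>R S. (\<forall>j<N. q j \<le> R j \<and> R j \<le> q j + 1) \<and> (\<forall>j<N. q j \<le> S j \<and> S j \<le> q j + 1) \<and> label R i \<noteq> label S i"
    proof (rule kuhn_lemma[of p N label])
      show "0 < p" by (fact p)
    qed (use p in \<open>auto simp: label_def\<close>)
    have near: "\<bar>pt Q j - pt q j\<bar> \<le> (r j - l j) / p" if "j < N" "q j \<le> Q j" "Q j \<le> q j + 1" for Q j
    proof -
      have "pt Q j - pt q j = (r j - l j) / p * (real (Q j) - real (q j))"
        by (simp add: pt_def field_simps diff_divide_distrib)
      moreover have "\<bar>real (Q j) - real (q j)\<bar> \<le> 1" using that by auto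
      ultimately show ?thesis using lr[OF that(1)] p
        by (simp add: abs_mult mult_left_le divide_right_mono)
    qed
    have "\<exists>A B. f A i \<ge> A i \<and> f B i \<le> B i \<and>
      (\<forall>j<N. A j \<in> {l j..r j} \<and> B j \<in> {l j..r j} \<and>
        \<bar>A j - pt q j\<bar> \<le> (r j - l j) / p \<and> \<bar>B j - pt q j\<bar> \<le> (r j - l j) / p)" if i: "i < N" for i
    proof -
      from q(2) i obtain R S where RS: "\<And>j. j < N \<Longrightarrow> q j \<le> R j \<and> R j \<le> q j + 1"
        "\<And>j. j < N \<Longrightarrow> q j \<le> S j \<and> S j \<le> q j + 1" "label R i \<noteq> label S i" by blast
      have le: "R j \<le> p" "S j \<le> p" if "j < N" for j using RS(1,2)[OF that] q(1) that by fastforce+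
      have in_box: "pt R j \<in> {l j..r j}" "pt S j \<in> {l j..r j}"
        "\<bar>pt R j - pt q j\<bar> \<le> (r j - l j) / p" "\<bar>pt S j - pt q j\<bar> \<le> (r j - l j) / p" if "j < N" for j
        using that le pt near RS(1,2) by auto
      have "label R i = 0 \<or> label R i = 1" "label S i = 0 \<or> label S i = 1" by (auto simp: label_def)
      with RS(3) consider "label R i = 0" "label S i = 1" | "label S i = 0" "label R i = 1" by auto
      then show ?thesis
      proof cases
        case 1
        then show ?thesis using in_box lab[OF le(1) i] lab[OF le(2) i]
          by (intro exI[of _ "pt R"] exI[of _ "pt S"]) auto
      next
        case 2
        then show ?thesis using in_box lab[OF le(1) i] lab[OF le(2) i]
          by (intro exI[of _ "pt S"] exI[of _ "pt R"]) auto
      qed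
    qed
    then obtain A B where "\<And>i. i < N \<Longrightarrow> f (A i) i \<ge> A i i \<and> f (B i) i \<le> B i i \<and>
      (\<forall>j<N. A i j \<in> {l j..r j} \<and> B i j \<in> {l j..r j} \<and>
        \<bar>A i j - pt q j\<bar> \<le> (r j - l j) / p \<and> \<bar>B i j - pt q j\<bar> \<le> (r j - l j) / p)" by metis
    moreover have "pt q i \<in> {l i..r i}" if "i < N" for i
      using pt[of q i] q(1) that by (simp add: less_imp_le)
    ultimately have "Q p (pt q) A B" unfolding Q_def by simp
    then show ?thesis by blast
  qed
  then have "\<forall>k. \<exists>Y A B. Q (Suc k) Y A B" by blast
  then obtain Y A B where Q: "\<And>k. Q (Suc k) (Y k) (A k) (B k)" by metis
  note YAB = Q[unfolded Q_def, rule_format]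
  have "\<bar>Y k j\<bar> \<le> max \<bar>l j\<bar> \<bar>r j\<bar>" if "j < N" for k j using YAB[OF that, of k] by auto
  from coordinatewise_convergent_subsequence[of N Y "\<lambda>j. max \<bar>l j\<bar> \<bar>r j\<bar>", OF this] obtain \<sigma> x where
    \<sigma>: "strict_mono (\<sigma>::nat \<Rightarrow> nat)" and x: "\<And>j. j < N \<Longrightarrow> (\<lambda>k. Y (\<sigma> k) j) \<longlonglongrightarrow> x j" by blast
  have lim0: "(\<lambda>k. (r j - l j) / Suc (\<sigma> k)) \<longlonglongrightarrow> 0" for j
    using LIMSEQ_subseq_LIMSEQ[OF LIMSEQ_Suc[OF lim_const_over_n[of "r j - l j"]] \<sigma>] by (simp add: o_def)
  have conv: "(\<lambda>k. Z (\<sigma> k) j) \<longlonglongrightarrow> x j"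
    if "j < N" "\<And>k. \<bar>Z k j - Y k j\<bar> \<le> (r j - l j) / Suc k" for j and Z :: "nat \<Rightarrow> nat \<Rightarrow> real"
  proof -
    have "(\<lambda>k. Z (\<sigma> k) j - Y (\<sigma> k) j) \<longlonglongrightarrow> 0"
      by (rule Lim_null_comparison[OF _ lim0[of j]]) (use that in auto)
    from tendsto_add[OF this x[OF that(1)]] show ?thesis by simp
  qed
  have "x j \<in> {l j..r j}" if "j < N" for j
    using LIMSEQ_le_const[OF x[OF that]] LIMSEQ_le_const2[OF x[OF that]] YAB[OF that] by auto
  \<comment> \<open>Both witnesses for coordinate \<open>i\<close> tend to \<open>x\<close>, so
    their opposite inequalities meet in the limit.\<close>
  moreover have "f x i = x i" if i: "i < N" for i
  proof (rule antisym)
    have A: "(\<lambda>k. A (\<sigma> k) i j) \<longlonglongrightarrow> x j" if "j < N" for j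
      using conv[OF that, of "\<lambda>k. A k i"] YAB[OF i] that by auto
    have B: "(\<lambda>k. B (\<sigma> k) i j) \<longlonglongrightarrow> x j" if "j < N" for j
      using conv[OF that, of "\<lambda>k. B k i"] YAB[OF i] that by auto
    have "(\<lambda>k. f (A (\<sigma> k) i) i) \<longlonglongrightarrow> f x i" using YAB[OF i] A i by (intro cont) auto
    from LIMSEQ_le[OF A[OF i] this] YAB[OF i] show "x i \<le> f x i" by auto
    have "(\<lambda>k. f (B (\<sigma> k) i) i) \<longlonglongrightarrow> f x i" using YAB[OF i] B i by (intro cont) auto
    from LIMSEQ_le[OF this B[OF i]] YAB[OF i] show "f x i \<le> x i" by auto
  qed
  ultimately show ?thesis by blast
qed

text \<open>Discontinuous functions are admitted, since the finite-dimensional approximations are step functions.\<close>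

definition admissible :: "real \<Rightarrow> real \<Rightarrow> (real \<Rightarrow> real) set" where
  "admissible T R = {v \<in> borel_measurable (lebesgue_on {0..T}). \<forall>t\<in>{0..T}. \<bar>v t\<bar> \<le> R}"

text \<open>Two scalar unknowns \<open>a\<close> and \<open>c\<close> accompany the function. The
  common Lipschitz constant \<open>L\<close> provides compactness through Arzela-Ascoli, and
  continuity is formulated for pointwise convergence so that dominated convergence can supply
  it.\<close>

locale lipschitz_operator =
  fixes T R L al ar cl cr :: real and U :: "real \<Rightarrow> real \<Rightarrow> (real \<Rightarrow> real) \<Rightarrow> real \<Rightarrow> real"
  assumes T: "T > 0" and al: "al \<le> ar" and cl: "cl \<le> cr" and R: "R \<ge> 0"
    and U_bound: "\<And>a c v t. a \<in> {al..ar} \<Longrightarrow> c \<in> {cl..cr} \<Longrightarrow> v \<in> admissible T R \<Longrightarrow> t \<in> {0..T} \<Longrightarrow> \<bar>U a c v t\<bar> \<le> R"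
    and U_lipschitz: "\<And>a c v s t. a \<in> {al..ar} \<Longrightarrow> c \<in> {cl..cr} \<Longrightarrow> v \<in> admissible T R \<Longrightarrow> s \<in> {0..T} \<Longrightarrow> t \<in> {0..T} \<Longrightarrow>
       \<bar>U a c v s - U a c v t\<bar> \<le> L * \<bar>s - t\<bar>"
    and U_cont: "\<And>ak ck vk a c v t. (\<And>k. ak k \<in> {al..ar}) \<Longrightarrow> (\<And>k. ck k \<in> {cl..cr}) \<Longrightarrow> (\<And>k. vk k \<in> admissible T R) \<Longrightarrow>
       ak \<longlonglongrightarrow> a \<Longrightarrow> ck \<longlonglongrightarrow> c \<Longrightarrow> v \<in> admissible T R \<Longrightarrow> (\<And>t. t \<in> {0..T} \<Longrightarrow> (\<lambda>k. vk k t) \<longlonglongrightarrow> v t) \<Longrightarrow> t \<in> {0..T} \<Longrightarrow>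
       (\<lambda>k. U (ak k) (ck k) (vk k) t) \<longlonglongrightarrow> U a c v t"
begin

lemma L_nonneg: "L \<ge> 0"
proof -
  have "(\<lambda>_. 0) \<in> admissible T R" using R by (auto simp: admissible_def)
  from U_lipschitz[OF _ _ this, of al cl 0 T] al cl T have "0 \<le> L * T" by auto
  with T show ?thesis by (simp add: zero_le_mult_iff)
qed

text \<open>Serves twice: with errors tending to 0 for the passage from step functions to a fixed
  point, and with error 0 for limits of solutions.\<close>

lemma approximate_fixpoints_converge:
  assumes ak: "\<And>k. ak k \<in> {al..ar}" and ck: "\<And>k. ck k \<in> {cl..cr}" and vk: "\<And>k. vk k \<in> admissible T R"
    and e: "e \<longlonglongrightarrow> 0" and approx: "\<And>k t. t \<in> {0..T} \<Longrightarrow> \<bar>vk k t - U (ak k) (ck k) (vk k) t\<bar> \<le> e k"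
  obtains \<sigma> a c u where "strict_mono (\<sigma>::nat \<Rightarrow> nat)" "(\<lambda>k. ak (\<sigma> k)) \<longlonglongrightarrow> a" "(\<lambda>k. ck (\<sigma> k)) \<longlonglongrightarrow> c"
    "a \<in> {al..ar}" "c \<in> {cl..cr}" "u \<in> admissible T R" "\<And>t. t \<in> {0..T} \<Longrightarrow> (\<lambda>k. vk (\<sigma> k) t) \<longlonglongrightarrow> u t"
    "\<And>t. t \<in> {0..T} \<Longrightarrow> U a c u t = u t"
proof -
  define W where "W k = U (ak k) (ck k) (vk k)" for k
  \<comment> \<open>Equicontinuity is available for the images \<open>W k\<close>; the
    \<open>vk k\<close> may jump, and inherit the limit because their distance to \<open>W k\<close>
    is at most \<open>e k\<close>.\<close>
  obtain u \<tau> where u: "continuous_on {0..T} u" and \<tau>: "strict_mono (\<tau> :: nat \<Rightarrow> nat)"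
    and unif: "\<And>e. 0 < e \<Longrightarrow> \<exists>N. \<forall>n x. n \<ge> N \<and> x \<in> {0..T} \<longrightarrow> norm(W (\<tau> n) x - u x) < e"
  proof (rule Arzela_Ascoli[of "{0..T}" W R])
    fix x e :: real assume x: "x \<in> {0..T}" "0 < e"
    have "norm (W n x - W n y) < e" if "y \<in> {0..T}" "norm (x - y) < e / (L + 1)" for n y
    proof -
      have "norm (W n x - W n y) \<le> L * \<bar>x - y\<bar>"
        unfolding W_def using U_lipschitz[OF ak ck vk x(1) that(1)] by simp
      also have "\<dots> \<le> L * (e / (L + 1))" using L_nonneg that by (intro mult_left_mono) auto
      also have "\<dots> < e" using L_nonneg x by (simp add: field_simps)
      finally show ?thesis .
    qed
    then show "\<exists>d. 0 < d \<and> (\<forall>n y. y \<in> {0..T} \<and> norm(x - y) < d \<longrightarrow> norm(W n x - W n y) < e)"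
      using L_nonneg x by (intro exI[of _ "e / (L + 1)"]) auto
  qed (auto simp: W_def intro!: U_bound ak ck vk)
  define X where "X k j = (if j = 0 then ak (\<tau> k) else ck (\<tau> k))" for k and j :: nat
  have "\<bar>X k j\<bar> \<le> max (max \<bar>al\<bar> \<bar>ar\<bar>) (max \<bar>cl\<bar> \<bar>cr\<bar>)" for k j
    using ak[of "\<tau> k"] ck[of "\<tau> k"] unfolding X_def atLeastAtMost_iff by (cases "j = 0") (simp_all; linarith)+
  from coordinatewise_convergent_subsequence[of 2 X "\<lambda>_. max (max \<bar>al\<bar> \<bar>ar\<bar>) (max \<bar>cl\<bar> \<bar>cr\<bar>)", OF this] obtain \<rho> x where
    \<rho>: "strict_mono (\<rho>::nat \<Rightarrow> nat)" and x: "\<And>j. j < 2 \<Longrightarrow> (\<lambda>k. X (\<rho> k) j) \<longlonglongrightarrow> x j" by blast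
  define \<sigma> where "\<sigma> = \<tau> \<circ> \<rho>"
  have \<sigma>: "strict_mono \<sigma>" using \<tau> \<rho> by (simp add: \<sigma>_def strict_mono_o)
  have a: "(\<lambda>k. ak (\<sigma> k)) \<longlonglongrightarrow> x 0" and c: "(\<lambda>k. ck (\<sigma> k)) \<longlonglongrightarrow> x 1"
    using x[of 0] x[of 1] by (auto simp: X_def \<sigma>_def)
  have W: "(\<lambda>k. W (\<sigma> k) t) \<longlonglongrightarrow> u t" if "t \<in> {0..T}" for t
  proof -
    have "(\<lambda>k. W (\<tau> k) t) \<longlonglongrightarrow> u t" using unif that unfolding LIMSEQ_iff by meson
    from LIMSEQ_subseq_LIMSEQ[OF this \<rho>] show ?thesis by (simp add: \<sigma>_def o_def)
  qed
  have v: "(\<lambda>k. vk (\<sigma> k) t) \<longlonglongrightarrow> u t" if t: "t \<in> {0..T}" for t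
  proof -
    have "(\<lambda>k. e (\<sigma> k)) \<longlonglongrightarrow> 0" using LIMSEQ_subseq_LIMSEQ[OF e \<sigma>] by (simp add: o_def)
    then have "(\<lambda>k. vk (\<sigma> k) t - W (\<sigma> k) t) \<longlonglongrightarrow> 0"
      by (rule Lim_null_comparison[rotated]) (use approx[OF t] in \<open>auto simp: W_def\<close>)
    from tendsto_add[OF this W[OF t]] show ?thesis by simp
  qed
  have "\<bar>u t\<bar> \<le> R" if t: "t \<in> {0..T}" for t
    using LIMSEQ_le_const2[OF tendsto_rabs[OF v[OF t]]] vk t by (auto simp: admissible_def)
  moreover have "u \<in> borel_measurable (lebesgue_on {0..T})"
    using u by (rule continuous_imp_measurable_on_sets_lebesgue) auto
  ultimately have uV: "u \<in> admissible T R" by (auto simp: admissible_def)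
  have "U (x 0) (x 1) u t = u t" if t: "t \<in> {0..T}" for t
  proof (rule LIMSEQ_unique[OF _ W[OF t]])
    show "(\<lambda>k. W (\<sigma> k) t) \<longlonglongrightarrow> U (x 0) (x 1) u t"
      unfolding W_def by (rule U_cont) (use ak ck vk a c uV v t in auto)
  qed
  moreover have "x 0 \<in> {al..ar}" using LIMSEQ_le_const[OF a] LIMSEQ_le_const2[OF a] ak by auto
  moreover have "x 1 \<in> {cl..cr}" using LIMSEQ_le_const[OF c] LIMSEQ_le_const2[OF c] ck by auto
  ultimately show ?thesis using that \<sigma> a c uV v by blast
qed

text \<open>A Schauder type theorem by discretisation: Brouwer's theorem is applied to
  \<open>a\<close>, \<open>c\<close> and the values of a step function on a grid of mesh
  \<open>T / m\<close>, and the defect of at most \<open>L * T / m\<close> vanishes in the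
  limit.\<close>

theorem fixpoint:
  fixes A C :: "real \<Rightarrow> real \<Rightarrow> (real \<Rightarrow> real) \<Rightarrow> real"
  assumes A: "\<And>a c v. a \<in> {al..ar} \<Longrightarrow> c \<in> {cl..cr} \<Longrightarrow> v \<in> admissible T R \<Longrightarrow> A a c v \<in> {al..ar}"
    and C: "\<And>a c v. a \<in> {al..ar} \<Longrightarrow> c \<in> {cl..cr} \<Longrightarrow> v \<in> admissible T R \<Longrightarrow> C a c v \<in> {cl..cr}"
    and AC_cont: "\<And>ak ck vk a c v. (\<And>k. ak k \<in> {al..ar}) \<Longrightarrow> (\<And>k. ck k \<in> {cl..cr}) \<Longrightarrow> (\<And>k. vk k \<in> admissible T R) \<Longrightarrow>
       ak \<longlonglongrightarrow> a \<Longrightarrow> ck \<longlonglongrightarrow> c \<Longrightarrow> v \<in> admissible T R \<Longrightarrow> (\<And>t. t \<in> {0..T} \<Longrightarrow> (\<lambda>k. vk k t) \<longlonglongrightarrow> v t) \<Longrightarrow>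
       (\<lambda>k. A (ak k) (ck k) (vk k)) \<longlonglongrightarrow> A a c v \<and> (\<lambda>k. C (ak k) (ck k) (vk k)) \<longlonglongrightarrow> C a c v"
  obtains a c u where "a \<in> {al..ar}" "c \<in> {cl..cr}" "u \<in> admissible T R" "A a c u = a" "C a c u = c"
    "\<And>t. t \<in> {0..T} \<Longrightarrow> U a c u t = u t"
proof -
  have "\<exists>a c v. a \<in> {al..ar} \<and> c \<in> {cl..cr} \<and> v \<in> admissible T R \<and> A a c v = a \<and> C a c v = c \<and>
     (\<forall>t\<in>{0..T}. \<bar>v t - U a c v t\<bar> \<le> L * T / m)" if m: "m > 0" for m :: nat
  proof -
    define step where "step x t = x (2 + nat \<lfloor>real m * t / T\<rfloor>)" for x :: "nat \<Rightarrow> real" and t :: real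
    define l r where "l i = (if i = 0 then al else if i = 1 then cl else - R)"
      and "r i = (if i = 0 then ar else if i = 1 then cr else R)" for i :: nat
    define f where "f x i = (if i = 0 then A (x 0) (x 1) (step x) else if i = 1 then C (x 0) (x 1) (step x)
        else U (x 0) (x 1) (step x) (real (i - 2) * T / real m))" for x :: "nat \<Rightarrow> real" and i :: nat
    \<comment> \<open>Coordinates 0 and 1 carry \<open>a\<close> and \<open>c\<close>, whence the
      shift by 2 in \<open>step\<close>. There are \<open>m + 1\<close> grid values, since the grid
      index reaches \<open>m\<close> at \<open>t = T\<close>.\<close>
    define N where "N = m + 3"
    have idx: "nat \<lfloor>real m * t / T\<rfloor> \<le> m" if "t \<in> {0..T}" for t
    proof -
      have "m * t / T \<le> m" using that T by (simp add: field_simps mult_right_mono)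
      then show ?thesis by linarith
    qed
    have grid: "real i * T / m \<in> {0..T}" if "i \<le> m" for i :: nat using that m T by (auto simp: field_simps)
    have step: "step x \<in> admissible T R" if "\<And>j. j < N \<Longrightarrow> x j \<in> {l j..r j}" for x
    proof -
      have "(\<lambda>t. real m * t / T) \<in> borel_measurable (lebesgue_on {0..T})"
        by (rule continuous_imp_measurable_on_sets_lebesgue) (use T in \<open>auto intro!: continuous_intros\<close>)
      then have "(\<lambda>t. \<lfloor>real m * t / T\<rfloor>) \<in> lebesgue_on {0..T} \<rightarrow>\<^sub>M count_space UNIV" by measurable
      then have "step x \<in> borel_measurable (lebesgue_on {0..T})"
        unfolding step_def by (rule measurable_compose) simp
      moreover have "\<bar>step x t\<bar> \<le> R" if t: "t \<in> {0..T}" for t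
        using \<open>\<And>j. j < N \<Longrightarrow> x j \<in> {l j..r j}\<close>[of "2 + nat \<lfloor>real m * t / T\<rfloor>"] idx[OF t]
        by (auto simp: N_def step_def l_def r_def)
      ultimately show ?thesis by (auto simp: admissible_def)
    qed
    have "\<exists>x. (\<forall>j<N. x j \<in> {l j..r j}) \<and> (\<forall>i<N. f x i = x i)"
    proof (rule brouwer_box)
      show "l i \<le> r i" for i using al cl R by (auto simp: l_def r_def)
    next
      fix x i assume x: "\<And>j. j < N \<Longrightarrow> x j \<in> {l j..r j}" and i: "i < N"
      have x01: "x 0 \<in> {al..ar}" "x 1 \<in> {cl..cr}" using x[of 0] x[of 1] by (auto simp: N_def l_def r_def)
      have "\<bar>U (x 0) (x 1) (step x) (real (i - 2) * T / real m)\<bar> \<le> R"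
        by (rule U_bound[OF x01 step[OF x] grid]) (use i N_def in auto)
      then show "f x i \<in> {l i..r i}"
        using A[OF x01 step[OF x]] C[OF x01 step[OF x]] by (auto simp: f_def l_def r_def abs_le_iff)
    next
      fix X :: "nat \<Rightarrow> nat \<Rightarrow> real" and x i
      assume X: "\<And>k j. j < N \<Longrightarrow> X k j \<in> {l j..r j}" and lim: "\<And>j. j < N \<Longrightarrow> (\<lambda>k. X k j) \<longlonglongrightarrow> x j" and i: "i < N"
      have x: "x j \<in> {l j..r j}" if "j < N" for j
        using LIMSEQ_le_const[OF lim[OF that]] LIMSEQ_le_const2[OF lim[OF that]] X[OF that] by auto
      have X01: "X k 0 \<in> {al..ar}" "X k 1 \<in> {cl..cr}" for k using X[of 0 k] X[of 1 k] by (auto simp: N_def l_def r_def)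
      have lim01: "(\<lambda>k. X k 0) \<longlonglongrightarrow> x 0" "(\<lambda>k. X k 1) \<longlonglongrightarrow> x 1" by (auto intro!: lim simp: N_def)
      have slim: "(\<lambda>k. step (X k) t) \<longlonglongrightarrow> step x t" if "t \<in> {0..T}" for t
        unfolding step_def by (rule lim) (use idx[OF that] N_def in auto)
      note AC = AC_cont[OF X01 step[OF X] lim01 step[OF x] slim]
      have "(\<lambda>k. U (X k 0) (X k 1) (step (X k)) (real (i - 2) * T / real m)) \<longlonglongrightarrow> U (x 0) (x 1) (step x) (real (i - 2) * T / real m)"
        by (rule U_cont[OF X01 step[OF X] lim01 step[OF x] slim grid]) (use i N_def in auto)
      with AC show "(\<lambda>k. f (X k) i) \<longlonglongrightarrow> f x i" by (auto simp: f_def)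
    qed
    then obtain x where x: "\<And>j. j < N \<Longrightarrow> x j \<in> {l j..r j}" and fix_x: "\<And>i. i < N \<Longrightarrow> f x i = x i" by blast
    have x01: "x 0 \<in> {al..ar}" "x 1 \<in> {cl..cr}" using x[of 0] x[of 1] by (auto simp: N_def l_def r_def)
    \<comment> \<open>On a cell the step function repeats the value of the operator at the left grid
      point, so only the variation of \<open>U\<close> over one cell is left.\<close>
    have "\<bar>step x t - U (x 0) (x 1) (step x) t\<bar> \<le> L * T / m" if t: "t \<in> {0..T}" for t
    proof -
      define i where "i = nat \<lfloor>real m * t / T\<rfloor>"
      have i: "i \<le> m" using idx[OF t] by (simp add: i_def)
      have "step x t = U (x 0) (x 1) (step x) (real i * T / m)"
        using fix_x[of "2 + i"] i by (simp add: f_def N_def step_def i_def)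
      then have "\<bar>step x t - U (x 0) (x 1) (step x) t\<bar> \<le> L * \<bar>real i * T / m - t\<bar>"
        using U_lipschitz[OF x01 step[OF x] grid[OF i] t] by simp
      also have "\<dots> \<le> L * (T / m)"
      proof (rule mult_left_mono[OF _ L_nonneg])
        have "m * t / T \<ge> 0" using t T by auto
        then have "real i \<le> m * t / T" "m * t / T \<le> real i + 1" unfolding i_def by linarith+
        then have "real i * T / m \<le> t" "t \<le> real i * T / m + T / m" using m T by (auto simp: field_simps)
        then show "\<bar>real i * T / m - t\<bar> \<le> T / m" by auto
      qed
      finally show ?thesis by simp
    qed
    moreover have "A (x 0) (x 1) (step x) = x 0" "C (x 0) (x 1) (step x) = x 1"
      using fix_x[of 0] fix_x[of 1] by (auto simp: f_def N_def)
    ultimately show ?thesis using x01 step[OF x] by blast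
  qed
  then have "\<forall>k. \<exists>a c v. a \<in> {al..ar} \<and> c \<in> {cl..cr} \<and> v \<in> admissible T R \<and> A a c v = a \<and> C a c v = c \<and>
     (\<forall>t\<in>{0..T}. \<bar>v t - U a c v t\<bar> \<le> L * T / Suc k)" by blast
  then obtain ak ck vk where k: "\<And>k. ak k \<in> {al..ar}" "\<And>k. ck k \<in> {cl..cr}" "\<And>k. vk k \<in> admissible T R"
    "\<And>k. A (ak k) (ck k) (vk k) = ak k" "\<And>k. C (ak k) (ck k) (vk k) = ck k"
    "\<And>k t. t \<in> {0..T} \<Longrightarrow> \<bar>vk k t - U (ak k) (ck k) (vk k) t\<bar> \<le> L * T / Suc k"
    by metis
  have "(\<lambda>k. L * T / Suc k) \<longlonglongrightarrow> 0" by (rule LIMSEQ_Suc[OF lim_const_over_n])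
  from approximate_fixpoints_converge[OF k(1-3) this k(6)] obtain \<sigma> a c u where
    s: "strict_mono (\<sigma>::nat \<Rightarrow> nat)" "(\<lambda>k. ak (\<sigma> k)) \<longlonglongrightarrow> a" "(\<lambda>k. ck (\<sigma> k)) \<longlonglongrightarrow> c"
    "a \<in> {al..ar}" "c \<in> {cl..cr}" "u \<in> admissible T R" "\<And>t. t \<in> {0..T} \<Longrightarrow> (\<lambda>k. vk (\<sigma> k) t) \<longlonglongrightarrow> u t"
    "\<And>t. t \<in> {0..T} \<Longrightarrow> U a c u t = u t" by blast
  have "(\<lambda>k. A (ak (\<sigma> k)) (ck (\<sigma> k)) (vk (\<sigma> k))) \<longlonglongrightarrow> A a c u" "(\<lambda>k. C (ak (\<sigma> k)) (ck (\<sigma> k)) (vk (\<sigma> k))) \<longlonglongrightarrow> C a c u"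
    using AC_cont[OF k(1-3) s(2,3,6,7)] by auto
  then have "A a c u = a" "C a c u = c" unfolding k(4,5) using s(2,3) LIMSEQ_unique by blast+
  with that s show ?thesis by blast
qed

end

section \<open>Periodic solutions in integrated form\<close>

text \<open>Rounding \<open>v\<close> down to multiples of \<open>1 / Suc n\<close> leaves countably
  many values, for each of which measurability is assumed; continuity in the second argument passes
  to the limit.\<close>

lemma caratheodory_composition_measurable:
  fixes g :: "'a \<Rightarrow> real \<Rightarrow> real"
  assumes g: "\<And>x. (\<lambda>t. g t x) \<in> borel_measurable M" and cont: "\<And>t. t \<in> space M \<Longrightarrow> continuous_on UNIV (g t)"
    and v: "v \<in> borel_measurable M"
  shows "(\<lambda>t. g t (v t)) \<in> borel_measurable M"
proof (rule borel_measurable_LIMSEQ_real)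
  define vn where "vn n t = real_of_int \<lfloor>real (Suc n) * v t\<rfloor> / real (Suc n)" for n t
  show "(\<lambda>t. g t (vn n t)) \<in> borel_measurable M" for n
    unfolding vn_def
  proof (rule measurable_compose_countable[of "\<lambda>i t. g t (real_of_int i / real (Suc n))"])
    show "(\<lambda>t. \<lfloor>real (Suc n) * v t\<rfloor>) \<in> M \<rightarrow>\<^sub>M count_space UNIV" using v by measurable
  qed (rule g)
  fix t assume t: "t \<in> space M"
  have "(\<lambda>n. vn n t - v t) \<longlonglongrightarrow> 0"
  proof (rule Lim_null_comparison[OF always_eventually])
    show "(\<lambda>n. 1 / real (Suc n)) \<longlonglongrightarrow> 0" by (rule LIMSEQ_Suc[OF lim_const_over_n])
    show "\<forall>n. norm (vn n t - v t) \<le> 1 / real (Suc n)"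
    proof
      fix n
      have "vn n t - v t = (real_of_int \<lfloor>real (Suc n) * v t\<rfloor> - real (Suc n) * v t) / real (Suc n)"
        by (simp add: vn_def field_simps del: of_nat_Suc)
      moreover have "\<bar>real_of_int \<lfloor>real (Suc n) * v t\<rfloor> - real (Suc n) * v t\<bar> \<le> 1" by linarith
      ultimately show "norm (vn n t - v t) \<le> 1 / real (Suc n)" by (simp add: divide_right_mono del: of_nat_Suc)
    qed
  qed
  then have lim: "(\<lambda>n. vn n t) \<longlonglongrightarrow> v t" by (simp add: LIM_zero_iff)
  show "(\<lambda>n. g t (vn n t)) \<longlonglongrightarrow> g t (v t)"
    by (rule continuous_on_tendsto_compose[OF cont[OF t] lim]) auto
qed

text \<open>Bridge from gauge integrals over subintervals to integrals over one fixed measure space,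
  where almost everywhere comparison is available. Open intervals are used because those in
  \<open>abs_continuous_on\<close> are disjoint only without their endpoints.\<close>

lemma integral_eq_lebesgue_indicator:
  fixes q :: "real \<Rightarrow> real"
  assumes q: "integrable (lebesgue_on {a..b}) q" and xy: "a \<le> x" "y \<le> b"
  shows "integral {x..y} q = (\<integral>t. indicator {x<..<y} t * q t \<partial>lebesgue_on {a..b})"
    and "integrable (lebesgue_on {a..b}) (\<lambda>t. indicator {x<..<y} t * q t)"
proof -
  show int: "integrable (lebesgue_on {a..b}) (\<lambda>t. indicator {x<..<y} t * q t)"
    using integrable_real_mult_indicator[OF _ q, of "{x<..<y}"] xy
    by (simp add: mult.commute sets_restrict_space_iff) (simp add: subset_eq)
  have "(\<integral>t. indicator {x<..<y} t * q t \<partial>lebesgue_on {a..b}) = integral {a..b} (\<lambda>t. indicator {x<..<y} t * q t)"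
    by (rule lebesgue_integral_eq_integral[OF int]) auto
  also have "\<dots> = integral {a..b} (\<lambda>t. if t \<in> {x<..<y} then q t else 0)"
    by (intro Henstock_Kurzweil_Integration.integral_cong) auto
  also have "\<dots> = integral ({x<..<y} \<inter> {a..b}) q"
    by (rule Henstock_Kurzweil_Integration.integral_restrict_Int)
  also have "{x<..<y} \<inter> {a..b} = {x<..<y}" using xy by auto
  also have "integral {x<..<y} q = integral {x..y} q" by (simp add: integral_open_interval_real)
  finally show "integral {x..y} q = (\<integral>t. indicator {x<..<y} t * q t \<partial>lebesgue_on {a..b})" ..
qed

lemma integrable_lebesgue_on_subinterval:
  fixes q :: "real \<Rightarrow> real"
  assumes q: "integrable (lebesgue_on {a..b}) q" and xy: "a \<le> x" "y \<le> b"
  shows "q integrable_on {x..y}"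
  using has_integral_integral_lebesgue_on[OF q] xy by (auto intro: integrable_on_subinterval)

lemma abs_integral_subinterval_le:
  fixes q :: "real \<Rightarrow> real"
  assumes q: "integrable (lebesgue_on {a..b}) q" and xy: "a \<le> x" "y \<le> b"
  shows "\<bar>integral {x..y} q\<bar> \<le> (\<integral>t. \<bar>q t\<bar> \<partial>lebesgue_on {a..b})"
proof -
  note I = integral_eq_lebesgue_indicator[OF q xy]
  have "\<bar>integral {x..y} q\<bar> \<le> (\<integral>t. \<bar>indicator {x<..<y} t * q t\<bar> \<partial>lebesgue_on {a..b})"
    unfolding I(1) by (rule integral_abs_bound)
  also have "\<dots> \<le> (\<integral>t. \<bar>q t\<bar> \<partial>lebesgue_on {a..b})"
    by (rule integral_mono) (use I(2) q in \<open>auto simp: indicator_def\<close>)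
  finally show ?thesis .
qed

text \<open>Cut \<open>m\<close> at a level \<open>k\<close> above which its integral is below
  \<open>e / 2\<close>; the part below the level contributes at most \<open>k\<close> times the
  total length of the intervals.\<close>

lemma abs_continuous_on_if_le_integral:
  fixes m :: "real \<Rightarrow> real"
  assumes m: "integrable (lebesgue_on {a..b}) m" and nonneg: "\<And>t. m t \<ge> 0"
    and le: "\<And>x y. a \<le> x \<Longrightarrow> x \<le> y \<Longrightarrow> y \<le> b \<Longrightarrow> \<bar>V y - V x\<bar> \<le> integral {x..y} m"
  shows "abs_continuous_on a b V"
  unfolding abs_continuous_on_def
proof (intro allI impI)
  fix e :: real assume e: "e > 0"
  let ?M = "lebesgue_on {a..b}"
  have [measurable]: "m \<in> borel_measurable ?M" using m by auto
  have mn: "integrable ?M (\<lambda>t. min (m t) (real n))" for n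
    by (rule Bochner_Integration.integrable_bound[OF m]) (use nonneg in auto)
  have "(\<lambda>n. \<integral>t. m t - min (m t) (real n) \<partial>?M) \<longlonglongrightarrow> (\<integral>t. 0 \<partial>?M)"
  proof (rule integral_dominated_convergence[OF _ _ m])
    show "AE t in ?M. (\<lambda>n. m t - min (m t) (real n)) \<longlonglongrightarrow> 0"
    proof (rule AE_I2)
      fix t
      obtain N :: nat where "m t \<le> real N" using real_arch_simple by blast
      then have "m t - min (m t) (real n) = 0" if "n \<ge> N" for n using that by simp
      then show "(\<lambda>n. m t - min (m t) (real n)) \<longlonglongrightarrow> 0"
        by (intro tendsto_eventually) (auto simp: eventually_sequentially)
    qed
  qed (use nonneg in \<open>auto simp: min_def\<close>)
  then have "eventually (\<lambda>n. (\<integral>t. m t - min (m t) (real n) \<partial>?M) < e / 2) sequentially"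
    by (rule order_tendstoD(2)) (use e in auto)
  then obtain k where k: "(\<integral>t. m t - min (m t) (real k) \<partial>?M) < e / 2"
    using eventually_happens'[OF sequentially_bot] by blast
  show "\<exists>d>0. \<forall>(n::nat) x y. (\<forall>i<n. a \<le> x i \<and> x i \<le> y i \<and> y i \<le> b) \<and>
        (\<forall>i<n. \<forall>j<n. i \<noteq> j \<longrightarrow> {x i<..<y i} \<inter> {x j<..<y j} = {}) \<and> (\<Sum>i<n. y i - x i) < d
        \<longrightarrow> (\<Sum>i<n. \<bar>V (y i) - V (x i)\<bar>) < e"
  \<comment> \<open>The summand 1 covers \<open>k = 0\<close>.\<close>
  proof (intro exI[of _ "e / (2 * (real k + 1))"] conjI allI impI)
    show "e / (2 * (real k + 1)) > 0" using e by simp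
    fix n :: nat and x y :: "nat \<Rightarrow> real"
    assume A: "(\<forall>i<n. a \<le> x i \<and> x i \<le> y i \<and> y i \<le> b) \<and>
        (\<forall>i<n. \<forall>j<n. i \<noteq> j \<longrightarrow> {x i<..<y i} \<inter> {x j<..<y j} = {}) \<and> (\<Sum>i<n. y i - x i) < e / (2 * (real k + 1))"
    have xy: "a \<le> x i" "x i \<le> y i" "y i \<le> b" if "i < n" for i using A that by auto
    have disj: "{x i<..<y i} \<inter> {x j<..<y j} = {}" if "i < n" "j < n" "i \<noteq> j" for i j using A that by blast
    define I where "I i = {x i<..<y i}" for i
    have count: "(\<Sum>i<n. indicator (I i) t) \<le> (1::real)" for t
    proof -
      have "(\<Sum>i<n. indicator (I i) t) = (indicator (\<Union>i<n. I i) t :: real)"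
        by (rule indicator_UN_disjoint[symmetric]) (use disj in \<open>auto simp: disjoint_family_on_def I_def\<close>)
      then show ?thesis by simp
    qed
    define q where "q t = m t - min (m t) (real k)" for t
    have q: "integrable ?M q" "\<And>t. q t \<ge> 0" unfolding q_def using m mn by (auto simp: min_def)
    have intI: "integral {x i..y i} p = (\<integral>t. indicator (I i) t * p t \<partial>?M)" "integrable ?M (\<lambda>t. indicator (I i) t * p t)"
      if "i < n" "integrable ?M p" for i and p :: "real \<Rightarrow> real"
      using integral_eq_lebesgue_indicator[OF that(2) xy(1,3)[OF that(1)]] by (auto simp: I_def)
    have part: "(\<Sum>i<n. integral {x i..y i} q) \<le> (\<integral>t. q t \<partial>?M)"
    proof -
      have "(\<Sum>i<n. integral {x i..y i} q) = (\<Sum>i<n. \<integral>t. indicator (I i) t * q t \<partial>?M)"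
        using intI q by simp
      also have "\<dots> = (\<integral>t. (\<Sum>i<n. indicator (I i) t * q t) \<partial>?M)"
        by (rule Bochner_Integration.integral_sum[symmetric]) (use intI q in auto)
      also have "\<dots> \<le> (\<integral>t. q t \<partial>?M)"
      proof (rule integral_mono)
        fix t
        have "(\<Sum>i<n. indicator (I i) t) * q t \<le> 1 * q t" by (rule mult_right_mono[OF count q(2)])
        then show "(\<Sum>i<n. indicator (I i) t * q t) \<le> q t" by (simp add: sum_distrib_right)
      next
        show "integrable ?M (\<lambda>t. \<Sum>i<n. indicator (I i) t * q t)"
          by (rule Bochner_Integration.integrable_sum) (use intI(2)[OF _ q(1)] in auto)
      qed (fact q(1))
      finally show ?thesis .
    qed
    have each: "\<bar>V (y i) - V (x i)\<bar> \<le> integral {x i..y i} q + real k * (y i - x i)" if i: "i < n" for i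
    proof -
      note sub = integrable_lebesgue_on_subinterval[OF _ xy(1,3)[OF i]]
      have "\<bar>V (y i) - V (x i)\<bar> \<le> integral {x i..y i} m" using le xy[OF i] by blast
      also have "\<dots> = integral {x i..y i} (\<lambda>t. q t + min (m t) (real k))" by (simp add: q_def)
      also have "\<dots> = integral {x i..y i} q + integral {x i..y i} (\<lambda>t. min (m t) (real k))"
        by (rule Henstock_Kurzweil_Integration.integral_add[OF sub[OF q(1)] sub[OF mn]])
      also have "integral {x i..y i} (\<lambda>t. min (m t) (real k)) \<le> integral {x i..y i} (\<lambda>t. real k)"
        by (rule integral_le[OF sub[OF mn]]) auto
      also have "\<dots> = real k * (y i - x i)" using xy[OF i] by simp
      finally show ?thesis by simp
    qed
    have "(\<Sum>i<n. \<bar>V (y i) - V (x i)\<bar>) \<le> (\<Sum>i<n. integral {x i..y i} q + real k * (y i - x i))"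
      using each by (intro sum_mono) auto
    also have "\<dots> = (\<Sum>i<n. integral {x i..y i} q) + real k * (\<Sum>i<n. y i - x i)"
      by (simp add: sum.distrib sum_distrib_left)
    also have "\<dots> < e / 2 + e / 2"
    proof (rule add_less_le_mono)
      show "(\<Sum>i<n. integral {x i..y i} q) < e / 2" using part k by (simp add: q_def)
      have "real k * (\<Sum>i<n. y i - x i) \<le> real k * (e / (2 * (real k + 1)))"
        using A by (intro mult_left_mono) auto
      also have "\<dots> \<le> e / 2" using e by (simp add: field_simps)
      finally show "real k * (\<Sum>i<n. y i - x i) \<le> e / 2" .
    qed
    finally show "(\<Sum>i<n. \<bar>V (y i) - V (x i)\<bar>) < e" by simp
  qed
qed

lemma abs_continuous_on_subinterval:
  assumes "abs_continuous_on a b v" "a \<le> c" "d \<le> b"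
  shows "abs_continuous_on c d v"
  unfolding abs_continuous_on_def
proof (intro allI impI)
  fix e :: real assume "e > 0"
  from assms(1)[unfolded abs_continuous_on_def, THEN spec[of _ e], THEN mp, OF this]
  obtain \<delta> where \<delta>: "\<delta> > 0 \<and> (\<forall>(n::nat) x y. (\<forall>i<n. a \<le> x i \<and> x i \<le> y i \<and> y i \<le> b) \<and>
          (\<forall>i<n. \<forall>j<n. i \<noteq> j \<longrightarrow> {x i<..<y i} \<inter> {x j<..<y j} = {}) \<and>
          (\<Sum>i<n. y i - x i) < \<delta> \<longrightarrow> (\<Sum>i<n. \<bar>v (y i) - v (x i)\<bar>) < e)" ..
  show "\<exists>\<delta>>0. \<forall>(n::nat) x y. (\<forall>i<n. c \<le> x i \<and> x i \<le> y i \<and> y i \<le> d) \<and>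
          (\<forall>i<n. \<forall>j<n. i \<noteq> j \<longrightarrow> {x i<..<y i} \<inter> {x j<..<y j} = {}) \<and>
          (\<Sum>i<n. y i - x i) < \<delta> \<longrightarrow> (\<Sum>i<n. \<bar>v (y i) - v (x i)\<bar>) < e"
  proof (intro exI[of _ \<delta>] conjI allI impI)
    show "\<delta> > 0" using \<delta> by blast
    fix n :: nat and x y :: "nat \<Rightarrow> real"
    assume A: "(\<forall>i<n. c \<le> x i \<and> x i \<le> y i \<and> y i \<le> d) \<and>
          (\<forall>i<n. \<forall>j<n. i \<noteq> j \<longrightarrow> {x i<..<y i} \<inter> {x j<..<y j} = {}) \<and> (\<Sum>i<n. y i - x i) < \<delta>"
    then have "\<forall>i<n. a \<le> x i \<and> x i \<le> y i \<and> y i \<le> b" using assms(2,3) by fastforce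
    note B = conjI[OF this conjunct2[OF A]]
    show "(\<Sum>i<n. \<bar>v (y i) - v (x i)\<bar>) < e"
      by (rule conjunct2[OF \<delta>, THEN spec[of _ n], THEN spec[of _ x], THEN spec[of _ y], THEN mp, OF B])
  qed
qed

lemma AE_lebesgue_on_negligible:
  assumes "AE t in lebesgue_on {a..b::real}. Q t"
  obtains N where "negligible N" "\<And>t. t \<in> {a..b} - N \<Longrightarrow> Q t"
proof -
  have "AE t in lebesgue. t \<in> {a..b} \<longrightarrow> Q t"
    using assms by (subst (asm) AE_restrict_space_iff) auto
  then obtain N where "N \<in> null_sets lebesgue" "\<And>t. t \<in> {a..b} - N \<Longrightarrow> Q t"
    by (rule AE_E3) auto
  then show ?thesis using that by (simp add: negligible_iff_null_sets)
qed

lemma caratheodory_integrable: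
  assumes g: "caratheodory T g" and v: "v \<in> borel_measurable (lebesgue_on {0..T})"
    and bound: "\<And>t. t \<in> {0..T} \<Longrightarrow> \<bar>v t\<bar> \<le> R"
  shows "integrable (lebesgue_on {0..T}) (\<lambda>t. g t (v t))"
proof -
  \<comment> \<open>A dominating function is granted for positive radii, hence
    \<open>max R 1\<close>.\<close>
  from g obtain h where h: "integrable (lebesgue_on {0..T}) h" "\<And>t x. t \<in> {0..T} \<Longrightarrow> \<bar>x\<bar> \<le> max R 1 \<Longrightarrow> \<bar>g t x\<bar> \<le> h t"
    unfolding caratheodory_def by (metis max.strict_coboundedI2 zero_less_one)
  have "(\<lambda>t. g t (v t)) \<in> borel_measurable (lebesgue_on {0..T})"
    by (rule caratheodory_composition_measurable[OF _ _ v]) (use g in \<open>auto simp: caratheodory_def\<close>)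
  then show ?thesis
  proof (rule Bochner_Integration.integrable_bound[OF h(1)])
    show "AE t in lebesgue_on {0..T}. norm (g t (v t)) \<le> norm (h t)"
      by (rule AE_I2) (use bound in \<open>force intro!: order_trans[OF h(2) abs_ge_self]\<close>)
  qed
qed

lemma continuous_on_borel_measurable_lebesgue_on:
  "continuous_on {a..b::real} v \<Longrightarrow> (v :: real \<Rightarrow> real) \<in> borel_measurable (lebesgue_on {a..b})"
  by (rule continuous_imp_measurable_on_sets_lebesgue) auto

lemma continuous_on_interval_abs_bounded:
  fixes v :: "real \<Rightarrow> real"
  assumes "continuous_on {a..b} v"
  obtains R where "\<And>t. t \<in> {a..b} \<Longrightarrow> \<bar>v t\<bar> \<le> R"
proof -
  have "bounded (v ` {a..b})"
    by (rule compact_imp_bounded[OF compact_continuous_image[OF assms]]) auto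
  then obtain R where "\<forall>x\<in>{a..b}. \<bar>v x\<bar> \<le> R" unfolding bounded_iff by auto
  then show ?thesis using that by blast
qed

lemma caratheodory_integrable_continuous:
  assumes g: "caratheodory T g" and v: "continuous_on {0..T} v"
  shows "integrable (lebesgue_on {0..T}) (\<lambda>t. g t (v t))"
proof -
  obtain R where "\<And>t. t \<in> {0..T} \<Longrightarrow> \<bar>v t\<bar> \<le> R"
    using continuous_on_interval_abs_bounded[OF v] by blast
  with caratheodory_integrable[OF g continuous_on_borel_measurable_lebesgue_on[OF v]] show ?thesis .
qed

section \<open>The first integral of the equation\<close>

definition C1_periodic :: "real \<Rightarrow> (real \<Rightarrow> real) \<Rightarrow> (real \<Rightarrow> real) \<Rightarrow> bool" where
  "C1_periodic T u u' \<longleftrightarrow> (\<forall>t\<in>{0..T}. (u has_real_derivative u' t) (at t within {0..T})) \<and>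
     continuous_on {0..T} u' \<and> u 0 = u T \<and> u' 0 = u' T"

text \<open>Here \<open>F (u)\<close> absorbs \<open>f (u) * u'\<close>, which leaves an identity at
  every \<open>t\<close>, free of null sets and of derivatives of
  \<open>\<phi> (u')\<close>.\<close>

definition integrated_solution ::
  "real \<Rightarrow> (real \<Rightarrow> real) \<Rightarrow> (real \<Rightarrow> real) \<Rightarrow> (real \<Rightarrow> real \<Rightarrow> real) \<Rightarrow> real \<Rightarrow> (real \<Rightarrow> real) \<Rightarrow> (real \<Rightarrow> real) \<Rightarrow> bool"
where
  "integrated_solution T \<phi> F g s u u' \<longleftrightarrow> C1_periodic T u u' \<and>
     (\<forall>t\<in>{0..T}. \<phi> (u' t) + F (u t) + integral {0..t} (\<lambda>\<tau>. g \<tau> (u \<tau>) - s) = \<phi> (u' 0) + F (u 0))"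

lemma C1_periodicD:
  assumes "C1_periodic T u u'"
  shows "t \<in> {0..T} \<Longrightarrow> (u has_real_derivative u' t) (at t within {0..T})"
    "continuous_on {0..T} u" "continuous_on {0..T} u'" "u T = u 0" "u' T = u' 0"
  using assms unfolding C1_periodic_def by (auto intro!: DERIV_continuous_on)

lemma C1_periodic_integral:
  assumes "C1_periodic T u u'" "0 \<le> x" "x \<le> y" "y \<le> T"
  shows "(u' has_integral (u y - u x)) {x..y}"
proof (rule fundamental_theorem_of_calculus[OF assms(3)])
  fix t assume "t \<in> {x..y}"
  then have "(u has_real_derivative u' t) (at t within {0..T})" using C1_periodicD(1)[OF assms(1)] assms by auto
  then show "(u has_vector_derivative u' t) (at t within {x..y})"
    unfolding has_real_derivative_iff_has_vector_derivative
    by (rule has_vector_derivative_within_subset) (use assms in auto)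
qed

text \<open>From left to right, \<open>\<phi> (u')\<close> is recovered from its almost everywhere
  derivative by absolute continuity. From right to left, the identity displays
  \<open>\<phi> (u')\<close> as a C1 function plus an indefinite integral, so Lebesgue
  differentiation gives the equation and domination gives absolute continuity.\<close>

lemma periodic_solution_iff_integrated:
  assumes T: "T > 0" and F: "\<And>x. (F has_real_derivative f x) (at x)" and f: "continuous_on UNIV f"
    and g: "caratheodory T g"
  shows "periodic_solution \<phi> f g T s u \<longleftrightarrow> (\<exists>u'. integrated_solution T \<phi> F g s u u')"
proof
  assume "periodic_solution \<phi> f g T s u"
  then obtain u' w where C1: "C1_periodic T u u'" and ac: "abs_continuous_on 0 T (\<lambda>t. \<phi> (u' t))"
    and ae: "AE t in lebesgue_on {0..T}. ((\<lambda>\<tau>. \<phi> (u' \<tau>)) has_real_derivative w t) (at t within {0..T}) \<and>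
                  w t + f (u t) * u' t + g t (u t) = s"
    unfolding periodic_solution_def C1_periodic_def by blast
  note u = C1_periodicD[OF C1]
  define sol where "sol t \<longleftrightarrow> ((\<lambda>\<tau>. \<phi> (u' \<tau>)) has_real_derivative w t) (at t within {0..T}) \<and>
      w t + f (u t) * u' t + g t (u t) = s" for t
  obtain N where N: "negligible N" and off_N: "\<And>t. t \<in> {0..T} - N \<Longrightarrow> sol t"
    using AE_lebesgue_on_negligible[OF ae] unfolding sol_def by blast
  note gi = caratheodory_integrable_continuous[OF g u(2)]
  have "\<phi> (u' t) + F (u t) + integral {0..t} (\<lambda>\<tau>. g \<tau> (u \<tau>) - s) = \<phi> (u' 0) + F (u 0)" if t: "t \<in> {0..T}" for t
  proof -
    have "(w has_integral (\<phi> (u' t) - \<phi> (u' 0))) {0..t}"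
    proof (rule abs_continuous_on_has_integral[OF abs_continuous_on_subinterval[OF ac] _ N])
      fix \<tau> assume \<tau>: "\<tau> \<in> {0..t} - N"
      then have "((\<lambda>\<tau>. \<phi> (u' \<tau>)) has_real_derivative w \<tau>) (at \<tau> within {0..T})"
        using t off_N[of \<tau>] by (auto simp: sol_def)
      then show "((\<lambda>\<tau>. \<phi> (u' \<tau>)) has_real_derivative w \<tau>) (at \<tau> within {0..t})"
        by (rule has_field_derivative_subset) (use t in auto)
    qed (use t in auto)
    moreover have "((\<lambda>\<tau>. g \<tau> (u \<tau>) - s) has_integral integral {0..t} (\<lambda>\<tau>. g \<tau> (u \<tau>) - s)) {0..t}"
      by (intro integrable_integral integrable_lebesgue_on_subinterval[of 0 T] Bochner_Integration.integrable_diff gi)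
        (use t in auto)
    moreover have "((\<lambda>\<tau>. f (u \<tau>) * u' \<tau>) has_integral (F (u t) - F (u 0))) {0..t}"
    proof (rule fundamental_theorem_of_calculus)
      fix \<tau> assume \<tau>: "\<tau> \<in> {0..t}"
      then have "(u has_real_derivative u' \<tau>) (at \<tau> within {0..T})" using u(1) t by auto
      then have "(u has_real_derivative u' \<tau>) (at \<tau> within {0..t})"
        by (rule has_field_derivative_subset) (use t in auto)
      from DERIV_chain2[OF F this] show "((\<lambda>\<tau>. F (u \<tau>)) has_vector_derivative f (u \<tau>) * u' \<tau>) (at \<tau> within {0..t})"
        by (simp add: has_real_derivative_iff_has_vector_derivative)
    qed (use t in auto)
    ultimately have "((\<lambda>\<tau>. w \<tau> + (g \<tau> (u \<tau>) - s) + f (u \<tau>) * u' \<tau>) has_integral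
        (\<phi> (u' t) - \<phi> (u' 0) + integral {0..t} (\<lambda>\<tau>. g \<tau> (u \<tau>) - s) + (F (u t) - F (u 0)))) {0..t}"
      by (intro has_integral_add)
    moreover have "((\<lambda>\<tau>. w \<tau> + (g \<tau> (u \<tau>) - s) + f (u \<tau>) * u' \<tau>) has_integral 0) {0..t}"
    proof (rule has_integral_spike[OF N _ has_integral_0])
      fix \<tau> assume "\<tau> \<in> {0..t} - N"
      then have "w \<tau> + f (u \<tau>) * u' \<tau> + g \<tau> (u \<tau>) = s" using t off_N[of \<tau>] by (auto simp: sol_def)
      then show "w \<tau> + (g \<tau> (u \<tau>) - s) + f (u \<tau>) * u' \<tau> = 0" by simp
    qed
    ultimately have "\<phi> (u' t) - \<phi> (u' 0) + integral {0..t} (\<lambda>\<tau>. g \<tau> (u \<tau>) - s) + (F (u t) - F (u 0)) = 0"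
      by (rule has_integral_unique)
    then show ?thesis by simp
  qed
  with C1 show "\<exists>u'. integrated_solution T \<phi> F g s u u'" unfolding integrated_solution_def by blast
next
  assume "\<exists>u'. integrated_solution T \<phi> F g s u u'"
  then obtain u' where C1: "C1_periodic T u u'"
    and eq: "\<And>t. t \<in> {0..T} \<Longrightarrow> \<phi> (u' t) + F (u t) + integral {0..t} (\<lambda>\<tau>. g \<tau> (u \<tau>) - s) = \<phi> (u' 0) + F (u 0)"
    unfolding integrated_solution_def by blast
  note u = C1_periodicD[OF C1]
  define G where "G = (\<lambda>\<tau>. g \<tau> (u \<tau>) - s)"
  define V where "V = (\<lambda>t. \<phi> (u' t))"
  have V: "V t = \<phi> (u' 0) + F (u 0) - F (u t) - integral {0..t} G" if "t \<in> {0..T}" for t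
    using eq[OF that] by (simp add: V_def G_def)
  have G: "integrable (lebesgue_on {0..T}) G" unfolding G_def
    by (intro Bochner_Integration.integrable_diff caratheodory_integrable_continuous[OF g u(2)]) auto
  have dF: "((\<lambda>\<tau>. F (u \<tau>)) has_real_derivative f (u \<tau>) * u' \<tau>) (at \<tau> within {0..T})" if "\<tau> \<in> {0..T}" for \<tau>
    by (rule DERIV_chain2[OF F u(1)[OF that]])
  have cf: "continuous_on {0..T} (\<lambda>\<tau>. f (u \<tau>) * u' \<tau>)"
    using u continuous_on_compose2[OF f u(2)] by (intro continuous_intros) auto
  obtain L where L: "\<And>\<tau>. \<tau> \<in> {0..T} \<Longrightarrow> \<bar>f (u \<tau>) * u' \<tau>\<bar> \<le> L"
    using continuous_on_interval_abs_bounded[OF cf] by blast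
  have L0: "L \<ge> 0" using L[of 0] T by auto
  have ac: "abs_continuous_on 0 T V"
  proof (rule abs_continuous_on_if_le_integral)
    \<comment> \<open>\<open>L\<close> bounds the derivative of \<open>F (u)\<close>, and
      \<open>\<bar>G t\<bar>\<close> dominates the forcing term.\<close>
    show mi: "integrable (lebesgue_on {0..T}) (\<lambda>t. L + \<bar>G t\<bar>)" using G by auto
    fix x y :: real assume xy: "0 \<le> x" "x \<le> y" "y \<le> T"
    have sub: "q integrable_on {x..y}" if "integrable (lebesgue_on {0..T}) q" for q :: "real \<Rightarrow> real"
      by (rule integrable_lebesgue_on_subinterval[OF that]) (use xy in auto)
    have "integral {0..x} G + integral {x..y} G = integral {0..y} G"
      by (rule Henstock_Kurzweil_Integration.integral_combine)
         (use xy integrable_lebesgue_on_subinterval[OF G] in auto)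
    then have "V y - V x = - (F (u y) - F (u x)) - integral {x..y} G" using V[of x] V[of y] xy by auto
    moreover have "\<bar>F (u y) - F (u x)\<bar> \<le> L * \<bar>y - x\<bar>"
      using field_differentiable_bound[of "{0..T}" "\<lambda>t. F (u t)" "\<lambda>\<tau>. f (u \<tau>) * u' \<tau>" L x y] dF L xy by auto
    moreover have "\<bar>integral {x..y} G\<bar> \<le> integral {x..y} (\<lambda>t. \<bar>G t\<bar>)"
      using integral_norm_bound_integral[of G "{x..y}" "\<lambda>t. \<bar>G t\<bar>"] sub[OF G] sub[of "\<lambda>t. \<bar>G t\<bar>"] G by auto
    moreover have "integral {x..y} (\<lambda>t. L + \<bar>G t\<bar>) = L * (y - x) + integral {x..y} (\<lambda>t. \<bar>G t\<bar>)"
      using Henstock_Kurzweil_Integration.integral_add[of "\<lambda>_. L" "{x..y}" "\<lambda>t. \<bar>G t\<bar>"] sub[of "\<lambda>t. \<bar>G t\<bar>"] G xy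
      by (auto simp: mult.commute intro: integrable_const_ivl)
    ultimately show "\<bar>V y - V x\<bar> \<le> integral {x..y} (\<lambda>t. L + \<bar>G t\<bar>)" using xy by auto
  qed (use L0 in auto)
  define N where "N = {t \<in> {0..T}. \<not> ((\<lambda>x. integral {0..x} G) has_real_derivative G t) (at t within {0..T})}"
  have "negligible N" unfolding N_def
    by (intro negligible_not_has_derivative_indefinite_integral integrable_lebesgue_on_subinterval[OF G]) auto
  then have "AE t in lebesgue. t \<notin> N" unfolding negligible_iff_null_sets by (rule AE_not_in)
  then have "AE t in lebesgue_on {0..T}. t \<notin> N" by (subst AE_restrict_space_iff) auto
  then have "AE t in lebesgue_on {0..T}. (V has_real_derivative - (f (u t) * u' t) - G t) (at t within {0..T}) \<and>
     (- (f (u t) * u' t) - G t) + f (u t) * u' t + g t (u t) = s"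
  proof (rule AE_mp, intro AE_I2 impI conjI)
    fix t assume "t \<in> space (lebesgue_on {0..T})" and tN: "t \<notin> N"
    then have t: "t \<in> {0..T}" by simp
    have "((\<lambda>t. \<phi> (u' 0) + F (u 0) - F (u t) - integral {0..t} G) has_real_derivative 0 - f (u t) * u' t - G t) (at t within {0..T})"
      by (intro DERIV_diff DERIV_const dF t) (use t tN in \<open>auto simp: N_def\<close>)
    then have "((\<lambda>t. \<phi> (u' 0) + F (u 0) - F (u t) - integral {0..t} G) has_real_derivative - (f (u t) * u' t) - G t) (at t within {0..T})"
      by simp
    then show "(V has_real_derivative - (f (u t) * u' t) - G t) (at t within {0..T})"
      by (rule has_field_derivative_transform_within[OF _ zero_less_one t]) (use V in simp)
  qed (simp add: G_def)
  then have ex: "\<exists>w. AE t in lebesgue_on {0..T}. (V has_real_derivative w t) (at t within {0..T}) \<and>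
     w t + f (u t) * u' t + g t (u t) = s"
    by (rule exI[of _ "\<lambda>t. - (f (u t) * u' t) - G t"])
  show "periodic_solution \<phi> f g T s u"
    unfolding periodic_solution_def
  proof (rule exI[of _ u'], intro conjI)
    show "abs_continuous_on 0 T (\<lambda>t. \<phi> (u' t))" using ac by (simp only: V_def)
    from ex show "\<exists>w. AE t in lebesgue_on {0..T}. ((\<lambda>\<tau>. \<phi> (u' \<tau>)) has_real_derivative w t) (at t within {0..T}) \<and>
       w t + f (u t) * u' t + g t (u t) = s" by (simp only: V_def)
  qed (use C1 in \<open>unfold C1_periodic_def, blast+\<close>)
qed

section \<open>The problem with bounded nonlinearities\<close>

definition clip :: "real \<Rightarrow> real \<Rightarrow> real \<Rightarrow> real" where
  "clip lo hi x = max lo (min hi x)"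

lemma clip_simps:
  "lo \<le> hi \<Longrightarrow> clip lo hi x \<in> {lo..hi}"
  "x \<in> {lo..hi} \<Longrightarrow> clip lo hi x = x"
  "\<bar>clip lo hi x - clip lo hi y\<bar> \<le> \<bar>x - y\<bar>"
  by (auto simp: clip_def)

lemma continuous_on_clip [continuous_intros]:
  "continuous_on S f \<Longrightarrow> continuous_on S (\<lambda>x. clip lo hi (f x))"
  unfolding clip_def by (intro continuous_intros)

lemma tendsto_clip: "(f \<longlongrightarrow> l) A \<Longrightarrow> ((\<lambda>x. clip lo hi (f x)) \<longlongrightarrow> clip lo hi l) A"
  unfolding clip_def by (intro tendsto_intros)

definition sup_on :: "real \<Rightarrow> (real \<Rightarrow> real) \<Rightarrow> real" where
  "sup_on T w = Sup (w ` {0..T})"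

lemma sup_on_attained:
  assumes "T \<ge> 0" "continuous_on {0..T} w"
  shows "\<exists>t\<in>{0..T}. w t = sup_on T w" "t \<in> {0..T} \<Longrightarrow> w t \<le> sup_on T w"
proof -
  obtain x where x: "x \<in> {0..T}" "\<And>y. y \<in> {0..T} \<Longrightarrow> w y \<le> w x"
    using continuous_attains_sup[OF _ _ assms(2)] assms(1) by auto
  then have "sup_on T w = w x" unfolding sup_on_def by (intro cSup_eq_maximum) auto
  with x show "\<exists>t\<in>{0..T}. w t = sup_on T w" "t \<in> {0..T} \<Longrightarrow> w t \<le> sup_on T w" by auto
qed

lemma sup_on_diff_le:
  assumes T: "T \<ge> 0" and c: "continuous_on {0..T} w1" "continuous_on {0..T} w2"
    and d: "\<And>t. t \<in> {0..T} \<Longrightarrow> \<bar>w1 t - w2 t\<bar> \<le> d"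
  shows "\<bar>sup_on T w1 - sup_on T w2\<bar> \<le> d"
proof -
  obtain x y where "x \<in> {0..T}" "w1 x = sup_on T w1" "y \<in> {0..T}" "w2 y = sup_on T w2"
    using sup_on_attained(1)[OF T] c by metis
  moreover from this have "w2 x \<le> sup_on T w2" "w1 y \<le> sup_on T w1"
    using sup_on_attained(2)[OF T] c by auto
  ultimately show ?thesis using d[of x] d[of y] by (auto simp: abs_le_iff)
qed

locale phi_problem =
  fixes T :: real and \<phi> \<psi> F :: "real \<Rightarrow> real" and g :: "real \<Rightarrow> real \<Rightarrow> real"
  assumes T: "T > 0" and psi_phi: "\<And>x. \<psi> (\<phi> x) = x" and phi_psi: "\<And>x. \<phi> (\<psi> x) = x"
    and phi_strict: "strict_mono \<phi>" and phi_cont: "continuous_on UNIV \<phi>" and psi_cont: "continuous_on UNIV \<psi>"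
    and phi_0: "\<phi> 0 = 0"
    and F_cont: "continuous_on UNIV F" and g_car: "caratheodory T g"
begin

lemma psi_strict: "strict_mono \<psi>"
  using phi_strict phi_psi by (metis strict_monoI strict_mono_less)

lemma psi_0: "\<psi> 0 = 0"
  using psi_phi phi_0 by metis

lemma psi_abs_le: "\<bar>x\<bar> \<le> y \<Longrightarrow> \<bar>\<psi> x\<bar> \<le> max \<bar>\<psi> y\<bar> \<bar>\<psi> (- y)\<bar>"
  using strict_mono_less_eq[OF psi_strict, of x y] strict_mono_less_eq[OF psi_strict, of "- y" x]
  by (auto simp: abs_le_iff)

abbreviation M where "M \<equiv> lebesgue_on {0..T}"

lemma measure_M: "measure M {0..T} = T"
  using T by (simp add: measure_restrict_space)

lemma integrable_const_M: "integrable M (\<lambda>_. c :: real)"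
  by (intro finite_measure.integrable_const finite_measureI)
     (use T in \<open>simp add: emeasure_restrict_space\<close>)

end

text \<open>The situation after truncation: \<open>F\<close> and \<open>g\<close> have bounds
  independent of the unknown, so the integral operator maps into one fixed ball. The contact level
  is measured against \<open>b\<close>.\<close>

locale bounded_phi_problem = phi_problem +
  fixes K :: real and h b :: "real \<Rightarrow> real" and B :: real
  assumes F_bound: "\<And>x. \<bar>F x\<bar> \<le> K"
    and h: "integrable (lebesgue_on {0..T}) h" and g_bound: "\<And>t x. t \<in> {0..T} \<Longrightarrow> \<bar>g t x\<bar> \<le> h t"
    and b_cont: "continuous_on {0..T} b" and b_bound: "\<And>t. t \<in> {0..T} \<Longrightarrow> \<bar>b t\<bar> \<le> B"
begin

section \<open>The integral operator and its bounds\<close>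

definition lam :: "(real \<Rightarrow> real) \<Rightarrow> real" where
  "lam v = (\<integral>t. g t (v t) \<partial>M) / T"

definition H :: "(real \<Rightarrow> real) \<Rightarrow> real \<Rightarrow> real" where
  "H v t = integral {0..t} (\<lambda>\<tau>. g \<tau> (v \<tau>) - lam v)"

definition slope :: "real \<Rightarrow> (real \<Rightarrow> real) \<Rightarrow> real \<Rightarrow> real" where
  "slope a v t = \<psi> (a - F (v t) - H v t)"

definition P :: "real \<Rightarrow> (real \<Rightarrow> real) \<Rightarrow> real \<Rightarrow> real" where
  "P a v t = integral {0..t} (slope a v)"

text \<open>Normalised so that the maximum of \<open>U a c v - b\<close> over \<open>{0..T}\<close>
  equals \<open>c\<close>: the free additive constant of the periodic problem is traded for the
  contact level.\<close>

definition U :: "real \<Rightarrow> real \<Rightarrow> (real \<Rightarrow> real) \<Rightarrow> real \<Rightarrow> real" where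
  "U a c v t = c - sup_on T (\<lambda>\<tau>. P a v \<tau> - b \<tau>) + P a v t"

definition h_int :: real where "h_int = (\<integral>t. h t \<partial>M)"

text \<open>\<open>K + 2 * h_int\<close> bounds the sum of the \<open>F\<close> and \<open>H\<close>
  terms. The surplus 1 fixes the sign of the slope at \<open>a = A\<close> and
  \<open>a = - A\<close>; for \<open>\<bar>a\<bar> \<le> A\<close> the whole argument of
  \<open>\<psi>\<close> is bounded by \<open>2 * A\<close>, whence \<open>S\<close>.\<close>

definition A :: real where "A = K + 2 * h_int + 1"

definition S :: real where "S = max \<bar>\<psi> (2 * A)\<bar> \<bar>\<psi> (- (2 * A))\<bar>"

lemma g_measurable:
  assumes "v \<in> borel_measurable M"
  shows "(\<lambda>t. g t (v t)) \<in> borel_measurable M"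
  by (rule caratheodory_composition_measurable[OF _ _ assms]) (use g_car in \<open>auto simp: caratheodory_def\<close>)

lemma h_nonneg: "t \<in> {0..T} \<Longrightarrow> h t \<ge> 0"
  using g_bound[of t 0] by linarith

lemma g_integrable:
  assumes "v \<in> borel_measurable M"
  shows "integrable M (\<lambda>t. g t (v t))"
  by (rule Bochner_Integration.integrable_bound[OF h g_measurable[OF assms]])
     (auto intro!: AE_I2 order_trans[OF g_bound abs_ge_self])

lemma K_nonneg: "K \<ge> 0" using F_bound[of 0] by linarith

lemma h_int_nonneg: "h_int \<ge> 0"
  unfolding h_int_def by (rule integral_nonneg_AE) (use h_nonneg in \<open>auto intro!: AE_I2\<close>)

lemma A_pos: "A \<ge> 1" using K_nonneg h_int_nonneg by (simp add: A_def)

lemma bounded_integrable: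
  fixes w :: "real \<Rightarrow> real"
  assumes "w \<in> borel_measurable M" "\<And>t. t \<in> {0..T} \<Longrightarrow> \<bar>w t\<bar> \<le> c"
  shows "integrable M w"
  by (rule Bochner_Integration.integrable_bound[OF integrable_const_M[of c] assms(1)])
     (use assms(2) in \<open>auto intro!: AE_I2 order_trans[OF _ abs_ge_self]\<close>)

lemma abs_lam_le:
  assumes "v \<in> borel_measurable M"
  shows "\<bar>lam v\<bar> * T \<le> h_int"
proof -
  have "\<bar>\<integral>t. g t (v t) \<partial>M\<bar> \<le> (\<integral>t. \<bar>g t (v t)\<bar> \<partial>M)" by (rule integral_abs_bound)
  also have "\<dots> \<le> h_int" unfolding h_int_def
    by (rule integral_mono) (use g_integrable[OF assms] h g_bound in auto)
  finally show ?thesis using T by (simp add: lam_def)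
qed

lemma g_lam_integrable:
  assumes "v \<in> borel_measurable M"
  shows "integrable M (\<lambda>t. g t (v t) - lam v)"
  by (intro Bochner_Integration.integrable_diff g_integrable assms integrable_const_M)

lemma abs_H_le:
  assumes v: "v \<in> borel_measurable M" and t: "t \<in> {0..T}"
  shows "\<bar>H v t\<bar> \<le> 2 * h_int"
proof -
  have "\<bar>H v t\<bar> \<le> (\<integral>t. \<bar>g t (v t) - lam v\<bar> \<partial>M)"
    unfolding H_def by (rule abs_integral_subinterval_le[OF g_lam_integrable[OF v]]) (use t in auto)
  also have "\<dots> \<le> (\<integral>t. h t + \<bar>lam v\<bar> \<partial>M)"
  proof (rule integral_mono)
    fix t assume "t \<in> space M"
    then have "t \<in> {0..T}" by simp
    from g_bound[OF this, of "v t"] show "\<bar>g t (v t) - lam v\<bar> \<le> h t + \<bar>lam v\<bar>" by linarith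
  qed (use g_lam_integrable[OF v] h integrable_const_M in auto)
  also have "\<dots> = h_int + \<bar>lam v\<bar> * T"
    using h integrable_const_M by (simp add: h_int_def measure_M)
  finally show ?thesis using abs_lam_le[OF v] by simp
qed

lemma H_cont:
  assumes v: "v \<in> borel_measurable M"
  shows "continuous_on {0..T} (H v)"
  unfolding H_def
  by (rule indefinite_integral_continuous_1) (use integrable_lebesgue_on_subinterval[OF g_lam_integrable[OF v]] in auto)

lemma H_ends:
  assumes v: "v \<in> borel_measurable M"
  shows "H v 0 = 0" "H v T = 0"
proof -
  have "H v T = (\<integral>t. g t (v t) - lam v \<partial>M)"
    unfolding H_def by (rule lebesgue_integral_eq_integral[symmetric, OF g_lam_integrable[OF v]]) auto
  also have "\<dots> = (\<integral>t. g t (v t) \<partial>M) - lam v * T"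
    using g_integrable[OF v] integrable_const_M by (simp add: measure_M)
  finally show "H v T = 0" using T by (simp add: lam_def)
qed (simp add: H_def)

lemma abs_slope_le:
  assumes "v \<in> borel_measurable M" "\<bar>a\<bar> \<le> A" "t \<in> {0..T}"
  shows "\<bar>slope a v t\<bar> \<le> S"
proof -
  have "\<bar>a - F (v t) - H v t\<bar> \<le> 2 * A"
    using abs_H_le[OF assms(1,3)] F_bound[of "v t"] assms(2) K_nonneg h_int_nonneg
    unfolding A_def by argo
  then show ?thesis unfolding slope_def S_def by (rule psi_abs_le)
qed

lemma slope_measurable:
  assumes v: "v \<in> borel_measurable M"
  shows "slope a v \<in> borel_measurable M"
proof -
  have [measurable]: "F \<in> borel_measurable borel" "\<psi> \<in> borel_measurable borel"
    using F_cont psi_cont by (auto intro: borel_measurable_continuous_onI)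
  have [measurable]: "H v \<in> borel_measurable M" by (rule continuous_on_borel_measurable_lebesgue_on[OF H_cont[OF v]])
  note v[measurable]
  show ?thesis unfolding slope_def[abs_def] by measurable
qed

lemma slope_integrable:
  assumes v: "v \<in> borel_measurable M" "\<bar>a\<bar> \<le> A"
  shows "integrable M (slope a v)"
  by (rule bounded_integrable[OF slope_measurable[OF v(1)] abs_slope_le[OF v]])

lemma S_nonneg: "S \<ge> 0" by (simp add: S_def)

lemma P_lipschitz:
  assumes v: "v \<in> borel_measurable M" "\<bar>a\<bar> \<le> A" and t: "t1 \<in> {0..T}" "t2 \<in> {0..T}"
  shows "\<bar>P a v t1 - P a v t2\<bar> \<le> S * \<bar>t1 - t2\<bar>"
proof -
  have *: "\<bar>P a v y - P a v x\<bar> \<le> S * (y - x)" if xy: "0 \<le> x" "x \<le> y" "y \<le> T" for x y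
  proof -
    note int = integrable_lebesgue_on_subinterval[OF slope_integrable[OF v]]
    have "P a v x + integral {x..y} (slope a v) = P a v y"
      unfolding P_def by (rule Henstock_Kurzweil_Integration.integral_combine) (use xy int in auto)
    moreover have "norm (integral {x..y} (slope a v)) \<le> S * (y - x)"
      using has_integral_bound_real[OF S_nonneg, of "{}" "slope a v" _ x y] int[of x y] xy abs_slope_le[OF v]
      by (auto simp: mult.commute)
    ultimately show ?thesis by simp
  qed
  show ?thesis using *[of t1 t2] *[of t2 t1] t by (cases "t1 \<le> t2") auto
qed

lemma P_cont:
  assumes v: "v \<in> borel_measurable M" "\<bar>a\<bar> \<le> A"
  shows "continuous_on {0..T} (P a v)"
  unfolding P_def
  by (rule indefinite_integral_continuous_1) (use integrable_lebesgue_on_subinterval[OF slope_integrable[OF v]] in auto)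

lemma abs_P_le:
  assumes v: "v \<in> borel_measurable M" "\<bar>a\<bar> \<le> A" and t: "t \<in> {0..T}"
  shows "\<bar>P a v t\<bar> \<le> S * T"
proof -
  have "P a v 0 = 0" by (simp add: P_def)
  then have "\<bar>P a v t\<bar> \<le> S * \<bar>t - 0\<bar>" using P_lipschitz[OF v t, of 0] T by simp
  also have "\<dots> \<le> S * T" using t S_nonneg by (intro mult_left_mono) auto
  finally show ?thesis .
qed

lemma sup_on_P:
  assumes v: "v \<in> borel_measurable M" "\<bar>a\<bar> \<le> A"
  shows "\<exists>t\<in>{0..T}. P a v t - b t = sup_on T (\<lambda>t. P a v t - b t)"
    "t \<in> {0..T} \<Longrightarrow> P a v t - b t \<le> sup_on T (\<lambda>t. P a v t - b t)"
proof -
  have "continuous_on {0..T} (\<lambda>t. P a v t - b t)" by (intro continuous_on_diff P_cont v b_cont)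
  from sup_on_attained[OF less_imp_le[OF T] this]
  show "\<exists>t\<in>{0..T}. P a v t - b t = sup_on T (\<lambda>t. P a v t - b t)"
    "t \<in> {0..T} \<Longrightarrow> P a v t - b t \<le> sup_on T (\<lambda>t. P a v t - b t)" by auto
qed

lemma abs_U_le:
  assumes v: "v \<in> borel_measurable M" "\<bar>a\<bar> \<le> A" and t: "t \<in> {0..T}"
  shows "\<bar>U a c v t\<bar> \<le> \<bar>c\<bar> + B + 2 * (S * T)"
proof -
  obtain x where x: "x \<in> {0..T}" "P a v x - b x = sup_on T (\<lambda>t. P a v t - b t)" using sup_on_P(1)[OF v] by blast
  show ?thesis unfolding U_def x(2)[symmetric]
    using abs_P_le[OF v x(1)] abs_P_le[OF v t] b_bound[OF x(1)] by linarith
qed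

text \<open>Pointwise convergence of \<open>v\<close> suffices, because all nonlinear terms sit under an integral.\<close>

lemma convergence:
  assumes vk: "\<And>k. vk k \<in> borel_measurable M" and v: "v \<in> borel_measurable M"
    and lim: "\<And>t. t \<in> {0..T} \<Longrightarrow> (\<lambda>k. vk k t) \<longlonglongrightarrow> v t"
    and ak: "\<And>k. \<bar>ak k\<bar> \<le> A" and a: "ak \<longlonglongrightarrow> a"
  shows "(\<lambda>k. lam (vk k)) \<longlonglongrightarrow> lam v" and "t \<in> {0..T} \<Longrightarrow> (\<lambda>k. P (ak k) (vk k) t) \<longlonglongrightarrow> P a v t"
    and "ck \<longlonglongrightarrow> c \<Longrightarrow> t \<in> {0..T} \<Longrightarrow> (\<lambda>k. U (ak k) (ck k) (vk k) t) \<longlonglongrightarrow> U a c v t"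
proof -
  have g_lim: "(\<lambda>k. g t (vk k t)) \<longlonglongrightarrow> g t (v t)" if "t \<in> {0..T}" for t
    using g_car that by (intro continuous_on_tendsto_compose[OF _ lim]) (auto simp: caratheodory_def)
  have aA: "\<bar>a\<bar> \<le> A" using LIMSEQ_le_const2[OF tendsto_rabs[OF a]] ak by auto
  show lam: "(\<lambda>k. lam (vk k)) \<longlonglongrightarrow> lam v"
    unfolding lam_def
  proof (intro tendsto_divide tendsto_const integral_dominated_convergence[OF _ _ h])
    show "AE t in M. (\<lambda>k. g t (vk k t)) \<longlonglongrightarrow> g t (v t)" using g_lim by (auto intro!: AE_I2)
    show "AE t in M. norm (g t (vk k t)) \<le> h t" for k using g_bound by (auto intro!: AE_I2)
  qed (use g_measurable vk v T in auto)
  have H: "(\<lambda>k. H (vk k) t) \<longlonglongrightarrow> H v t" if t: "t \<in> {0..T}" for t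
  proof -
    have "(\<lambda>k. \<integral>t. \<bar>(g t (vk k t) - lam (vk k)) - (g t (v t) - lam v)\<bar> \<partial>M) \<longlonglongrightarrow> (\<integral>t. 0 \<partial>M)"
    proof (rule integral_dominated_convergence[where w = "\<lambda>t. 2 * h t + 2 * (h_int / T)"])
      show "integrable M (\<lambda>t. 2 * h t + 2 * (h_int / T))" using h integrable_const_M by auto
      show "(\<lambda>t. \<bar>(g t (vk k t) - lam (vk k)) - (g t (v t) - lam v)\<bar>) \<in> borel_measurable M" for k
        using g_measurable[OF vk] g_measurable[OF v] by measurable
      show "AE t in M. (\<lambda>k. \<bar>(g t (vk k t) - lam (vk k)) - (g t (v t) - lam v)\<bar>) \<longlonglongrightarrow> 0"
      proof (rule AE_I2)
        fix t assume "t \<in> space M"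
        then have "t \<in> {0..T}" by simp
        then have "(\<lambda>k. (g t (vk k t) - lam (vk k)) - (g t (v t) - lam v)) \<longlonglongrightarrow> (g t (v t) - lam v) - (g t (v t) - lam v)"
          by (intro tendsto_intros g_lim lam)
        then show "(\<lambda>k. \<bar>(g t (vk k t) - lam (vk k)) - (g t (v t) - lam v)\<bar>) \<longlonglongrightarrow> 0"
          by (simp add: tendsto_rabs_zero)
      qed
      show "AE t in M. norm \<bar>(g t (vk k t) - lam (vk k)) - (g t (v t) - lam v)\<bar> \<le> 2 * h t + 2 * (h_int / T)" for k
      proof (rule AE_I2)
        fix t assume "t \<in> space M"
        then have t: "t \<in> {0..T}" by simp
        have "\<bar>lam (vk k)\<bar> \<le> h_int / T" "\<bar>lam v\<bar> \<le> h_int / T"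
          using abs_lam_le[OF vk] abs_lam_le[OF v] T by (auto simp: field_simps)
        with g_bound[OF t, of "vk k t"] g_bound[OF t, of "v t"]
        show "norm \<bar>(g t (vk k t) - lam (vk k)) - (g t (v t) - lam v)\<bar> \<le> 2 * h t + 2 * (h_int / T)"
          by (simp; linarith)
      qed
    qed simp
    then have "(\<lambda>k. \<integral>t. \<bar>(g t (vk k t) - lam (vk k)) - (g t (v t) - lam v)\<bar> \<partial>M) \<longlonglongrightarrow> 0" by simp
    then have "(\<lambda>k. H (vk k) t - H v t) \<longlonglongrightarrow> 0"
    proof (rule Lim_null_comparison[OF always_eventually, rotated], intro allI)
      fix k
      note int = g_lam_integrable[OF vk[of k]] g_lam_integrable[OF v]
      have "H (vk k) t - H v t = integral {0..t} (\<lambda>t. (g t (vk k t) - lam (vk k)) - (g t (v t) - lam v))"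
        unfolding H_def
        by (rule Henstock_Kurzweil_Integration.integral_diff[symmetric]; rule integrable_lebesgue_on_subinterval[OF int(1)] integrable_lebesgue_on_subinterval[OF int(2)])
           (use t in auto)
      then show "norm (H (vk k) t - H v t) \<le> (\<integral>t. \<bar>(g t (vk k t) - lam (vk k)) - (g t (v t) - lam v)\<bar> \<partial>M)"
        using abs_integral_subinterval_le[OF Bochner_Integration.integrable_diff[OF int], of 0 t] t by simp
    qed
    then show ?thesis by (simp add: LIM_zero_iff)
  qed
  have slope: "(\<lambda>k. slope (ak k) (vk k) t) \<longlonglongrightarrow> slope a v t" if t: "t \<in> {0..T}" for t
    unfolding slope_def
    by (intro continuous_on_tendsto_compose[OF psi_cont] tendsto_diff a H t
          continuous_on_tendsto_compose[OF F_cont] lim) auto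
  \<comment> \<open>The \<open>L1\<close> distance of the slopes bounds the difference of their
    primitives uniformly in \<open>t\<close>, which carries convergence over to the maxima in
    \<open>sup_on\<close>.\<close>
  define d where "d k = (\<integral>t. \<bar>slope (ak k) (vk k) t - slope a v t\<bar> \<partial>M)" for k
  have "d \<longlonglongrightarrow> (\<integral>t. 0 \<partial>M)" unfolding d_def
  proof (rule integral_dominated_convergence[where w = "\<lambda>t. 2 * S"])
    show "AE t in M. (\<lambda>k. \<bar>slope (ak k) (vk k) t - slope a v t\<bar>) \<longlonglongrightarrow> 0"
    proof (rule AE_I2)
      fix t assume "t \<in> space M"
      then have "(\<lambda>k. slope (ak k) (vk k) t - slope a v t) \<longlonglongrightarrow> 0" using slope[of t] by (simp add: LIM_zero)
      then show "(\<lambda>k. \<bar>slope (ak k) (vk k) t - slope a v t\<bar>) \<longlonglongrightarrow> 0" by (rule tendsto_rabs_zero)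
    qed
    show "AE t in M. norm \<bar>slope (ak k) (vk k) t - slope a v t\<bar> \<le> 2 * S" for k
    proof (rule AE_I2)
      fix t assume "t \<in> space M"
      then have t: "t \<in> {0..T}" by simp
      show "norm \<bar>slope (ak k) (vk k) t - slope a v t\<bar> \<le> 2 * S"
        using abs_slope_le[OF vk[of k] ak[of k] t] abs_slope_le[OF v aA t] by (simp; linarith)
    qed
    show "(\<lambda>t. \<bar>slope (ak k) (vk k) t - slope a v t\<bar>) \<in> borel_measurable M" for k
      using slope_measurable[OF vk] slope_measurable[OF v] by measurable
  qed (use integrable_const_M in auto)
  then have d: "d \<longlonglongrightarrow> 0" by simp
  have P_diff: "\<bar>P (ak k) (vk k) t - P a v t\<bar> \<le> d k" if t: "t \<in> {0..T}" for k t
  proof -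
    note int = slope_integrable[OF vk[of k] ak[of k]] slope_integrable[OF v aA]
    have "P (ak k) (vk k) t - P a v t = integral {0..t} (\<lambda>t. slope (ak k) (vk k) t - slope a v t)"
      unfolding P_def
      by (rule Henstock_Kurzweil_Integration.integral_diff[symmetric]; rule integrable_lebesgue_on_subinterval[OF int(1)] integrable_lebesgue_on_subinterval[OF int(2)])
         (use t in auto)
    then show ?thesis
      using abs_integral_subinterval_le[OF Bochner_Integration.integrable_diff[OF int], of 0 t] t by (simp add: d_def)
  qed
  show P: "(\<lambda>k. P (ak k) (vk k) t) \<longlonglongrightarrow> P a v t" if t: "t \<in> {0..T}" for t
  proof -
    have "(\<lambda>k. P (ak k) (vk k) t - P a v t) \<longlonglongrightarrow> 0"
      by (rule Lim_null_comparison[OF always_eventually d]) (use P_diff[OF t] in auto)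
    then show ?thesis by (simp add: LIM_zero_iff)
  qed
  have "(\<lambda>k. sup_on T (\<lambda>\<tau>. P (ak k) (vk k) \<tau> - b \<tau>) - sup_on T (\<lambda>\<tau>. P a v \<tau> - b \<tau>)) \<longlonglongrightarrow> 0"
  proof (rule Lim_null_comparison[OF always_eventually d], intro allI)
    fix k
    show "norm (sup_on T (\<lambda>\<tau>. P (ak k) (vk k) \<tau> - b \<tau>) - sup_on T (\<lambda>\<tau>. P a v \<tau> - b \<tau>)) \<le> d k"
      unfolding real_norm_def
      by (rule sup_on_diff_le) (use T P_diff in \<open>auto intro!: continuous_on_diff P_cont vk ak v aA b_cont\<close>)
  qed
  then have sup: "(\<lambda>k. sup_on T (\<lambda>\<tau>. P (ak k) (vk k) \<tau> - b \<tau>)) \<longlonglongrightarrow> sup_on T (\<lambda>\<tau>. P a v \<tau> - b \<tau>)"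
    by (simp add: LIM_zero_iff)
  show "(\<lambda>k. U (ak k) (ck k) (vk k) t) \<longlonglongrightarrow> U a c v t" if "ck \<longlonglongrightarrow> c" "t \<in> {0..T}"
    unfolding U_def by (intro tendsto_intros that sup P)
qed

lemma lipschitz_operator:
  assumes "lo \<le> hi" "max \<bar>lo\<bar> \<bar>hi\<bar> + B + 2 * (S * T) \<le> R"
  shows "lipschitz_operator T R S (- A) A lo hi U"
proof
  have B: "B \<ge> 0" using b_bound[of 0] T by auto
  show "0 \<le> R" using assms(2) B S_nonneg T mult_nonneg_nonneg[of S T] by linarith
  show "\<bar>U a c v t\<bar> \<le> R" if "a \<in> {-A..A}" "c \<in> {lo..hi}" "v \<in> admissible T R" "t \<in> {0..T}" for a c v t
  proof -
    have "\<bar>c\<bar> \<le> max \<bar>lo\<bar> \<bar>hi\<bar>" using that(2) by (auto simp: abs_le_iff)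
    moreover have "\<bar>U a c v t\<bar> \<le> \<bar>c\<bar> + B + 2 * (S * T)"
      using that by (intro abs_U_le) (auto simp: admissible_def abs_le_iff)
    ultimately show ?thesis using assms(2) by linarith
  qed
  show "\<bar>U a c v s - U a c v t\<bar> \<le> S * \<bar>s - t\<bar>"
    if "a \<in> {-A..A}" "v \<in> admissible T R" "s \<in> {0..T}" "t \<in> {0..T}" for a c v s t
    using P_lipschitz[of v a s t] that by (auto simp: admissible_def U_def)
  show "(\<lambda>k. U (ak k) (ck k) (vk k) t) \<longlonglongrightarrow> U a c v t"
    if "\<And>k. ak k \<in> {-A..A}" "\<And>k. vk k \<in> admissible T R" "ak \<longlonglongrightarrow> a" "ck \<longlonglongrightarrow> c"
      "v \<in> admissible T R" "\<And>t. t \<in> {0..T} \<Longrightarrow> (\<lambda>k. vk k t) \<longlonglongrightarrow> v t" "t \<in> {0..T}" for ak ck vk a c v t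
    by (rule convergence(3)) (use that in \<open>auto simp: admissible_def abs_le_iff\<close>, (smt (verit))+)
qed (use T A_pos assms in auto)

text \<open>Periodicity of \<open>u\<close> comes from \<open>P a u T = 0\<close>; that of
  \<open>slope a u\<close> follows since \<open>H u\<close> vanishes at both ends. Contact at level
  \<open>c\<close> is the normalisation built into \<open>U\<close>.\<close>

lemma fixpoint_solution:
  assumes u: "u \<in> borel_measurable M" and a: "\<bar>a\<bar> \<le> A" and fix_u: "\<And>t. t \<in> {0..T} \<Longrightarrow> U a c u t = u t"
    and P_T: "P a u T = 0"
  shows "integrated_solution T \<phi> F g (lam u) u (slope a u)"
    and "t \<in> {0..T} \<Longrightarrow> u t - b t \<le> c" and "\<exists>t\<in>{0..T}. u t - b t = c"
proof -
  define d where "d = c - sup_on T (\<lambda>\<tau>. P a u \<tau> - b \<tau>)"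
  have u_eq: "u t = d + P a u t" if "t \<in> {0..T}" for t using fix_u[OF that] by (simp add: U_def d_def)
  have u_cont: "continuous_on {0..T} u"
    by (rule continuous_on_eq[OF continuous_on_add[OF continuous_on_const[of _ d] P_cont[OF u a]]])
       (use u_eq in simp)
  have F: "continuous_on {0..T} (\<lambda>t. F (u t))"
    by (rule continuous_on_compose2[OF F_cont u_cont]) auto
  have sl: "continuous_on {0..T} (slope a u)"
    unfolding slope_def by (rule continuous_on_compose2[OF psi_cont]) (auto intro!: continuous_intros F H_cont u)
  have deriv: "(u has_real_derivative slope a u t) (at t within {0..T})" if t: "t \<in> {0..T}" for t
  proof -
    have "((\<lambda>t. d + P a u t) has_real_derivative 0 + slope a u t) (at t within {0..T})"
      unfolding P_def by (intro DERIV_add DERIV_const integral_has_real_derivative sl t)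
    then have "((\<lambda>t. d + P a u t) has_real_derivative slope a u t) (at t within {0..T})" by simp
    then show ?thesis
      by (rule has_field_derivative_transform_within[OF _ zero_less_one t]) (use u_eq in simp)
  qed
  have u0T: "u 0 = u T" using u_eq[of 0] u_eq[of T] P_T T by (simp add: P_def)
  have sl0T: "slope a u 0 = slope a u T" unfolding slope_def u0T H_ends[OF u] ..
  have eq: "\<phi> (slope a u t) + F (u t) + H u t = a" for t by (simp add: slope_def phi_psi)
  have "\<phi> (slope a u t) + F (u t) + integral {0..t} (\<lambda>\<tau>. g \<tau> (u \<tau>) - lam u) = \<phi> (slope a u 0) + F (u 0)" for t
    using eq[of t] eq[of 0] H_ends(1)[OF u] by (simp add: H_def)
  then show "integrated_solution T \<phi> F g (lam u) u (slope a u)"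
    unfolding integrated_solution_def C1_periodic_def using deriv sl u0T sl0T by blast
  show "t \<in> {0..T} \<Longrightarrow> u t - b t \<le> c"
    using sup_on_P(2)[OF u a, of t] u_eq[of t] by (simp add: d_def)
  show "\<exists>t\<in>{0..T}. u t - b t = c"
    using sup_on_P(1)[OF u a] u_eq by (force simp: d_def)
qed

text \<open>At both ends of \<open>{- A..A}\<close> the integrand has a fixed sign, so the update
  \<open>a - P a u T\<close> points inwards there, and a fixed point of its clipped form satisfies
  \<open>P a u T = 0\<close>.\<close>

lemma P_end_sign:
  assumes u: "u \<in> borel_measurable M"
  shows "P A u T > 0" "P (- A) u T < 0"
proof -
  have T0: "0 \<le> T" using T by simp
  have int: "slope A u integrable_on {0..T}" "slope (- A) u integrable_on {0..T}"
    by (rule integrable_lebesgue_on_subinterval[OF slope_integrable[OF u]], use A_pos in auto)+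
  have "slope A u t \<ge> \<psi> 1" "slope (- A) u t \<le> \<psi> (- 1)" if "t \<in> {0..T}" for t
    unfolding slope_def strict_mono_less_eq[OF psi_strict]
    using abs_H_le[OF u that] F_bound[of "u t"] by (auto simp: A_def)
  then have "integral {0..T} (\<lambda>_. \<psi> 1) \<le> P A u T" "P (- A) u T \<le> integral {0..T} (\<lambda>_. \<psi> (- 1))"
    unfolding P_def by (intro integral_le int integrable_const_ivl; blast)+
  moreover have "\<psi> 1 > 0" "\<psi> (- 1) < 0"
    using strict_mono_less[OF psi_strict, of 0 1] strict_mono_less[OF psi_strict, of "-1" 0] psi_0 by auto
  then have "T * \<psi> 1 > 0" "T * \<psi> (- 1) < 0" using T by (auto simp: mult_pos_neg)
  ultimately show "P A u T > 0" "P (- A) u T < 0" using T0 by auto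
qed

text \<open>Periodicity is coded as a fixed point of a clipped update of \<open>a\<close>, so one
  application of \<open>fixpoint\<close> settles \<open>a\<close>, \<open>c\<close> and
  \<open>u\<close> together. The factor \<open>e\<close> fixes the direction in which
  \<open>\<mu> - s\<close> moves \<open>c\<close>; whether \<open>\<mu> = s\<close> is left open
  here.\<close>

theorem exists_solution_with_contact:
  assumes lohi: "lo \<le> hi"
  obtains c \<mu> u u' where "c \<in> {lo..hi}" "clip lo hi (c + e * (\<mu> - s)) = c" "integrated_solution T \<phi> F g \<mu> u u'"
    "\<And>t. t \<in> {0..T} \<Longrightarrow> u t - b t \<le> c" "\<exists>t\<in>{0..T}. u t - b t = c"
proof -
  define R where "R = max \<bar>lo\<bar> \<bar>hi\<bar> + B + 2 * (S * T)"
  interpret op: lipschitz_operator T R S "- A" A lo hi U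
    by (rule lipschitz_operator[OF lohi]) (simp add: R_def)
  obtain a c u where a: "a \<in> {- A..A}" and c: "c \<in> {lo..hi}" and u: "u \<in> admissible T R"
    and fa: "clip (- A) A (a - P a u T) = a" and fc: "clip lo hi (c + e * (lam u - s)) = c"
    and fu: "\<And>t. t \<in> {0..T} \<Longrightarrow> U a c u t = u t"
  proof (rule op.fixpoint[of "\<lambda>a c v. clip (- A) A (a - P a v T)" "\<lambda>a c v. clip lo hi (c + e * (lam v - s))"])
    show "clip (- A) A (a - P a v T) \<in> {- A..A}" "clip lo hi (c + e * (lam v - s)) \<in> {lo..hi}" for a c v
      using A_pos lohi by (intro clip_simps(1); simp)+
    show "(\<lambda>k. clip (- A) A (ak k - P (ak k) (vk k) T)) \<longlonglongrightarrow> clip (- A) A (a - P a v T) \<and>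
       (\<lambda>k. clip lo hi (ck k + e * (lam (vk k) - s))) \<longlonglongrightarrow> clip lo hi (c + e * (lam v - s))"
      if ak: "\<And>k. ak k \<in> {-A..A}" and vk: "\<And>k. vk k \<in> admissible T R" and lims: "ak \<longlonglongrightarrow> a" "ck \<longlonglongrightarrow> c"
      and v: "v \<in> admissible T R" and lim: "\<And>t. t \<in> {0..T} \<Longrightarrow> (\<lambda>k. vk k t) \<longlonglongrightarrow> v t" for ak ck vk a c v
    proof -
      have "vk k \<in> borel_measurable M" "v \<in> borel_measurable M" "\<bar>ak k\<bar> \<le> A" for k
        using ak[of k] vk[of k] v by (auto simp: admissible_def abs_le_iff)
      note conv = convergence(1,2)[OF this(1,2) lim this(3) lims(1)]
      show ?thesis
        by (intro conjI tendsto_clip tendsto_diff tendsto_add tendsto_mult tendsto_const lims conv) (use T in auto)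
    qed
  qed blast
  have um: "u \<in> borel_measurable M" and aA: "\<bar>a\<bar> \<le> A" using u a by (auto simp: admissible_def abs_le_iff)
  have "P a u T = 0"
  proof (rule ccontr)
    assume "P a u T \<noteq> 0"
    with fa a have "a = A \<and> P a u T < 0 \<or> a = - A \<and> P a u T > 0"
      using A_pos by (auto simp: clip_def max_def min_def split: if_splits)
    with P_end_sign[OF um] show False by auto
  qed
  from fixpoint_solution[OF um aA fu this] c fc that show ?thesis by blast
qed

text \<open>Solutions with a common bound are exact fixed points of \<open>U\<close>, so compactness
  applies with error 0. Continuity of \<open>lam\<close> and \<open>P\<close> identifies the
  limiting parameter and keeps the limit periodic.\<close>

theorem solutions_closed:
  assumes sol: "\<And>k. integrated_solution T \<phi> F g (sk k) (uk k) (uk' k)" and s: "sk \<longlonglongrightarrow> s"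
    and bound: "\<And>k t. t \<in> {0..T} \<Longrightarrow> \<bar>uk k t\<bar> \<le> R"
  obtains u u' where "integrated_solution T \<phi> F g s u u'" "\<And>t. t \<in> {0..T} \<Longrightarrow> \<bar>u t\<bar> \<le> R"
proof -
  have C1: "C1_periodic T (uk k) (uk' k)" for k using sol by (simp add: integrated_solution_def)
  note u = C1_periodicD[OF C1]
  have um: "uk k \<in> borel_measurable M" for k by (rule continuous_on_borel_measurable_lebesgue_on[OF u(2)])
  have eq: "\<phi> (uk' k t) + F (uk k t) + integral {0..t} (\<lambda>\<tau>. g \<tau> (uk k \<tau>) - sk k) = \<phi> (uk' k 0) + F (uk k 0)"
    if "t \<in> {0..T}" for k t using sol that by (simp add: integrated_solution_def)
  have lam: "lam (uk k) = sk k" for k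
  proof -
    have "integral {0..T} (\<lambda>\<tau>. g \<tau> (uk k \<tau>) - sk k) = 0" using eq[of T k] u(4,5)[of k] T by simp
    moreover have "integral {0..T} (\<lambda>\<tau>. g \<tau> (uk k \<tau>) - sk k) = (\<integral>t. g t (uk k t) - sk k \<partial>M)"
      by (rule lebesgue_integral_eq_integral[symmetric]) (auto intro!: g_integrable um integrable_const_M)
    ultimately show ?thesis using g_integrable[OF um[of k]] integrable_const_M T
      by (simp add: measure_M lam_def)
  qed
  define ak where "ak k = \<phi> (uk' k 0) + F (uk k 0)" for k
  have H: "\<phi> (uk' k t) = ak k - F (uk k t) - H (uk k) t" if "t \<in> {0..T}" for k t
    using eq[OF that, of k] by (simp add: ak_def H_def lam)
  have slope: "slope (ak k) (uk k) t = uk' k t" if "t \<in> {0..T}" for k t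
    unfolding slope_def H[OF that, symmetric] by (rule psi_phi)
  \<comment> \<open>At a zero of \<open>uk' k\<close>, which Rolle's theorem supplies, the
    \<open>\<phi>\<close> term vanishes and \<open>ak k\<close> is the sum of an \<open>F\<close>
    term and an \<open>H\<close> term.\<close>
  have akA: "\<bar>ak k\<bar> \<le> A" for k
  proof -
    obtain z where z: "0 < z" "z < T" "uk' k z = 0"
    proof -
      have "((uk k) has_derivative (*) (uk' k x)) (at x)" if "0 < x" "x < T" for x
        using u(1)[of x k] that by (simp add: at_within_Icc_at has_field_derivative_def)
      from Rolle_deriv[OF T u(4)[symmetric] u(2) this] obtain z where
        "0 < z" "z < T" "(*) (uk' k z) = (\<lambda>v. 0)" by blast
      then have "uk' k z * 1 = 0" by metis
      with \<open>0 < z\<close> \<open>z < T\<close> show ?thesis by (intro that[of z]) simp_all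
    qed
    then show ?thesis using H[of z k] abs_H_le[OF um, of z k] F_bound[of "uk k z"] phi_0 by (auto simp: A_def)
  qed
  have P: "P (ak k) (uk k) t = uk k t - uk k 0" if t: "t \<in> {0..T}" for k t
  proof -
    have "P (ak k) (uk k) t = integral {0..t} (uk' k)"
      unfolding P_def by (rule Henstock_Kurzweil_Integration.integral_cong) (use slope t in auto)
    then show ?thesis using integral_unique[OF C1_periodic_integral[OF C1, of 0 t]] t by simp
  qed
  \<comment> \<open>The maximum of \<open>uk k - b\<close>, which is the level at which
    \<open>U\<close> reproduces \<open>uk k\<close>.\<close>
  define ck where "ck k = sup_on T (\<lambda>\<tau>. P (ak k) (uk k) \<tau> - b \<tau>) + uk k 0" for k
  define C where "C = S * T + B + R"
  have ck: "\<bar>ck k\<bar> \<le> C" for k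
  proof -
    obtain x where x: "x \<in> {0..T}" "P (ak k) (uk k) x - b x = sup_on T (\<lambda>t. P (ak k) (uk k) t - b t)"
      using sup_on_P(1)[OF um akA] by blast
    show ?thesis unfolding ck_def C_def x(2)[symmetric]
      using abs_P_le[OF um[of k] akA[of k] x(1)] b_bound[OF x(1)] bound[of 0 k] T by (simp; linarith)
  qed
  have U: "U (ak k) (ck k) (uk k) t = uk k t" if "t \<in> {0..T}" for k t
    using P[OF that, of k] by (simp add: U_def ck_def)
  define R' where "R' = max \<bar>- C\<bar> \<bar>C\<bar> + B + 2 * (S * T) + \<bar>R\<bar>"
  have C0: "- C \<le> C" using ck[of 0] by linarith
  interpret op: lipschitz_operator T R' S "- A" A "- C" C U
    by (rule lipschitz_operator[OF C0]) (simp add: R'_def)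
  have "R \<le> R'"
    using b_bound[of 0] T S_nonneg mult_nonneg_nonneg[OF S_nonneg, of T] unfolding R'_def by (auto; linarith)
  then have adm: "uk k \<in> admissible T R'" for k
    using um[of k] order_trans[OF bound[of _ k]] by (simp add: admissible_def)
  obtain \<sigma> a c v where lim: "strict_mono (\<sigma>::nat \<Rightarrow> nat)" "(\<lambda>k. ak (\<sigma> k)) \<longlonglongrightarrow> a" "(\<lambda>k. ck (\<sigma> k)) \<longlonglongrightarrow> c"
    "a \<in> {- A..A}" "c \<in> {- C..C}" "v \<in> admissible T R'" "\<And>t. t \<in> {0..T} \<Longrightarrow> (\<lambda>k. uk (\<sigma> k) t) \<longlonglongrightarrow> v t"
    "\<And>t. t \<in> {0..T} \<Longrightarrow> U a c v t = v t"
  proof (rule op.approximate_fixpoints_converge[of ak ck uk "\<lambda>_. 0"])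
    show "ak k \<in> {- A..A}" "ck k \<in> {- C..C}" for k using akA[of k] ck[of k] by (auto simp: abs_le_iff)
  qed (use adm U in auto)
  have vm: "v \<in> borel_measurable M" and aA: "\<bar>a\<bar> \<le> A" using lim(4,6) by (auto simp: admissible_def abs_le_iff)
  note conv = convergence(1,2)[of "\<lambda>k. uk (\<sigma> k)" v "\<lambda>k. ak (\<sigma> k)" a, OF um vm lim(7) akA lim(2)]
  have "(\<lambda>k. sk (\<sigma> k)) \<longlonglongrightarrow> s" using LIMSEQ_subseq_LIMSEQ[OF s lim(1)] by (simp add: o_def)
  with conv(1) have "lam v = s" unfolding lam using LIMSEQ_unique by blast
  moreover have "P a v T = 0"
  proof (rule LIMSEQ_unique[OF conv(2)])
    show "(\<lambda>k. P (ak (\<sigma> k)) (uk (\<sigma> k)) T) \<longlonglongrightarrow> 0" using P[of T] u(4) T by simp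
  qed (use T in auto)
  ultimately have "integrated_solution T \<phi> F g s v (slope a v)"
    using fixpoint_solution(1)[OF vm aA lim(8)] by simp
  moreover have "\<bar>v t\<bar> \<le> R" if t: "t \<in> {0..T}" for t
    using LIMSEQ_le_const2[OF tendsto_rabs[OF lim(7)[OF t]]] bound[OF t] by auto
  ultimately show ?thesis using that by blast
qed

end

section \<open>A priori bounds\<close>

text \<open>Integrated form of the inequality
  \<open>(\<phi> (b'))' + (F (b))' + g (t, b) \<le> s\<close>, demanded on every subinterval. It
  covers solutions for \<open>s\<close> as well as the constant of (H2), and \<open>b\<close> is
  strict for every larger parameter.\<close>

definition upper_solution ::
  "real \<Rightarrow> (real \<Rightarrow> real) \<Rightarrow> (real \<Rightarrow> real) \<Rightarrow> (real \<Rightarrow> real \<Rightarrow> real) \<Rightarrow> real \<Rightarrow> (real \<Rightarrow> real) \<Rightarrow> (real \<Rightarrow> real) \<Rightarrow> bool"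
where
  "upper_solution T \<phi> F g s b b' \<longleftrightarrow> C1_periodic T b b' \<and>
     (\<forall>x y. 0 \<le> x \<longrightarrow> x \<le> y \<longrightarrow> y \<le> T \<longrightarrow>
       \<phi> (b' y) + F (b y) + integral {x..y} (\<lambda>\<tau>. g \<tau> (b \<tau>) - s) \<le> \<phi> (b' x) + F (b x))"

text \<open>\<open>K\<close> bounds the \<open>L\<^sup>1\<close> norm of \<open>g (t, u) - s\<close> along a solution, and \<open>\<bar>\<xi>\<bar> \<ge> max (\<psi> (K + 1)) (- \<psi> (- (K + 1)))\<close>
  forces \<open>\<bar>\<phi> \<xi>\<bar> \<ge> K + 1\<close>.\<close>

definition osc_bound :: "real \<Rightarrow> (real \<Rightarrow> real) \<Rightarrow> real \<Rightarrow> real \<Rightarrow> real" where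
  "osc_bound T \<psi> \<Gamma> s = (let K = 2 * T * max s 0 + 2 * \<Gamma> in (K + 1) * max (\<psi> (K + 1)) (- \<psi> (- (K + 1))) * T)"

context phi_problem
begin

lemma g_along_integrable:
  "C1_periodic T u u' \<Longrightarrow> integrable M (\<lambda>t. g t (u t))"
  by (intro caratheodory_integrable_continuous g_car C1_periodicD(2))

lemma solution_integral:
  assumes sol: "integrated_solution T \<phi> F g s u u'" and xy: "0 \<le> x" "x \<le> y" "y \<le> T"
  shows "\<phi> (u' y) + F (u y) + integral {x..y} (\<lambda>\<tau>. g \<tau> (u \<tau>) - s) = \<phi> (u' x) + F (u x)"
proof -
  have C1: "C1_periodic T u u'" using sol by (simp add: integrated_solution_def)
  have "integral {0..x} (\<lambda>\<tau>. g \<tau> (u \<tau>) - s) + integral {x..y} (\<lambda>\<tau>. g \<tau> (u \<tau>) - s) = integral {0..y} (\<lambda>\<tau>. g \<tau> (u \<tau>) - s)"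
  proof (rule Henstock_Kurzweil_Integration.integral_combine)
    show "(\<lambda>\<tau>. g \<tau> (u \<tau>) - s) integrable_on {0..y}"
      by (rule integrable_lebesgue_on_subinterval[of 0 T])
         (use xy in \<open>auto intro!: g_along_integrable[OF C1] integrable_const_M\<close>)
  qed (use xy in auto)
  moreover have "\<phi> (u' y) + F (u y) + integral {0..y} (\<lambda>\<tau>. g \<tau> (u \<tau>) - s) = \<phi> (u' 0) + F (u 0)"
    "\<phi> (u' x) + F (u x) + integral {0..x} (\<lambda>\<tau>. g \<tau> (u \<tau>) - s) = \<phi> (u' 0) + F (u 0)"
    using sol xy by (auto simp: integrated_solution_def)
  ultimately show ?thesis by linarith
qed

lemma solution_is_upper:
  "integrated_solution T \<phi> F g s u u' \<Longrightarrow> upper_solution T \<phi> F g s u u'"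
  unfolding upper_solution_def using solution_integral
  by (auto simp: integrated_solution_def)

lemma solution_mean:
  assumes sol: "integrated_solution T \<phi> F g s u u'"
  shows "(\<integral>t. g t (u t) \<partial>M) = s * T"
proof -
  have C1: "C1_periodic T u u'" using sol by (simp add: integrated_solution_def)
  note gi = g_along_integrable[OF C1]
  have "integral {0..T} (\<lambda>\<tau>. g \<tau> (u \<tau>) - s) = 0"
    using solution_integral[OF sol, of 0 T] C1_periodicD(4,5)[OF C1] T by simp
  moreover have "integral {0..T} (\<lambda>\<tau>. g \<tau> (u \<tau>) - s) = (\<integral>t. g t (u t) - s \<partial>M)"
    by (rule lebesgue_integral_eq_integral[symmetric]) (auto intro!: gi integrable_const_M)
  ultimately show ?thesis using gi integrable_const_M T by (simp add: measure_M)
qed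

text \<open>Keeps the set of solvable parameters bounded below, so that its infimum is a real
  number.\<close>

lemma solution_parameter_bound:
  assumes sol: "integrated_solution T \<phi> F g s u u'"
    and \<gamma>: "integrable M \<gamma>" and lower: "AE t in M. \<forall>x. g t x \<ge> - \<gamma> t"
  shows "s * T \<ge> - (\<integral>t. \<gamma> t \<partial>M)"
proof -
  have C1: "C1_periodic T u u'" using sol by (simp add: integrated_solution_def)
  have "(\<integral>t. - \<gamma> t \<partial>M) \<le> (\<integral>t. g t (u t) \<partial>M)"
    by (rule integral_mono_AE) (use \<gamma> lower g_along_integrable[OF C1] in auto)
  then show ?thesis using solution_mean[OF sol] by simp
qed

text \<open>Testing the equation with \<open>u'\<close> kills the friction term \<open>F (u) u'\<close> by periodicity, and
  \<open>\<phi> (u') u'\<close> grows superlinearly in \<open>u'\<close>.\<close>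

lemma solution_oscillation:
  assumes sol: "integrated_solution T \<phi> F g s u u'" and sS: "s \<le> S"
    and \<gamma>: "integrable M \<gamma>" "\<And>t. \<gamma> t \<ge> 0" and lower: "AE t in M. \<forall>x. g t x \<ge> - \<gamma> t"
    and xy: "x \<in> {0..T}" "y \<in> {0..T}"
  shows "\<bar>u y - u x\<bar> \<le> osc_bound T \<psi> (\<integral>t. \<gamma> t \<partial>M) S"
proof -
  define \<Gamma> where "\<Gamma> = (\<integral>t. \<gamma> t \<partial>M)"
  define K where "K = 2 * T * max S 0 + 2 * \<Gamma>"
  define m where "m = max (\<psi> (K + 1)) (- \<psi> (- (K + 1)))"
  have C1: "C1_periodic T u u'" using sol by (simp add: integrated_solution_def)
  note u = C1_periodicD[OF C1]
  note gi = g_along_integrable[OF C1]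
  have \<Gamma>0: "\<Gamma> \<ge> 0" unfolding \<Gamma>_def using \<gamma> by (intro integral_nonneg_AE) auto
  have K0: "K \<ge> 0" using \<Gamma>0 T by (simp add: K_def)
  \<comment> \<open>For \<open>\<bar>\<xi>\<bar> < m\<close> the right-hand side is negative, while
    \<open>\<phi> \<xi> * \<xi>\<close> never is.\<close>
  have coerc: "\<phi> \<xi> * \<xi> \<ge> (K + 1) * \<bar>\<xi>\<bar> - (K + 1) * m" for \<xi>
  proof -
    have sgn: "\<phi> \<xi> * \<xi> = \<bar>\<phi> \<xi>\<bar> * \<bar>\<xi>\<bar>"
      using strict_mono_less_eq[OF phi_strict, of 0 \<xi>] phi_0 by (auto simp: abs_if not_le[symmetric])
    show ?thesis
    proof (cases "\<bar>\<xi>\<bar> \<ge> m")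
      case True
      then have "\<xi> \<ge> \<psi> (K + 1) \<or> \<xi> \<le> \<psi> (- (K + 1))" by (auto simp: m_def abs_if split: if_splits)
      then have "\<bar>\<phi> \<xi>\<bar> \<ge> K + 1"
        using strict_mono_less_eq[OF phi_strict, of "\<psi> (K + 1)" \<xi>] strict_mono_less_eq[OF phi_strict, of \<xi> "\<psi> (- (K + 1))"]
        by (auto simp: phi_psi)
      then have "\<bar>\<phi> \<xi>\<bar> * \<bar>\<xi>\<bar> \<ge> (K + 1) * \<bar>\<xi>\<bar>" by (intro mult_right_mono) auto
      moreover have "m \<ge> 0"
        using strict_mono_less_eq[OF psi_strict, of 0 "K + 1"] psi_0 K0 by (auto simp: m_def)
      then have "(K + 1) * m \<ge> 0" using K0 by simp
      ultimately show ?thesis using sgn by linarith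
    next
      case False
      then have "(K + 1) * \<bar>\<xi>\<bar> \<le> (K + 1) * m" using K0 by (intro mult_left_mono) auto
      then show ?thesis using sgn by (smt (verit) mult_nonneg_nonneg abs_ge_zero)
    qed
  qed
  define a where "a = \<phi> (u' 0) + F (u 0)"
  define H where "H t = integral {0..t} (\<lambda>\<tau>. g \<tau> (u \<tau>) - s)" for t
  have eq: "\<phi> (u' t) = a - F (u t) - H t" if "t \<in> {0..T}" for t
    using solution_integral[OF sol, of 0 t] that by (simp add: a_def H_def)
  have gs: "integrable M (\<lambda>\<tau>. g \<tau> (u \<tau>) - s)" using gi integrable_const_M by auto
  \<comment> \<open>The lower bound \<open>- \<gamma>\<close> gives
    \<open>\<bar>g\<bar> \<le> g + 2 * \<gamma>\<close>, and the integral of \<open>g\<close> along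
    \<open>u\<close> is known to be \<open>s * T\<close>. A one-sided bound thus becomes an
    \<open>L1\<close> bound.\<close>
  have H_le: "\<bar>H t\<bar> \<le> K" if t: "t \<in> {0..T}" for t
  proof -
    have "\<bar>H t\<bar> \<le> (\<integral>\<tau>. \<bar>g \<tau> (u \<tau>) - s\<bar> \<partial>M)"
      unfolding H_def by (rule abs_integral_subinterval_le[OF gs]) (use t in auto)
    also have "\<dots> \<le> (\<integral>\<tau>. g \<tau> (u \<tau>) + 2 * \<gamma> \<tau> + \<bar>s\<bar> \<partial>M)"
    proof (rule integral_mono_AE)
      show "AE \<tau> in M. \<bar>g \<tau> (u \<tau>) - s\<bar> \<le> g \<tau> (u \<tau>) + 2 * \<gamma> \<tau> + \<bar>s\<bar>"
        using lower
      proof (rule AE_mp, intro AE_I2 impI)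
        fix \<tau> assume "\<forall>x. g \<tau> x \<ge> - \<gamma> \<tau>"
        then have "g \<tau> (u \<tau>) \<ge> - \<gamma> \<tau>" by blast
        with \<gamma>(2)[of \<tau>] show "\<bar>g \<tau> (u \<tau>) - s\<bar> \<le> g \<tau> (u \<tau>) + 2 * \<gamma> \<tau> + \<bar>s\<bar>" by linarith
      qed
    qed (use gs gi \<gamma> integrable_const_M in auto)
    also have "\<dots> = s * T + 2 * \<Gamma> + \<bar>s\<bar> * T"
      using gi \<gamma> integrable_const_M T solution_mean[OF sol] by (simp add: \<Gamma>_def measure_M)
    also have "\<dots> \<le> K"
    proof -
      have "(s + \<bar>s\<bar>) * T \<le> 2 * max S 0 * T" using sS T by (intro mult_right_mono) auto
      then show ?thesis by (simp add: K_def algebra_simps)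
    qed
    finally show ?thesis .
  qed
  have cphi: "continuous_on {0..T} (\<lambda>t. \<phi> (u' t))" by (rule continuous_on_compose2[OF phi_cont u(3)]) auto
  have cF: "continuous_on {0..T} (\<lambda>t. F (u t))" by (rule continuous_on_compose2[OF F_cont u(2)]) auto
  obtain R where R: "\<And>t. t \<in> {0..T} \<Longrightarrow> \<bar>u t\<bar> \<le> R" using continuous_on_interval_abs_bounded[OF u(2)] by blast
  \<comment> \<open>The integrand is the derivative of a primitive of \<open>F\<close> composed with
    \<open>u\<close>, which agrees at 0 and \<open>T\<close>. The base point \<open>- R\<close> lies
    at or below the range of \<open>u\<close>.\<close>
  have Fu': "((\<lambda>t. F (u t) * u' t) has_integral 0) {0..T}"
  proof -
    have "((\<lambda>t. F (u t) * u' t) has_integral (integral {- R..u T} F - integral {- R..u 0} F)) {0..T}"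
    proof (rule fundamental_theorem_of_calculus)
      fix t assume t: "t \<in> {0..T}"
      have "((\<lambda>x. integral {- R..x} F) has_real_derivative F (u t)) (at (u t) within {- R..R})"
        using R[OF t] by (intro integral_has_real_derivative continuous_on_subset[OF F_cont]) (auto simp: abs_le_iff)
      then have "((\<lambda>x. integral {- R..x} F) has_real_derivative F (u t)) (at (u t) within u ` {0..T})"
        by (rule has_field_derivative_subset) (use R in \<open>force simp: abs_le_iff\<close>)
      from DERIV_image_chain[OF this u(1)[OF t]]
      show "((\<lambda>t. integral {- R..u t} F) has_vector_derivative F (u t) * u' t) (at t within {0..T})"
        by (simp add: o_def has_real_derivative_iff_has_vector_derivative)
    qed (use T in auto)
    then show ?thesis by (simp add: u(4))
  qed
  have au': "((\<lambda>t. a * u' t) has_integral 0) {0..T}"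
    using has_integral_mult_right[OF C1_periodic_integral[OF C1, of 0 T], of a] T u(4) by simp
  have int1: "(\<lambda>t. \<phi> (u' t) * u' t) integrable_on {0..T}" "(\<lambda>t. \<bar>u' t\<bar>) integrable_on {0..T}"
    by (intro integrable_continuous_real continuous_intros cphi u(3))+
  define V where "V = integral {0..T} (\<lambda>t. \<bar>u' t\<bar>)"
  have "((\<lambda>t. \<phi> (u' t) * u' t - (a * u' t - F (u t) * u' t)) has_integral
       (integral {0..T} (\<lambda>t. \<phi> (u' t) * u' t) - (0 - 0))) {0..T}"
    by (intro has_integral_diff au' Fu' integrable_integral int1)
  then have "((\<lambda>t. \<phi> (u' t) * u' t - (a * u' t - F (u t) * u' t)) has_integral
       integral {0..T} (\<lambda>t. \<phi> (u' t) * u' t)) {0..T}" by simp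
  moreover have "((\<lambda>t. K * \<bar>u' t\<bar>) has_integral K * V) {0..T}"
    unfolding V_def by (intro has_integral_mult_right integrable_integral int1)
  ultimately have "integral {0..T} (\<lambda>t. \<phi> (u' t) * u' t) \<le> K * V"
  proof (rule has_integral_le)
    fix t assume t: "t \<in> {0..T}"
    have "\<phi> (u' t) * u' t - (a * u' t - F (u t) * u' t) = - H t * u' t"
      unfolding eq[OF t] by (simp add: algebra_simps)
    also have "\<dots> \<le> \<bar>H t\<bar> * \<bar>u' t\<bar>" by (metis abs_ge_self abs_minus_cancel abs_mult)
    also have "\<dots> \<le> K * \<bar>u' t\<bar>" using H_le[OF t] by (intro mult_right_mono) auto
    finally show "\<phi> (u' t) * u' t - (a * u' t - F (u t) * u' t) \<le> K * \<bar>u' t\<bar>" .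
  qed
  moreover have "(K + 1) * V - (K + 1) * m * T \<le> integral {0..T} (\<lambda>t. \<phi> (u' t) * u' t)"
  proof (rule has_integral_le)
    show "((\<lambda>t. (K + 1) * \<bar>u' t\<bar> - (K + 1) * m) has_integral ((K + 1) * V - (K + 1) * m * T)) {0..T}"
      unfolding V_def using T has_integral_const_real[of "(K + 1) * m" 0 T]
      by (intro has_integral_diff has_integral_mult_right integrable_integral int1) (simp add: mult.commute)
    show "((\<lambda>t. \<phi> (u' t) * u' t) has_integral integral {0..T} (\<lambda>t. \<phi> (u' t) * u' t)) {0..T}"
      by (intro integrable_integral int1)
    show "(K + 1) * \<bar>u' t\<bar> - (K + 1) * m \<le> \<phi> (u' t) * u' t" for t by (rule coerc)
  qed
  \<comment> \<open>The two estimates combine to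
    \<open>(K + 1) * V - (K + 1) * m * T \<le> K * V\<close>; the excess of \<open>K + 1\<close>
    over \<open>K\<close> is what leaves a bound on \<open>V\<close>.\<close>
  ultimately have V: "V \<le> (K + 1) * m * T" by (simp add: algebra_simps)
  have *: "\<bar>u z - u w\<bar> \<le> V" if zw: "0 \<le> w" "w \<le> z" "z \<le> T" for z w
  proof -
    note I = C1_periodic_integral[OF C1 zw]
    have sub: "(\<lambda>t. \<bar>u' t\<bar>) integrable_on {w..z}"
      using int1(2) by (rule integrable_on_subinterval) (use zw in auto)
    have "norm (u z - u w) \<le> integral {w..z} (\<lambda>t. \<bar>u' t\<bar>)"
      using integral_norm_bound_integral[of u' "{w..z}" "\<lambda>t. \<bar>u' t\<bar>"] I sub
      by (auto simp: integral_unique has_integral_integrable)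
    also have "\<dots> \<le> V"
      unfolding V_def by (rule integral_subset_le[OF _ sub int1(2)]) (use zw in auto)
    finally show ?thesis by simp
  qed
  have "\<bar>u y - u x\<bar> \<le> V" using *[of x y] *[of y x] xy by (cases "x \<le> y") (auto simp: abs_minus_commute)
  then show ?thesis using V by (simp add: osc_bound_def Let_def K_def m_def \<Gamma>_def)
qed

end

section \<open>Contact with a strict upper solution\<close>

text \<open>\<open>F\<close> is asked to be locally Lipschitz rather than differentiable, because
  the truncated \<open>F_tr R\<close> must satisfy the same assumptions and may have corners at
  \<open>- R\<close> and \<open>R\<close>.\<close>

locale ambrosetti_prodi = phi_problem +
  fixes \<gamma> :: "real \<Rightarrow> real"
  assumes F_lipschitz: "\<And>r. \<exists>L. \<forall>x y. \<bar>x\<bar> \<le> r \<longrightarrow> \<bar>y\<bar> \<le> r \<longrightarrow> \<bar>F x - F y\<bar> \<le> L * \<bar>x - y\<bar>"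
    and H0: "\<And>t0 v0 \<epsilon>. t0 \<in> {0..T} \<Longrightarrow> \<epsilon> > 0 \<Longrightarrow> \<exists>\<delta>>0. AE t in lebesgue_on {0..T}. \<forall>v. \<bar>t - t0\<bar> < \<delta> \<and> \<bar>v - v0\<bar> < \<delta>
                  \<longrightarrow> \<bar>g t v - g t v0\<bar> < \<epsilon>"
    and \<gamma>_int: "integrable (lebesgue_on {0..T}) \<gamma>" and \<gamma>_nonneg: "\<And>t. \<gamma> t \<ge> 0"
    and lower: "AE t in lebesgue_on {0..T}. \<forall>x. g t x \<ge> - \<gamma> t"
begin

text \<open>At an interior contact point \<open>u - b\<close> has a maximum. Contact at 0 or
  \<open>T\<close> occurs at both by periodicity, and the one-sided inequalities there combine
  through the equal end derivatives. A point \<open>t1 < T\<close> leaves room on its right.\<close>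

lemma contact_derivative_eq:
  assumes u: "C1_periodic T u u'" and b: "C1_periodic T b b'"
    and le: "\<And>t. t \<in> {0..T} \<Longrightarrow> u t \<le> b t" and t0: "t0 \<in> {0..T}" "u t0 = b t0"
  obtains t1 where "0 \<le> t1" "t1 < T" "u t1 = b t1" "u' t1 = b' t1"
proof -
  have w: "((\<lambda>t. u t - b t) has_real_derivative u' t - b' t) (at t within {0..T})" if "t \<in> {0..T}" for t
    by (intro DERIV_diff C1_periodicD(1)[OF u that] C1_periodicD(1)[OF b that])
  have right: "u' t \<le> b' t" if t: "0 \<le> t" "t < T" "u t = b t" for t
  proof (rule ccontr)
    assume "\<not> ?thesis"
    then obtain d where d: "d > 0" "\<And>h. h > 0 \<Longrightarrow> t + h \<in> {0..T} \<Longrightarrow> h < d \<Longrightarrow> u t - b t < u (t + h) - b (t + h)"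
      using has_real_derivative_pos_inc_right[OF w[of t]] t by auto
    define h where "h = min (d / 2) (T - t)"
    have "h > 0" "h < d" "t + h \<in> {0..T}" using d t by (auto simp: h_def min_def field_simps)
    with d(2)[of h] le[of "t + h"] t show False by simp
  qed
  have left: "u' t \<ge> b' t" if t: "0 < t" "t \<le> T" "u t = b t" for t
  proof (rule ccontr)
    assume "\<not> ?thesis"
    then obtain d where d: "d > 0" "\<And>h. h > 0 \<Longrightarrow> t - h \<in> {0..T} \<Longrightarrow> h < d \<Longrightarrow> u t - b t < u (t - h) - b (t - h)"
      using has_real_derivative_neg_dec_left[OF w[of t]] t by auto
    define h where "h = min (d / 2) t"
    have "h > 0" "h < d" "t - h \<in> {0..T}" using d t by (auto simp: h_def min_def field_simps)
    with d(2)[of h] le[of "t - h"] t show False by simp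
  qed
  show ?thesis
  proof (cases "0 < t0 \<and> t0 < T")
    case True
    with that[of t0] left[of t0] right[of t0] t0 show ?thesis by force
  next
    case False
    then have "t0 = 0 \<or> t0 = T" using t0 by auto
    then have "u 0 = b 0" "u T = b T" using t0(2) C1_periodicD(4)[OF u] C1_periodicD(4)[OF b] by auto
    with that[of 0] left[of T] right[of 0] T C1_periodicD(5)[OF u] C1_periodicD(5)[OF b] show ?thesis by force
  qed
qed

text \<open>This is where \<open>H0\<close> enters: near a contact point the forcing terms of both functions are
  essentially equal, so \<open>\<mu> - s\<close> drives \<open>u\<close> above \<open>b\<close> just after it.\<close>

lemma no_contact_with_strict_upper_solution:
  assumes sol: "integrated_solution T \<phi> F g \<mu> u u'" and up: "upper_solution T \<phi> F g s b b'" and less: "s < \<mu>"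
    and le: "\<And>t. t \<in> {0..T} \<Longrightarrow> u t \<le> b t" and t0: "t0 \<in> {0..T}" "u t0 = b t0"
  shows False
proof -
  have u: "C1_periodic T u u'" and b: "C1_periodic T b b'"
    using sol up by (simp_all add: integrated_solution_def upper_solution_def)
  obtain t1 where t1: "0 \<le> t1" "t1 < T" "u t1 = b t1" "u' t1 = b' t1"
    by (rule contact_derivative_eq[OF u b le t0])
  define \<eta> where "\<eta> = \<mu> - s"
  have \<eta>: "\<eta> > 0" using less by (simp add: \<eta>_def)
  obtain \<delta> where \<delta>: "\<delta> > 0" and ae: "AE t in M. \<forall>v. \<bar>t - t1\<bar> < \<delta> \<and> \<bar>v - b t1\<bar> < \<delta> \<longrightarrow> \<bar>g t v - g t (b t1)\<bar> < \<eta> / 4"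
    using H0[of t1 "\<eta> / 4" "b t1"] t1 \<eta> by auto
  obtain N where N: "negligible N" and gN: "\<And>t v. t \<in> {0..T} - N \<Longrightarrow> \<bar>t - t1\<bar> < \<delta> \<Longrightarrow> \<bar>v - b t1\<bar> < \<delta> \<Longrightarrow>
      \<bar>g t v - g t (b t1)\<bar> < \<eta> / 4"
    using AE_lebesgue_on_negligible[OF ae] by metis
  obtain L0 where L0: "\<forall>x y. \<bar>x\<bar> \<le> \<bar>b t1\<bar> + 1 \<longrightarrow> \<bar>y\<bar> \<le> \<bar>b t1\<bar> + 1 \<longrightarrow> \<bar>F x - F y\<bar> \<le> L0 * \<bar>x - y\<bar>"
    using F_lipschitz by blast
  define L where "L = max L0 0 + 1"
  have L: "L > 0" "\<And>x y. \<bar>x\<bar> \<le> \<bar>b t1\<bar> + 1 \<Longrightarrow> \<bar>y\<bar> \<le> \<bar>b t1\<bar> + 1 \<Longrightarrow> \<bar>F x - F y\<bar> \<le> L * \<bar>x - y\<bar>"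
  proof -
    show "L > 0" by (simp add: L_def)
    fix x y :: real assume "\<bar>x\<bar> \<le> \<bar>b t1\<bar> + 1" "\<bar>y\<bar> \<le> \<bar>b t1\<bar> + 1"
    then have "\<bar>F x - F y\<bar> \<le> L0 * \<bar>x - y\<bar>" using L0 by blast
    also have "\<dots> \<le> L * \<bar>x - y\<bar>" by (intro mult_right_mono) (auto simp: L_def)
    finally show "\<bar>F x - F y\<bar> \<le> L * \<bar>x - y\<bar>" .
  qed
  have t1T: "t1 \<in> {0..T}" using t1 by simp
  have w: "((\<lambda>t. u t - b t) has_real_derivative u' t - b' t) (at t within {0..T})" if "t \<in> {0..T}" for t
    by (intro DERIV_diff C1_periodicD(1)[OF u that] C1_periodicD(1)[OF b that])
  \<comment> \<open>With this choice the difference of the \<open>F\<close> terms costs at most a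
    quarter of \<open>\<eta> * (t - t1)\<close>, against a gain of at least one half from the
    forcing terms.\<close>
  define \<epsilon> where "\<epsilon> = \<eta> / (4 * L)"
  have \<epsilon>: "\<epsilon> > 0" using \<eta> L by (simp add: \<epsilon>_def)
  have "((\<lambda>t. u t - b t) has_real_derivative 0) (at t1 within {0..T})" using w[OF t1T] t1 by simp
  then obtain d1 where d1: "d1 > 0" "\<And>t. t \<in> {0..T} \<Longrightarrow> \<bar>t - t1\<bar> < d1 \<Longrightarrow> \<bar>u t - b t\<bar> \<le> \<epsilon> * \<bar>t - t1\<bar>"
    unfolding has_field_derivative_def has_derivative_within_alt using \<epsilon> t1(3) by fastforce
  obtain d2 where d2: "d2 > 0" "\<And>t. t \<in> {0..T} \<Longrightarrow> \<bar>t - t1\<bar> < d2 \<Longrightarrow> \<bar>u t - b t1\<bar> < min \<delta> 1"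
    using C1_periodicD(2)[OF u, unfolded continuous_on_iff, rule_format, OF t1T, of "min \<delta> 1"] \<delta> t1(3)
    by (auto simp: dist_real_def)
  obtain d3 where d3: "d3 > 0" "\<And>t. t \<in> {0..T} \<Longrightarrow> \<bar>t - t1\<bar> < d3 \<Longrightarrow> \<bar>b t - b t1\<bar> < min \<delta> 1"
    using C1_periodicD(2)[OF b, unfolded continuous_on_iff, rule_format, OF t1T, of "min \<delta> 1"] \<delta>
    by (auto simp: dist_real_def)
  define d where "d = min (min d1 d2) (min (min d3 \<delta>) (T - t1))"
  have d: "d > 0" "d \<le> d1" "d \<le> d2" "d \<le> d3" "d \<le> \<delta>" "t1 + d \<le> T" using d1 d2 d3 \<delta> t1 by (auto simp: d_def)
  have grow: "u' t > b' t" if t: "t1 < t" "t < t1 + d" for t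
  proof -
    have tT: "t \<in> {0..T}" using t d t1 by auto
    define q where "q \<tau> = (g \<tau> (b \<tau>) - s) - (g \<tau> (u \<tau>) - \<mu>)" for \<tau>
    \<comment> \<open>Changing \<open>q\<close> on the null set makes the bound
      \<open>\<eta> / 2\<close> hold at every point: off \<open>N\<close> it is
      \<open>\<eta>\<close> less two deviations below \<open>\<eta> / 4\<close>.\<close>
    define q' where "q' \<tau> = (if \<tau> \<in> N then \<eta> / 2 else q \<tau>)" for \<tau>
    have int: "(\<lambda>\<tau>. g \<tau> (b \<tau>) - s) integrable_on {t1..t}" "(\<lambda>\<tau>. g \<tau> (u \<tau>) - \<mu>) integrable_on {t1..t}"
      by (rule integrable_lebesgue_on_subinterval[of 0 T];
          use t tT t1 in \<open>auto intro!: g_along_integrable[OF b] g_along_integrable[OF u] integrable_const_M\<close>)+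
    have "integral {t1..t} q = integral {t1..t} q'"
      by (rule integral_spike[OF N]) (simp add: q'_def)
    moreover have "q integrable_on {t1..t}" unfolding q_def by (intro integrable_diff int)
    then have "q' integrable_on {t1..t}" by (rule integrable_spike[OF _ N]) (simp add: q'_def)
    then have "integral {t1..t} (\<lambda>_. \<eta> / 2) \<le> integral {t1..t} q'"
    proof (rule integral_le[rotated])
      fix \<tau> assume \<tau>: "\<tau> \<in> {t1..t}"
      show "\<eta> / 2 \<le> q' \<tau>"
      proof (cases "\<tau> \<in> N")
        case False
        have \<tau>': "\<tau> \<in> {0..T}" "\<bar>\<tau> - t1\<bar> < d" using \<tau> t tT t1 by auto
        have "\<bar>u \<tau> - b t1\<bar> < \<delta>" "\<bar>b \<tau> - b t1\<bar> < \<delta>" "\<bar>\<tau> - t1\<bar> < \<delta>" using d2(2)[of \<tau>] d3(2)[of \<tau>] \<tau>' d by auto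
        then have "\<bar>g \<tau> (u \<tau>) - g \<tau> (b t1)\<bar> < \<eta> / 4" "\<bar>g \<tau> (b \<tau>) - g \<tau> (b t1)\<bar> < \<eta> / 4"
          using gN \<tau>' False by auto
        moreover have "q' \<tau> = \<eta> + (g \<tau> (b \<tau>) - g \<tau> (b t1)) - (g \<tau> (u \<tau>) - g \<tau> (b t1))"
          using False by (simp add: q'_def q_def \<eta>_def)
        ultimately show ?thesis by linarith
      qed (simp add: q'_def)
    qed (rule integrable_const_ivl)
    moreover have "integral {t1..t} q = integral {t1..t} (\<lambda>\<tau>. g \<tau> (b \<tau>) - s) - integral {t1..t} (\<lambda>\<tau>. g \<tau> (u \<tau>) - \<mu>)"
      unfolding q_def by (rule Henstock_Kurzweil_Integration.integral_diff[OF int])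
    ultimately have I: "\<eta> / 2 * (t - t1) \<le> integral {t1..t} (\<lambda>\<tau>. g \<tau> (b \<tau>) - s) - integral {t1..t} (\<lambda>\<tau>. g \<tau> (u \<tau>) - \<mu>)"
      using t by (simp add: mult.commute)
    have at: "\<bar>t - t1\<bar> < d" using t by auto
    have "\<bar>u t - b t1\<bar> < 1" "\<bar>b t - b t1\<bar> < 1" using d2(2)[OF tT] d3(2)[OF tT] at d by auto
    then have "\<bar>b t\<bar> \<le> \<bar>b t1\<bar> + 1" "\<bar>u t\<bar> \<le> \<bar>b t1\<bar> + 1" by linarith+
    from L(2)[OF this] have "\<bar>F (b t) - F (u t)\<bar> \<le> L * \<bar>u t - b t\<bar>" by (simp add: abs_minus_commute)
    also have "\<dots> \<le> L * (\<epsilon> * \<bar>t - t1\<bar>)" using d1(2)[OF tT] at d L(1) by (intro mult_left_mono) auto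
    also have "\<dots> = \<eta> / 4 * (t - t1)" using t L(1) by (simp add: \<epsilon>_def)
    finally have F: "\<bar>F (b t) - F (u t)\<bar> \<le> \<eta> / 4 * (t - t1)" .
    have "\<phi> (u' t) + F (u t) + integral {t1..t} (\<lambda>\<tau>. g \<tau> (u \<tau>) - \<mu>) = \<phi> (u' t1) + F (u t1)"
      by (rule solution_integral[OF sol]) (use t tT t1 in auto)
    moreover have "\<phi> (b' t) + F (b t) + integral {t1..t} (\<lambda>\<tau>. g \<tau> (b \<tau>) - s) \<le> \<phi> (b' t1) + F (b t1)"
      using up t tT t1 by (simp add: upper_solution_def)
    moreover define X where "X = \<eta> * (t - t1)"
    moreover have "X > 0" using \<eta> t by (simp add: X_def)
    moreover have "\<bar>F (b t) - F (u t)\<bar> \<le> X / 4" using F by (simp add: X_def)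
    moreover have "X / 2 \<le> integral {t1..t} (\<lambda>\<tau>. g \<tau> (b \<tau>) - s) - integral {t1..t} (\<lambda>\<tau>. g \<tau> (u \<tau>) - \<mu>)"
      using I by (simp add: X_def)
    ultimately have "\<phi> (u' t) > \<phi> (b' t)" unfolding t1(3,4) by linarith
    then show ?thesis by (simp add: strict_mono_less[OF phi_strict])
  qed
  \<comment> \<open>By the mean value theorem, \<open>u' > b'\<close> just after contact lifts
    \<open>u\<close> above \<open>b\<close> at this \<open>t\<close>, against
    \<open>le\<close>.\<close>
  define t where "t = t1 + d / 2"
  have t: "t1 < t" "t < t1 + d" "t \<le> T" using d by (auto simp: t_def)
  have "\<exists>z\<in>{t1<..<t}. (u t - b t) - (u t1 - b t1) = (u' z - b' z) * (t - t1)"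
  proof (rule mvt_simple[OF t(1)])
    fix z assume z: "t1 \<le> z" "z \<le> t"
    then have "((\<lambda>t. u t - b t) has_real_derivative u' z - b' z) (at z within {0..T})" using w t t1 by auto
    then have "((\<lambda>t. u t - b t) has_real_derivative u' z - b' z) (at z within {t1..t})"
      by (rule has_field_derivative_subset) (use t t1 in auto)
    then show "((\<lambda>t. u t - b t) has_derivative (*) (u' z - b' z)) (at z within {t1..t})"
      by (simp add: has_field_derivative_def)
  qed
  then obtain z where z: "t1 < z" "z < t" "(u t - b t) - (u t1 - b t1) = (u' z - b' z) * (t - t1)" by auto
  have "(u' z - b' z) * (t - t1) > 0" using grow[of z] z t by simp
  with z le[of t] t t1 show False by simp
qed

end

section \<open>Existence and multiplicity\<close>

lemma integrated_solution_cong: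
  assumes "\<And>t. t \<in> {0..T} \<Longrightarrow> F (u t) = F' (u t) \<and> g t (u t) = g' t (u t)" and "T \<ge> 0"
  shows "integrated_solution T \<phi> F g s u u' \<longleftrightarrow> integrated_solution T \<phi> F' g' s u u'"
proof -
  have "integral {0..t} (\<lambda>\<tau>. g \<tau> (u \<tau>) - s) = integral {0..t} (\<lambda>\<tau>. g' \<tau> (u \<tau>) - s)" if "t \<in> {0..T}" for t
    by (rule Henstock_Kurzweil_Integration.integral_cong) (use assms that in auto)
  moreover have "F (u t) = F' (u t)" if "t \<in> {0..T}" for t using assms that by blast
  ultimately show ?thesis using assms(2) unfolding integrated_solution_def by simp
qed

lemma upper_solution_cong:
  assumes "\<And>t. t \<in> {0..T} \<Longrightarrow> F (u t) = F' (u t) \<and> g t (u t) = g' t (u t)"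
    and up: "upper_solution T \<phi> F g s u u'"
  shows "upper_solution T \<phi> F' g' s u u'"
  unfolding upper_solution_def
proof (intro conjI allI impI)
  show "C1_periodic T u u'" using up by (simp add: upper_solution_def)
  fix x y :: real assume xy: "0 \<le> x" "x \<le> y" "y \<le> T"
  have "integral {x..y} (\<lambda>\<tau>. g \<tau> (u \<tau>) - s) = integral {x..y} (\<lambda>\<tau>. g' \<tau> (u \<tau>) - s)"
    by (rule Henstock_Kurzweil_Integration.integral_cong) (use assms xy in auto)
  moreover have "F (u x) = F' (u x)" "F (u y) = F' (u y)" using assms xy by auto
  moreover have "\<phi> (u' y) + F (u y) + integral {x..y} (\<lambda>\<tau>. g \<tau> (u \<tau>) - s) \<le> \<phi> (u' x) + F (u x)"
    using up xy by (simp add: upper_solution_def)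
  ultimately show "\<phi> (u' y) + F' (u y) + integral {x..y} (\<lambda>\<tau>. g' \<tau> (u \<tau>) - s) \<le> \<phi> (u' x) + F' (u x)"
    by simp
qed

context ambrosetti_prodi
begin

definition F_tr :: "real \<Rightarrow> real \<Rightarrow> real" where "F_tr R x = F (clip (- R) R x)"

definition g_tr :: "real \<Rightarrow> real \<Rightarrow> real \<Rightarrow> real" where "g_tr R t x = g t (clip (- R) R x)"

lemma tr_eq: "\<bar>x\<bar> \<le> R \<Longrightarrow> F_tr R x = F x \<and> g_tr R t x = g t x"
  by (simp add: F_tr_def g_tr_def clip_simps(2) abs_le_iff)

lemma abs_clip_le: "R \<ge> 0 \<Longrightarrow> \<bar>clip (- R) R x\<bar> \<le> R"
  by (auto simp: clip_def)

lemma caratheodory_tr: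
  assumes R: "R \<ge> 0"
  shows "caratheodory T (g_tr R)"
  unfolding caratheodory_def
proof (intro conjI allI ballI impI)
  show "(\<lambda>t. g_tr R t u) \<in> borel_measurable M" for u
    using g_car by (simp add: g_tr_def caratheodory_def)
  show "continuous_on UNIV (g_tr R t)" if "t \<in> {0..T}" for t
    unfolding g_tr_def
    by (rule continuous_on_compose2[of UNIV]) (use g_car that in \<open>auto simp: caratheodory_def intro!: continuous_intros\<close>)
  obtain h where h: "integrable M h" "\<forall>t\<in>{0..T}. \<forall>u. \<bar>u\<bar> \<le> R + 1 \<longrightarrow> \<bar>g t u\<bar> \<le> h t"
    using g_car[unfolded caratheodory_def] R by (metis add_nonneg_pos zero_less_one)
  have "\<bar>g_tr R t u\<bar> \<le> h t" if "t \<in> {0..T}" for t u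
    using h(2) that abs_clip_le[OF R, of u] unfolding g_tr_def by auto
  with h(1) show "\<exists>h. integrable M h \<and> (\<forall>t\<in>{0..T}. \<forall>u. \<bar>u\<bar> \<le> r \<longrightarrow> \<bar>g_tr R t u\<bar> \<le> h t)" for r :: real
    by blast
qed

text \<open>All assumptions survive truncation, (H0) because \<open>clip\<close> does not increase
  distances. Keeping the same \<open>\<gamma>\<close> makes the oscillation bound of the truncated
  problem independent of \<open>R\<close>.\<close>

lemma ambrosetti_prodi_tr:
  assumes R: "R \<ge> 0"
  shows "ambrosetti_prodi T \<phi> \<psi> (F_tr R) (g_tr R) \<gamma>"
proof
  show "continuous_on UNIV (F_tr R)"
    unfolding F_tr_def by (rule continuous_on_compose2[OF F_cont]) (auto intro!: continuous_intros)
  show "caratheodory T (g_tr R)" by (rule caratheodory_tr[OF R])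
  show "\<exists>L. \<forall>x y. \<bar>x\<bar> \<le> r \<longrightarrow> \<bar>y\<bar> \<le> r \<longrightarrow> \<bar>F_tr R x - F_tr R y\<bar> \<le> L * \<bar>x - y\<bar>" for r
  proof -
    obtain L where L: "\<forall>x y. \<bar>x\<bar> \<le> R \<longrightarrow> \<bar>y\<bar> \<le> R \<longrightarrow> \<bar>F x - F y\<bar> \<le> L * \<bar>x - y\<bar>" using F_lipschitz by blast
    have "\<bar>F_tr R x - F_tr R y\<bar> \<le> max L 0 * \<bar>x - y\<bar>" for x y
    proof -
      have "\<bar>F_tr R x - F_tr R y\<bar> \<le> L * \<bar>clip (- R) R x - clip (- R) R y\<bar>"
        unfolding F_tr_def using L abs_clip_le[OF R] by blast
      also have "\<dots> \<le> max L 0 * \<bar>x - y\<bar>" by (rule mult_mono) (auto intro: clip_simps(3))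
      finally show ?thesis .
    qed
    then show ?thesis by blast
  qed
  show "\<exists>\<delta>>0. AE t in M. \<forall>v. \<bar>t - t0\<bar> < \<delta> \<and> \<bar>v - v0\<bar> < \<delta> \<longrightarrow> \<bar>g_tr R t v - g_tr R t v0\<bar> < \<epsilon>"
    if t0: "t0 \<in> {0..T}" and \<epsilon>: "\<epsilon> > 0" for t0 v0 \<epsilon>
  proof -
    obtain \<delta> where \<delta>: "\<delta> > 0" "AE t in M. \<forall>v. \<bar>t - t0\<bar> < \<delta> \<and> \<bar>v - clip (- R) R v0\<bar> < \<delta> \<longrightarrow>
        \<bar>g t v - g t (clip (- R) R v0)\<bar> < \<epsilon>" using H0[OF t0 \<epsilon>] by blast
    from \<delta>(2) have "AE t in M. \<forall>v. \<bar>t - t0\<bar> < \<delta> \<and> \<bar>v - v0\<bar> < \<delta> \<longrightarrow> \<bar>g_tr R t v - g_tr R t v0\<bar> < \<epsilon>"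
    proof (rule AE_mp, intro AE_I2 impI allI)
      fix t v assume "\<forall>v. \<bar>t - t0\<bar> < \<delta> \<and> \<bar>v - clip (- R) R v0\<bar> < \<delta> \<longrightarrow> \<bar>g t v - g t (clip (- R) R v0)\<bar> < \<epsilon>"
        and "\<bar>t - t0\<bar> < \<delta> \<and> \<bar>v - v0\<bar> < \<delta>"
      then show "\<bar>g_tr R t v - g_tr R t v0\<bar> < \<epsilon>"
        unfolding g_tr_def using le_less_trans[OF clip_simps(3)] by blast
    qed
    with \<delta>(1) show ?thesis by blast
  qed
  show "AE t in M. \<forall>x. - \<gamma> t \<le> g_tr R t x"
    using lower unfolding g_tr_def by (rule AE_mp) auto
qed (fact T psi_phi phi_psi phi_strict phi_cont psi_cont phi_0 \<gamma>_int \<gamma>_nonneg)+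

lemma bounded_phi_problem_tr:
  assumes R: "R \<ge> 0" and b: "continuous_on {0..T} b" "\<And>t. t \<in> {0..T} \<Longrightarrow> \<bar>b t\<bar> \<le> B"
  obtains K h where "bounded_phi_problem T \<phi> \<psi> (F_tr R) (g_tr R) K h b B"
proof -
  interpret tr: ambrosetti_prodi T \<phi> \<psi> "F_tr R" "g_tr R" \<gamma> by (rule ambrosetti_prodi_tr[OF R])
  obtain K where K: "\<And>x. x \<in> {- R..R} \<Longrightarrow> \<bar>F x\<bar> \<le> K"
    by (rule continuous_on_interval_abs_bounded[OF continuous_on_subset[OF F_cont subset_UNIV]]) blast
  obtain h where h: "integrable M h" "\<forall>t\<in>{0..T}. \<forall>u. \<bar>u\<bar> \<le> R + 1 \<longrightarrow> \<bar>g t u\<bar> \<le> h t"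
    using g_car[unfolded caratheodory_def] R by (metis add_nonneg_pos zero_less_one)
  have "bounded_phi_problem T \<phi> \<psi> (F_tr R) (g_tr R) K h b B"
  proof
    show "\<bar>F_tr R x\<bar> \<le> K" for x unfolding F_tr_def by (rule K, rule clip_simps(1)) (use R in simp)
    show "\<bar>g_tr R t x\<bar> \<le> h t" if "t \<in> {0..T}" for t x
      using h(2) that abs_clip_le[OF R, of x] unfolding g_tr_def by auto
  qed (use h b in auto)
  then show ?thesis by (rule that)
qed

abbreviation "\<Gamma> \<equiv> (\<integral>t. \<gamma> t \<partial>M)"

text \<open>The two last conclusions have different ranges. Contact at level 0 is excluded for all
  \<open>\<mu> > s1\<close>, by arguing in the truncated problem; the return to the original problem
  requires the oscillation bound and therefore \<open>\<mu> \<le> s\<close>.\<close>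

lemma contact_solution:
  assumes up: "upper_solution T \<phi> F g s1 b b'" and s: "s1 < s"
    and lohi: "lo \<le> hi" "\<bar>lo\<bar> \<le> C" "\<bar>hi\<bar> \<le> C"
  obtains c \<mu> u u' where "c \<in> {lo..hi}" "clip lo hi (c + e * (\<mu> - s)) = c"
    "\<And>t. t \<in> {0..T} \<Longrightarrow> u t - b t \<le> c" "\<exists>t\<in>{0..T}. u t - b t = c"
    "c = 0 \<Longrightarrow> \<mu> \<le> s1"
    "\<mu> \<le> s \<Longrightarrow> integrated_solution T \<phi> F g \<mu> u u'"
proof -
  have C1b: "C1_periodic T b b'" using up by (simp add: upper_solution_def)
  note bc = C1_periodicD(2)[OF C1b]
  obtain B where B: "\<And>t. t \<in> {0..T} \<Longrightarrow> \<bar>b t\<bar> \<le> B" using continuous_on_interval_abs_bounded[OF bc] by blast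
  have B0: "B \<ge> 0" using B[of 0] T by auto
  define D where "D = osc_bound T \<psi> \<Gamma> s"
  \<comment> \<open>Bounds \<open>u\<close> through its value at a contact point: \<open>B\<close>
    for \<open>b\<close>, \<open>C\<close> for the level and \<open>D\<close> for the
    oscillation.\<close>
  define R where "R = B + C + \<bar>D\<bar>"
  have R: "R \<ge> 0" "B \<le> R" using B0 lohi by (auto simp: R_def)
  interpret tr: ambrosetti_prodi T \<phi> \<psi> "F_tr R" "g_tr R" \<gamma> by (rule ambrosetti_prodi_tr[OF R(1)])
  obtain K h where "bounded_phi_problem T \<phi> \<psi> (F_tr R) (g_tr R) K h b B"
    by (rule bounded_phi_problem_tr[OF R(1) bc B])
  then interpret bt: bounded_phi_problem T \<phi> \<psi> "F_tr R" "g_tr R" K h b B .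
  obtain c \<mu> u u' where c: "c \<in> {lo..hi}" "clip lo hi (c + e * (\<mu> - s)) = c"
    and sol: "integrated_solution T \<phi> (F_tr R) (g_tr R) \<mu> u u'"
    and le: "\<And>t. t \<in> {0..T} \<Longrightarrow> u t - b t \<le> c" and contact: "\<exists>t\<in>{0..T}. u t - b t = c"
    by (rule bt.exists_solution_with_contact[OF lohi(1), where e = e and s = s]) blast+
  show ?thesis
  proof (rule that[OF c le contact])
    show "\<mu> \<le> s1" if c0: "c = 0"
    proof (rule ccontr)
      assume "\<not> \<mu> \<le> s1"
      have "upper_solution T \<phi> (F_tr R) (g_tr R) s1 b b'"
      proof (rule upper_solution_cong[OF _ up])
        fix t assume "t \<in> {0..T}"
        then have "\<bar>b t\<bar> \<le> R" using B[of t] R(2) by linarith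
        from tr_eq[OF this] show "F (b t) = F_tr R (b t) \<and> g t (b t) = g_tr R t (b t)" by simp
      qed
      moreover obtain t0 where "t0 \<in> {0..T}" "u t0 = b t0" using contact c0 by auto
      ultimately show False
        using tr.no_contact_with_strict_upper_solution[OF sol, of s1 b b' t0] le c0 \<open>\<not> \<mu> \<le> s1\<close> by simp
    qed
    show "integrated_solution T \<phi> F g \<mu> u u'" if \<mu>: "\<mu> \<le> s"
    proof -
      obtain t0 where t0: "t0 \<in> {0..T}" "u t0 - b t0 = c" using contact by blast
      have "\<bar>u t\<bar> \<le> R" if t: "t \<in> {0..T}" for t
      proof -
        have "\<bar>u t - u t0\<bar> \<le> D" unfolding D_def
          by (rule tr.solution_oscillation[OF sol \<mu> \<gamma>_int \<gamma>_nonneg tr.lower t0(1) t])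
        moreover have "\<bar>c\<bar> \<le> C" using c(1) lohi by auto
        ultimately show ?thesis using t0 B[OF t0(1)] unfolding R_def by linarith
      qed
      then show ?thesis using sol integrated_solution_cong[of T "F_tr R" u F "g_tr R" g] tr_eq T by simp
    qed
  qed
qed

text \<open>With \<open>e = 1\<close>, a parameter above \<open>s\<close> holds the level at 0 and
  one below \<open>s\<close> holds it at \<open>- C\<close>. As the level bounds
  \<open>u - b\<close> from above at all points, \<open>C\<close> is large enough for
  \<open>- C\<close> to force \<open>u \<le> - d\<close>, against \<open>mean\<close>.\<close>

lemma solution_below:
  assumes up: "upper_solution T \<phi> F g s1 b b'" and s: "s1 < s"
    and mean: "\<And>u u'. C1_periodic T u u' \<Longrightarrow> (\<And>t. t \<in> {0..T} \<Longrightarrow> u t \<le> - d) \<Longrightarrow> (\<integral>t. g t (u t) \<partial>M) > s * T"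
  obtains u u' where "integrated_solution T \<phi> F g s u u'" "\<And>t. t \<in> {0..T} \<Longrightarrow> u t < b t"
proof -
  have "continuous_on {0..T} b" using up by (auto simp: upper_solution_def intro: C1_periodicD(2))
  then obtain B where B: "\<And>t. t \<in> {0..T} \<Longrightarrow> \<bar>b t\<bar> \<le> B" using continuous_on_interval_abs_bounded by blast
  define C where "C = B + \<bar>d\<bar>"
  have "B \<ge> 0" using B[of 0] T by auto
  then have C: "- C \<le> 0" "\<bar>- C\<bar> \<le> C" "\<bar>0\<bar> \<le> C" by (auto simp: C_def)
  obtain c \<mu> u u' where c: "c \<in> {- C..0}" "clip (- C) 0 (c + 1 * (\<mu> - s)) = c"
    and le: "\<And>t. t \<in> {0..T} \<Longrightarrow> u t - b t \<le> c" and c0: "c = 0 \<Longrightarrow> \<mu> \<le> s1"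
    and sol: "\<mu> \<le> s \<Longrightarrow> integrated_solution T \<phi> F g \<mu> u u'"
    by (rule contact_solution[OF up s C, where e = 1]) blast
  have "\<not> \<mu> > s"
  proof
    assume "\<mu> > s"
    with c have "c = 0" by (auto simp: clip_def max_def min_def split: if_splits)
    with c0 s \<open>\<mu> > s\<close> show False by simp
  qed
  moreover have "\<not> \<mu> < s"
  proof
    assume less: "\<mu> < s"
    with c have "c = - C" by (auto simp: clip_def max_def min_def split: if_splits)
    then have "u t \<le> - d" if "t \<in> {0..T}" for t using le[OF that] B[OF that] by (auto simp: C_def)
    with mean sol less have "(\<integral>t. g t (u t) \<partial>M) > s * T" by (auto simp: integrated_solution_def)
    moreover have "(\<integral>t. g t (u t) \<partial>M) = \<mu> * T" using sol less by (intro solution_mean) auto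
    ultimately show False using less T by simp
  qed
  ultimately have "\<mu> = s" by simp
  \<comment> \<open>Contact at level 0 would give \<open>\<mu> \<le> s1 < s\<close>; this makes the
    comparison with \<open>b\<close> strict.\<close>
  moreover have "c < 0" using c0 c(1) s \<open>\<mu> = s\<close> by (cases "c = 0") auto
  then have "u t < b t" if "t \<in> {0..T}" for t using le[OF that] by simp
  ultimately show ?thesis using that sol by blast
qed

text \<open>Now 0 is the lower end, so \<open>e = - 1\<close> is taken for a parameter above
  \<open>s\<close> to hold the level at 0 again.\<close>

lemma solution_not_below:
  assumes up: "upper_solution T \<phi> F g s1 b b'" and s: "s1 < s"
    and mean: "\<And>u u'. C1_periodic T u u' \<Longrightarrow> (\<And>t. t \<in> {0..T} \<Longrightarrow> u t \<ge> d) \<Longrightarrow> (\<integral>t. g t (u t) \<partial>M) > s * T"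
  obtains u u' where "integrated_solution T \<phi> F g s u u'" "\<exists>t\<in>{0..T}. u t > b t"
proof -
  have "continuous_on {0..T} b" using up by (auto simp: upper_solution_def intro: C1_periodicD(2))
  then obtain B where B: "\<And>t. t \<in> {0..T} \<Longrightarrow> \<bar>b t\<bar> \<le> B" using continuous_on_interval_abs_bounded by blast
  define D where "D = osc_bound T \<psi> \<Gamma> s"
  \<comment> \<open>The level controls \<open>u\<close> from below at a contact point only, where
    \<open>u = b + c\<close>; \<open>\<bar>D\<bar>\<close> pays for the oscillation so that
    \<open>c = C\<close> yields \<open>u \<ge> d\<close> everywhere.\<close>
  define C where "C = B + \<bar>d\<bar> + \<bar>D\<bar>"
  have "B \<ge> 0" using B[of 0] T by auto
  then have C: "0 \<le> C" "\<bar>0\<bar> \<le> C" "\<bar>C\<bar> \<le> C" by (auto simp: C_def)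
  obtain c \<mu> u u' where c: "c \<in> {0..C}" "clip 0 C (c + (- 1) * (\<mu> - s)) = c"
    and contact: "\<exists>t\<in>{0..T}. u t - b t = c" and c0: "c = 0 \<Longrightarrow> \<mu> \<le> s1"
    and sol: "\<mu> \<le> s \<Longrightarrow> integrated_solution T \<phi> F g \<mu> u u'"
    by (rule contact_solution[OF up s C, where e = "- 1"]) blast
  obtain t0 where t0: "t0 \<in> {0..T}" "u t0 - b t0 = c" using contact by blast
  have "\<not> \<mu> > s"
  proof
    assume "\<mu> > s"
    with c have "c = 0" by (auto simp: clip_def max_def min_def split: if_splits)
    with c0 s \<open>\<mu> > s\<close> show False by simp
  qed
  moreover have "\<not> \<mu> < s"
  proof
    assume less: "\<mu> < s"
    with c have cC: "c = C" by (auto simp: clip_def max_def min_def split: if_splits)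
    have "u t \<ge> d" if "t \<in> {0..T}" for t
    proof -
      have "\<bar>u t - u t0\<bar> \<le> D" unfolding D_def
        by (rule solution_oscillation[OF sol _ \<gamma>_int \<gamma>_nonneg lower t0(1) that]) (use less in auto)
      then show ?thesis using t0(2) B[OF t0(1)] unfolding cC C_def by linarith
    qed
    with mean sol less have "(\<integral>t. g t (u t) \<partial>M) > s * T" by (auto simp: integrated_solution_def)
    moreover have "(\<integral>t. g t (u t) \<partial>M) = \<mu> * T" using sol less by (intro solution_mean) auto
    ultimately show False using less T by simp
  qed
  ultimately have "\<mu> = s" by simp
  moreover have "c > 0" using c0 c(1) s \<open>\<mu> = s\<close> by (cases "c = 0") auto
  then have "\<exists>t\<in>{0..T}. u t > b t" using t0 by force
  ultimately show ?thesis using that sol by blast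
qed

text \<open>The common bound \<open>R\<close> makes all \<open>uk k\<close> solutions of one
  truncated problem, to which \<open>solutions_closed\<close> applies with comparison function
  0.\<close>

lemma solution_limit:
  assumes sol: "\<And>k. integrated_solution T \<phi> F g (sk k) (uk k) (uk' k)" and s: "sk \<longlonglongrightarrow> s"
    and bound: "\<And>k t. t \<in> {0..T} \<Longrightarrow> \<bar>uk k t\<bar> \<le> R"
  obtains u u' where "integrated_solution T \<phi> F g s u u'"
proof -
  have R: "R \<ge> 0" using order_trans[OF abs_ge_zero bound[of 0 0]] T by simp
  obtain K h where "bounded_phi_problem T \<phi> \<psi> (F_tr R) (g_tr R) K h (\<lambda>_. 0) 0"
    by (rule bounded_phi_problem_tr[OF R, of "\<lambda>_. 0" 0]) auto
  then interpret bt: bounded_phi_problem T \<phi> \<psi> "F_tr R" "g_tr R" K h "\<lambda>_. 0" 0 .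
  have sol': "integrated_solution T \<phi> (F_tr R) (g_tr R) (sk k) (uk k) (uk' k)" for k
    using sol integrated_solution_cong[of T "F_tr R" "uk k" F "g_tr R" g] tr_eq[OF bound] T by simp
  obtain u u' where "integrated_solution T \<phi> (F_tr R) (g_tr R) s u u'" "\<And>t. t \<in> {0..T} \<Longrightarrow> \<bar>u t\<bar> \<le> R"
    by (rule bt.solutions_closed[OF sol' s bound]) blast+
  then show ?thesis using that integrated_solution_cong[of T "F_tr R" u F "g_tr R" g] tr_eq T by simp
qed

text \<open>The mean of \<open>g\<close> along \<open>u\<close> is \<open>s \<le> S\<close>, so
  \<open>u\<close> lies neither entirely below \<open>- d1\<close> nor entirely above
  \<open>d2\<close>; the oscillation bound confines the rest.\<close>

lemma solution_bounded:
  assumes sol: "integrated_solution T \<phi> F g s u u'" and sS: "s \<le> S"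
    and neg: "\<And>u u'. C1_periodic T u u' \<Longrightarrow> (\<And>t. t \<in> {0..T} \<Longrightarrow> u t \<le> - d1) \<Longrightarrow> (\<integral>t. g t (u t) \<partial>M) > S * T"
    and pos: "\<And>u u'. C1_periodic T u u' \<Longrightarrow> (\<And>t. t \<in> {0..T} \<Longrightarrow> u t \<ge> d2) \<Longrightarrow> (\<integral>t. g t (u t) \<partial>M) > S * T"
    and t: "t \<in> {0..T}"
  shows "\<bar>u t\<bar> \<le> \<bar>d1\<bar> + \<bar>d2\<bar> + osc_bound T \<psi> \<Gamma> S"
proof -
  have C1: "C1_periodic T u u'" using sol by (simp add: integrated_solution_def)
  have "(\<integral>t. g t (u t) \<partial>M) \<le> S * T" unfolding solution_mean[OF sol] using sS T by simp
  then obtain x y where xy: "x \<in> {0..T}" "u x > - d1" "y \<in> {0..T}" "u y < d2"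
    using neg[OF C1] pos[OF C1] by (meson not_le)
  note osc = solution_oscillation[OF sol sS \<gamma>_int \<gamma>_nonneg lower _ t]
  show ?thesis using osc[OF xy(1)] osc[OF xy(3)] xy(2,4) by linarith
qed

end

lemma exists_primitive:
  fixes f :: "real \<Rightarrow> real"
  assumes "continuous_on UNIV f"
  obtains F where "\<And>x. (F has_real_derivative f x) (at x)"
proof -
  have "\<exists>F. \<forall>x. -\<infinity> < ereal x \<longrightarrow> ereal x < \<infinity> \<longrightarrow> (F has_vector_derivative f x) (at x)"
    by (rule einterval_antiderivative) (use assms in \<open>auto simp: continuous_on_eq_continuous_at\<close>)
  then show ?thesis using that by (auto simp: has_real_derivative_iff_has_vector_derivative)
qed

lemma C1_T_iff: "C1_T T u \<longleftrightarrow> (\<exists>u'. C1_periodic T u u')"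
  unfolding C1_T_def C1_periodic_def ..

text \<open>The suprema are taken in \<open>ereal\<close> because (H3) and (H4) may hold for
  arbitrarily large levels. Distinct solutions have to differ inside \<open>{0..T}\<close>, since
  values outside are arbitrary.\<close>

theorem theorem3p1:
  fixes \<phi> f :: "real \<Rightarrow> real" and g :: "real \<Rightarrow> real \<Rightarrow> real"
    and T u0 g0 :: real and \<gamma>0 :: "real \<Rightarrow> real"
  assumes T: "T > 0"
    and phi_homeo: "\<exists>\<psi>. homeomorphism UNIV UNIV \<phi> \<psi>"
    and phi_incr: "mono \<phi>"
    and phi0: "\<phi> 0 = 0"
    and f_cont: "continuous_on UNIV f"
    and g_car: "caratheodory T g"
    and H0: "\<forall>t0\<in>{0..T}. \<forall>v0::real. \<forall>\<epsilon>>0. \<exists>\<delta>>0.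
               AE t in lebesgue_on {0..T}. \<forall>v. \<bar>t - t0\<bar> < \<delta> \<and> \<bar>v - v0\<bar> < \<delta>
                  \<longrightarrow> \<bar>g t v - g t v0\<bar> < \<epsilon>"
    and H1_gamma: "integrable (lebesgue_on {0..T}) \<gamma>0" "\<forall>t. \<gamma>0 t \<ge> 0"
    and H1: "AE t in lebesgue_on {0..T}. \<forall>v. g t v \<ge> - \<gamma>0 t"
    and H2: "AE t in lebesgue_on {0..T}. g t u0 \<le> g0"
    and H3: "\<exists>\<sigma> d. H3_I T g g0 \<sigma> d"
  shows "\<exists>s0::real.
     ereal s0 < Sup (ereal ` {\<sigma>. \<sigma> > g0 \<and> (\<exists>d. H3_I T g g0 \<sigma> d)}) \<and>
     (\<forall>s::real. s0 < s \<and> ereal s < Sup (ereal ` {\<sigma>. \<sigma> > g0 \<and> (\<exists>d. H3_I T g g0 \<sigma> d)})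
        \<longrightarrow> (\<exists>u. periodic_solution \<phi> f g T s u)) \<and>
     (\<forall>s::real. s < s0 \<longrightarrow> \<not> (\<exists>u. periodic_solution \<phi> f g T s u)) \<and>
     ((\<exists>\<sigma> d. H4_I T g g0 \<sigma> d) \<longrightarrow>
        (\<exists>u. periodic_solution \<phi> f g T s0 u) \<and>
        (\<forall>s::real. s0 < s \<and>
           ereal s < Sup (ereal ` {\<sigma>. \<sigma> > g0 \<and>
                 ereal \<sigma> \<le> Sup (ereal ` {\<sigma>. \<sigma> > g0 \<and> (\<exists>d. H3_I T g g0 \<sigma> d)}) \<and>
                 (\<exists>d. H4_I T g g0 \<sigma> d)})
           \<longrightarrow> (\<exists>u1 u2. periodic_solution \<phi> f g T s u1 \<and> periodic_solution \<phi> f g T s u2 \<and>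
                        (\<exists>t\<in>{0..T}. u1 t \<noteq> u2 t))))"
proof -
  obtain \<psi> where \<psi>: "homeomorphism UNIV UNIV \<phi> \<psi>" using phi_homeo by blast
  then have inv: "\<psi> (\<phi> x) = x" "\<phi> (\<psi> x) = x" for x by (auto simp: homeomorphism_def)
  have strict: "strict_mono \<phi>"
    by (rule strict_monoI) (metis phi_incr inv(1) monoD less_imp_le order_le_less less_irrefl)
  obtain F where F: "\<And>x. (F has_real_derivative f x) (at x)" using exists_primitive[OF f_cont] by blast
  interpret ambrosetti_prodi T \<phi> \<psi> F g \<gamma>0
  proof
    show "continuous_on UNIV \<phi>" "continuous_on UNIV \<psi>" using \<psi> by (auto simp: homeomorphism_def)
    show "continuous_on UNIV F" using F by (auto intro!: DERIV_continuous_on)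
    show "\<exists>L. \<forall>x y. \<bar>x\<bar> \<le> r \<longrightarrow> \<bar>y\<bar> \<le> r \<longrightarrow> \<bar>F x - F y\<bar> \<le> L * \<bar>x - y\<bar>" for r
    proof -
      obtain L where L: "\<And>x. x \<in> {- r..r} \<Longrightarrow> \<bar>f x\<bar> \<le> L"
        by (rule continuous_on_interval_abs_bounded[OF continuous_on_subset[OF f_cont subset_UNIV]]) blast
      have "\<bar>F x - F y\<bar> \<le> L * \<bar>x - y\<bar>" if "\<bar>x\<bar> \<le> r" "\<bar>y\<bar> \<le> r" for x y
        using field_differentiable_bound[of "{- r..r}" F f L x y] has_field_derivative_at_within[OF F] L that
        by (auto simp: abs_le_iff)
      then show ?thesis by blast
    qed
  qed (use T inv strict phi0 g_car H0 H1_gamma H1 in auto)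
  define E where "E = Sup (ereal ` {\<sigma>. \<sigma> > g0 \<and> (\<exists>d. H3_I T g g0 \<sigma> d)})"
  have sol_iff: "periodic_solution \<phi> f g T s u \<longleftrightarrow> (\<exists>u'. integrated_solution T \<phi> F g s u u')" for s u
    by (rule periodic_solution_iff_integrated[OF T F f_cont g_car])
  have neg: "(\<integral>t. g t (u t) \<partial>M) > s * T"
    if "H3_I T g g0 \<sigma> d" "s \<le> \<sigma>" "C1_periodic T u u'" "\<And>t. t \<in> {0..T} \<Longrightarrow> u t \<le> - d" for \<sigma> d s u u'
  proof -
    have "1 / T * (\<integral>t. g t (u t) \<partial>M) > s"
      using that less_le_trans le_less_trans unfolding H3_I_def C1_T_iff by blast
    then show ?thesis using T by (simp add: field_simps)
  qed
  have pos: "(\<integral>t. g t (u t) \<partial>M) > s * T"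
    if "H4_I T g g0 \<sigma> d" "s \<le> \<sigma>" "C1_periodic T u u'" "\<And>t. t \<in> {0..T} \<Longrightarrow> u t \<ge> d" for \<sigma> d s u u'
  proof -
    have "1 / T * (\<integral>t. g t (u t) \<partial>M) > s"
      using that less_le_trans le_less_trans unfolding H4_I_def C1_T_iff by blast
    then show ?thesis using T by (simp add: field_simps)
  qed
  have below_E: "\<exists>\<sigma> d. H3_I T g g0 \<sigma> d \<and> s < \<sigma>" if "ereal s < E" for s
    using that unfolding E_def less_Sup_iff by auto
  have le_E: "ereal \<sigma> \<le> E" if "H3_I T g g0 \<sigma> d" for \<sigma> d
  proof -
    have "g0 < \<sigma>" using that by (simp add: H3_I_def)
    with that show ?thesis unfolding E_def by (intro Sup_upper imageI CollectI) blast
  qed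
  have solve_below: "\<exists>u u'. integrated_solution T \<phi> F g s u u' \<and> (\<forall>t\<in>{0..T}. u t < b t)"
    if up: "upper_solution T \<phi> F g s1 b b'" "s1 < s" and s: "ereal s < E" for s1 s b b'
  proof -
    obtain \<sigma> d where "H3_I T g g0 \<sigma> d" "s < \<sigma>" using below_E[OF s] by blast
    from neg[OF this(1) less_imp_le[OF this(2)]] show ?thesis
      using solution_below[OF up, of d] by metis
  qed
  define Z where "Z = {s. \<exists>u u'. integrated_solution T \<phi> F g s u u'}"
  \<comment> \<open>By (H2) the constant \<open>u0\<close> is an upper solution for the parameter
    \<open>g0\<close>, which starts the construction before any solution is known.\<close>
  have above: "s \<in> Z" if "g0 < s" "ereal s < E" for s
  proof -
    have "upper_solution T \<phi> F g g0 (\<lambda>_. u0) (\<lambda>_. 0)"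
      unfolding upper_solution_def
    proof (intro conjI allI impI)
      show "C1_periodic T (\<lambda>_. u0) (\<lambda>_. 0)" by (auto simp: C1_periodic_def)
      note gi = Bochner_Integration.integrable_diff[OF g_along_integrable[OF this] integrable_const_M[of g0]]
      fix x y :: real assume xy: "0 \<le> x" "x \<le> y" "y \<le> T"
      note I = integral_eq_lebesgue_indicator[OF gi xy(1,3)]
      have "integral {x..y} (\<lambda>\<tau>. g \<tau> u0 - g0) \<le> (\<integral>t. 0 \<partial>M)"
        unfolding I(1)
      proof (rule integral_mono_AE[OF I(2)])
        show "AE t in M. indicator {x<..<y} t * (g t u0 - g0) \<le> 0"
          using H2 by (rule AE_mp) (auto intro!: AE_I2 simp: indicator_def)
      qed simp
      then show "\<phi> 0 + F u0 + integral {x..y} (\<lambda>\<tau>. g \<tau> u0 - g0) \<le> \<phi> 0 + F u0" by simp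
    qed
    from solve_below[OF this that] show ?thesis by (auto simp: Z_def)
  qed
  \<comment> \<open>A solution for \<open>s1\<close> is itself an upper solution for
    \<open>s1\<close>, so solvability spreads upwards to every parameter below
    \<open>E\<close>.\<close>
  have up_closed: "s \<in> Z" if "s1 \<in> Z" "s1 < s" "ereal s < E" for s1 s
    using that solve_below solution_is_upper unfolding Z_def by blast
  have Z_lower: "s \<ge> - \<Gamma> / T" if "s \<in> Z" for s
  proof -
    from that have "s * T \<ge> - \<Gamma>" using solution_parameter_bound[OF _ \<gamma>_int lower] by (auto simp: Z_def)
    then show ?thesis using T by (simp add: field_simps)
  qed
  then have bdd: "bdd_below Z" by (rule bdd_belowI)
  obtain \<sigma>3 d3 where H3': "H3_I T g g0 \<sigma>3 d3" using H3 by blast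
  have \<sigma>3: "g0 < \<sigma>3" "ereal \<sigma>3 \<le> E" using H3' le_E by (auto simp: H3_I_def)
  \<comment> \<open>A solvable parameter strictly between \<open>g0\<close> and \<open>x\<close>: it
    makes \<open>Z\<close> nonempty and gives \<open>s0 < x\<close>, used for
    \<open>x = \<sigma>3\<close> and \<open>x = S\<close>.\<close>
  have mid: "(g0 + x) / 2 \<in> Z" if "g0 < x" "x \<le> \<sigma>3" for x
  proof (rule above)
    have "ereal ((g0 + x) / 2) < ereal \<sigma>3" using that by simp
    then show "ereal ((g0 + x) / 2) < E" using \<sigma>3(2) by (rule less_le_trans)
  qed (use that in simp)
  define s0 where "s0 = Inf Z"
  have s0_le: "s0 \<le> s" if "s \<in> Z" for s unfolding s0_def by (rule cInf_lower[OF that bdd])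
  have s0_approx: "\<exists>s1\<in>Z. s1 < s" if "s0 < s" for s
    using cInf_lessD[of Z s] mid[OF \<sigma>3(1)] that by (auto simp: s0_def)
  have s0_less: "s0 < x" if "g0 < x" "x \<le> \<sigma>3" for x
    using s0_le[OF mid[OF that]] that by argo
  show ?thesis
    unfolding E_def[symmetric] sol_iff
  proof (intro exI[of _ s0] conjI allI impI)
    have "ereal s0 < ereal \<sigma>3" using s0_less[OF \<sigma>3(1)] by simp
    then show "ereal s0 < E" using \<sigma>3(2) by (rule less_le_trans)
  next
    fix s assume "s0 < s \<and> ereal s < E"
    then have "s \<in> Z" using s0_approx up_closed by blast
    then show "\<exists>u u'. integrated_solution T \<phi> F g s u u'" by (simp add: Z_def)
  next
    fix s assume "s < s0"
    then have "s \<notin> Z" using s0_le by force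
    then show "\<not> (\<exists>u u'. integrated_solution T \<phi> F g s u u')" by (simp add: Z_def)
  next
    assume "\<exists>\<sigma> d. H4_I T g g0 \<sigma> d"
    then obtain \<sigma>4 d4 where H4': "H4_I T g g0 \<sigma>4 d4" by blast
    \<comment> \<open>At the common level \<open>S\<close> both \<open>neg\<close> and
      \<open>pos\<close> apply, and \<open>s0 < S\<close> leaves room for solvable parameters below
      \<open>S\<close> tending to \<open>s0\<close>, whose solutions are then uniformly
      bounded.\<close>
    define S where "S = min \<sigma>3 \<sigma>4"
    have S: "g0 < S" "S \<le> \<sigma>3" "S \<le> \<sigma>4" using \<sigma>3 H4' by (auto simp: S_def H4_I_def)
    have "\<forall>k::nat. \<exists>s u u'. integrated_solution T \<phi> F g s u u' \<and> s < min (s0 + 1 / Suc k) S"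
      using s0_approx s0_less[OF S(1,2)] unfolding Z_def by (fastforce simp: min_def)
    then obtain sk uk uk' where k: "\<And>k. integrated_solution T \<phi> F g (sk k) (uk k) (uk' k)"
      "\<And>k. sk k < min (s0 + 1 / Suc k) S" by metis
    have "sk \<longlonglongrightarrow> s0"
    proof (rule tendsto_sandwich[OF always_eventually always_eventually tendsto_const])
      show "\<forall>k. s0 \<le> sk k" using s0_le k(1) by (auto simp: Z_def)
      show "\<forall>k. sk k \<le> s0 + 1 / Suc k" using k(2) by (simp add: less_imp_le)
      show "(\<lambda>k. s0 + 1 / Suc k) \<longlonglongrightarrow> s0"
        using tendsto_add[OF tendsto_const LIMSEQ_Suc[OF lim_const_over_n[of 1]], of s0] by simp
    qed
    moreover have "\<bar>uk k t\<bar> \<le> \<bar>d3\<bar> + \<bar>d4\<bar> + osc_bound T \<psi> \<Gamma> S" if "t \<in> {0..T}" for k t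
      by (rule solution_bounded[OF k(1) _ neg[OF H3' S(2)] pos[OF H4' S(3)] that])
         (use k(2)[of k] in simp)
    ultimately show "\<exists>u u'. integrated_solution T \<phi> F g s0 u u'"
      by (rule solution_limit[OF k(1)]) (assumption | intro exI)+
  next
    fix s assume s: "s0 < s \<and> ereal s < Sup (ereal ` {\<sigma>. \<sigma> > g0 \<and> ereal \<sigma> \<le> E \<and> (\<exists>d. H4_I T g g0 \<sigma> d)})"
    then obtain \<sigma> d where \<sigma>: "s < \<sigma>" "ereal \<sigma> \<le> E" "H4_I T g g0 \<sigma> d"
      unfolding less_Sup_iff by auto
    have "ereal s < ereal \<sigma>" using \<sigma>(1) by simp
    then have sE: "ereal s < E" using \<sigma>(2) by (rule less_le_trans)
    \<comment> \<open>The solution \<open>b\<close> for a smaller parameter separates the two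
      solutions: the first stays below it everywhere, the second exceeds it at some
      \<open>t\<close>.\<close>
    obtain s1 b b' where b: "integrated_solution T \<phi> F g s1 b b'" "s1 < s"
      using s0_approx[of s] s unfolding Z_def by blast
    note up = solution_is_upper[OF b(1)]
    obtain u1 u1' where u1: "integrated_solution T \<phi> F g s u1 u1'" "\<And>t. t \<in> {0..T} \<Longrightarrow> u1 t < b t"
      using solve_below[OF up b(2) sE] by blast
    obtain u2 u2' where u2_sol: "integrated_solution T \<phi> F g s u2 u2'" and "\<exists>t\<in>{0..T}. u2 t > b t"
      by (rule solution_not_below[OF up b(2) pos[OF \<sigma>(3) less_imp_le[OF \<sigma>(1)]]]) assumption+
    then obtain t where t: "t \<in> {0..T}" "u2 t > b t" by blast
    have "u1 t \<noteq> u2 t" using u1(2)[OF t(1)] t(2) by simp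
    then show "\<exists>u1 u2. (\<exists>u'. integrated_solution T \<phi> F g s u1 u') \<and> (\<exists>u'. integrated_solution T \<phi> F g s u2 u') \<and>
        (\<exists>t\<in>{0..T}. u1 t \<noteq> u2 t)" using u1(1) u2_sol t(1) by blast
  qed
qed

end
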